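(* Let $G$ be a compactly generated locally compact group of polynomial growth, let $\Omega_{\mathbb{T}}\in \mathcal{Z}_b^2(G,\mathbb{T})$, let $\circledast_{\mathbb{T}}$ be the twisted convolution coming from $\Omega_{\mathbb{T}}$, and let $\omega_\beta$ be the polynomial weight $\omega_\beta(s)=(1+\tau(s))^\beta$ on $G$. Let $d:=d(G)$ be the order of growth of $G$, and let $l\geq 1$ be such that $\lim_{x\to0^+}\frac{\Psi(x)}{x^l}$ exists (as a finite limit). If $\beta>\frac{d}{l}$, then $(L^\Phi_{\omega_\beta}(G),\circledast_{\mathbb{T}})$ is a symmetric twisted Orlicz algebra.
   Context: $G$ carries a fixed left Haar measure $ds$, with $\lambda(S)$ the measure of $S$, and a fixed compact symmetric generating neighborhood $U$ of the identity. $G$ has polynomial growth if there are $C>0$ and $d\in\mathbb{N}$ with $\lambda(U^n)\le Cn^d$ for all $n\in\mathbb{N}$, where $U^n=\{u_1\cdots u_n:u_i\in U\}$; the smallest such $d$ is the order of growth $d(G)$, which does not depend on $U$ (such $G$ is unimodular). The length function $\tau=\tau_U:G\to[0,\infty)$ is $\tau(x)=\inf\{n\in\mathbb{N}:x\in U^n\}$ for $x\ne e$ and $\tau(e)=0$. A Young function is a nonzero convex function $\Phi:[0,\infty)\to[0,\infty]$ with $\Phi(0)=0$ and $\lim_{x\to\infty}\Phi(x)=\infty$; its complementary Young function is $\Psi(y)=\sup\{xy-\Phi(x):x\ge 0\}$. Standing assumption: $(\Phi,\Psi)$ is a complementary pair of Young functions with $\Phi$ real-valued and continuous on $[0,\infty)$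 and positive on $(0,\infty)$. $L^\Phi(G)$ is the space of measurable $f:G\to\mathbb{C}$ (modulo a.e. equality) with $\int_G\Phi(\alpha|f(s)|)\,ds<\infty$ for some $\alpha>0$, with norm $\|f\|_\Phi=\sup\{\int_G|f v|\,ds:\int_G\Psi(|v(s)|)\,ds\le 1\}$. $\mathcal{Z}_b^2(G,\mathbb{T})$ is the group of continuous maps $\Omega_{\mathbb{T}}:G\times G\to\mathbb{T}$ (unit circle) with $\Omega_{\mathbb{T}}(r,s)\Omega_{\mathbb{T}}(rs,t)=\Omega_{\mathbb{T}}(s,t)\Omega_{\mathbb{T}}(r,st)$ and $\Omega_{\mathbb{T}}(r,e)=\Omega_{\mathbb{T}}(e,r)=1$. For $\omega:G\to(0,\infty)$ measurable, $L^\Phi_\omega(G)=\{f: f\omega\in L^\Phi(G)\}$ with norm $\|f\|_{\Phi,\omega}=\|f\omega\|_\Phi$. Twisted convolution: $(f\circledast_{\mathbb{T}}g)(t)=\int_G f(s)g(s^{-1}t)\Omega_{\mathbb{T}}(s,s^{-1}t)\,ds$. Involution: $f^*(s)=\overline{f(s^{-1})}\,\overline{\Omega_{\mathbb{T}}(s,s^{-1})}$. That $(L^\Phi_\omega(G),\circledast_{\mathbb{T}})$ is a symmetric twisted Orlicz algebra means: there is $C>0$ with $f\circledast_{\mathbb{T}}g\in L^\Phi_\omega(G)$ and $\|f\circledast_{\mathbb{T}}g\|_{\Phi,\omega}\le C\|f\|_{\Phi,\omega}\|g\|_{\Phi,\omega}$ for all $f,g\in L^\Phi_\omega(G)$, so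 that with the involution $f^*(s)=\overline{f(s^{-1})}\,\overline{\Omega_{\mathbb{T}}(s,s^{-1})}$ it is a Banach $*$-algebra $A$, and $A$ is symmetric, i.e. $\sigma_A(a^*a)\subseteq[0,\infty)$ for every $a\in A$, where $\sigma_A$ denotes the spectrum in $A$ (taken in the unitization if $A$ is non-unital). *)

theory Defs
  imports "HOL-Analysis.Analysis" "HOL-Algebra.Algebraic_Closure_Type"
begin

section \<open>Groups, Haar measure, growth\<close>

text \<open>
  The group \<open>G\<close> is a type of class \<^class>\<open>topological_group_add\<close>. Its underlying class
  \<^class>\<open>group_add\<close> is not assumed commutative, so \<open>G\<close> is an arbitrary topological group, only
  written additively: \<open>x + y\<close> stands for the product $xy$, \<open>- x\<close> for $x^{-1}$ and \<open>0\<close> for $e$.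
\<close>

definition left_haar_measure :: "'g::{topological_group_add, t2_space} measure \<Rightarrow> bool" where
  "left_haar_measure M \<longleftrightarrow>
     sets M = sets borel \<and>
     emeasure M (space M) \<noteq> 0 \<and>
     (\<forall>K. compact K \<longrightarrow> emeasure M K < \<infinity>) \<and>
     (\<forall>A\<in>sets M. emeasure M A = (INF V\<in>{V. open V \<and> A \<subseteq> V}. emeasure M V)) \<and>
     (\<forall>V. open V \<longrightarrow> emeasure M V = (SUP K\<in>{K. compact K \<and> K \<subseteq> V}. emeasure M K)) \<and>
     (\<forall>x. \<forall>A\<in>sets M. emeasure M ((\<lambda>s. x + s) ` A) = emeasure M A)"

definition power_set :: "'g::group_add set \<Rightarrow> nat \<Rightarrow> 'g set" where
  "power_set U n = {sum_list us | us. length us = n \<and> set us \<subseteq> U}"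

definition generating_nbhd :: "'g::topological_group_add set \<Rightarrow> bool" where
  "generating_nbhd U \<longleftrightarrow>
     compact U \<and> uminus ` U = U \<and> 0 \<in> interior U \<and> (\<Union>n\<in>{1..}. power_set U n) = UNIV"

text \<open>Only $n \geq 1$ is considered: at $n = 0$ the bound would fail for discrete groups and $d > 0$.\<close>

definition growth_bound :: "'g::topological_group_add measure \<Rightarrow> 'g set \<Rightarrow> nat \<Rightarrow> bool" where
  "growth_bound M U d \<longleftrightarrow>
     (\<exists>C>0. \<forall>n\<ge>1. emeasure M (power_set U n) \<le> ennreal (C * real n ^ d))"

definition polynomial_growth :: "'g::topological_group_add measure \<Rightarrow> 'g set \<Rightarrow> bool" where
  "polynomial_growth M U \<longleftrightarrow> (\<exists>d. growth_bound M U d)"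

definition growth_order :: "'g::topological_group_add measure \<Rightarrow> 'g set \<Rightarrow> nat" where
  "growth_order M U = (LEAST d. growth_bound M U d)"

definition word_length :: "'g::group_add set \<Rightarrow> 'g \<Rightarrow> nat" where
  "word_length U x = (if x = 0 then 0 else Inf {n. n \<ge> 1 \<and> x \<in> power_set U n})"

definition poly_weight :: "'g::group_add set \<Rightarrow> real \<Rightarrow> 'g \<Rightarrow> real" where
  "poly_weight U \<beta> s = (1 + real (word_length U s)) powr \<beta>"

definition circle_cocycle :: "('g::topological_group_add \<Rightarrow> 'g \<Rightarrow> complex) \<Rightarrow> bool" where
  "circle_cocycle \<Omega> \<longleftrightarrow>
     continuous_on UNIV (\<lambda>(r, s). \<Omega> r s) \<and>
     (\<forall>r s. \<Omega> r s \<in> sphere 0 1) \<and>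
     (\<forall>r s t. \<Omega> r s * \<Omega> (r + s) t = \<Omega> s t * \<Omega> r (s + t)) \<and>
     (\<forall>r. \<Omega> r 0 = 1 \<and> \<Omega> 0 r = 1)"

section \<open>Young functions and weighted Orlicz spaces\<close>

text \<open>
  Young functions are functions \<^typ>\<open>real \<Rightarrow> ennreal\<close> of which only the values on $[0,\infty)$ are
  used.
\<close>

definition young_function :: "(real \<Rightarrow> ennreal) \<Rightarrow> bool" where
  "young_function \<Phi> \<longleftrightarrow>
     (\<exists>x\<ge>0. \<Phi> x \<noteq> 0) \<and>
     (\<forall>x\<ge>0. \<forall>y\<ge>0. \<forall>u\<ge>0. \<forall>v\<ge>0. u + v = 1 \<longrightarrow>
        \<Phi> (u * x + v * y) \<le> ennreal u * \<Phi> x + ennreal v * \<Phi> y) \<and>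
     \<Phi> 0 = 0 \<and>
     (\<Phi> \<longlongrightarrow> \<infinity>) at_top"

text \<open>
  Subtraction on \<^typ>\<open>ennreal\<close> truncates at \<open>0\<close> and \<open>a - \<infinity> = 0\<close> for finite \<open>a\<close>. This leaves the
  supremum unchanged, because \<open>x = 0\<close> contributes the value \<open>0\<close>.
\<close>

definition complementary :: "(real \<Rightarrow> ennreal) \<Rightarrow> real \<Rightarrow> ennreal" where
  "complementary \<Phi> y = (SUP x\<in>{0..}. ennreal (x * y) - \<Phi> x)"

definition complementary_young_pair :: "(real \<Rightarrow> ennreal) \<Rightarrow> (real \<Rightarrow> ennreal) \<Rightarrow> bool" where
  "complementary_young_pair \<Phi> \<Psi> \<longleftrightarrow>
     young_function \<Phi> \<and> young_function \<Psi> \<and> (\<forall>y\<ge>0. \<Psi> y = complementary \<Phi> y)"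

definition orlicz_space :: "'g measure \<Rightarrow> (real \<Rightarrow> ennreal) \<Rightarrow> ('g \<Rightarrow> complex) set" where
  "orlicz_space M \<Phi> =
     {f \<in> borel_measurable M. \<exists>\<alpha>>0. (\<integral>\<^sup>+ s. \<Phi> (\<alpha> * norm (f s)) \<partial>M) < \<infinity>}"

definition orlicz_norm :: "'g measure \<Rightarrow> (real \<Rightarrow> ennreal) \<Rightarrow> ('g \<Rightarrow> complex) \<Rightarrow> ennreal" where
  "orlicz_norm M \<Psi> f =
     (SUP v\<in>{v \<in> borel_measurable M. (\<integral>\<^sup>+ s. \<Psi> (norm (v s)) \<partial>M) \<le> 1}.
        \<integral>\<^sup>+ s. ennreal (norm (f s * v s :: complex)) \<partial>M)"

definition worlicz_space ::
  "'g measure \<Rightarrow> (real \<Rightarrow> ennreal) \<Rightarrow> ('g \<Rightarrow> real) \<Rightarrow> ('g \<Rightarrow> complex) set" where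
  "worlicz_space M \<Phi> \<omega> =
     {f \<in> borel_measurable M. (\<lambda>s. f s * complex_of_real (\<omega> s)) \<in> orlicz_space M \<Phi>}"

definition worlicz_norm ::
  "'g measure \<Rightarrow> (real \<Rightarrow> ennreal) \<Rightarrow> ('g \<Rightarrow> real) \<Rightarrow> ('g \<Rightarrow> complex) \<Rightarrow> ennreal" where
  "worlicz_norm M \<Psi> \<omega> f = orlicz_norm M \<Psi> (\<lambda>s. f s * complex_of_real (\<omega> s))"

definition tconv_integrand ::
  "('g::group_add \<Rightarrow> 'g \<Rightarrow> complex) \<Rightarrow> ('g \<Rightarrow> complex) \<Rightarrow> ('g \<Rightarrow> complex) \<Rightarrow> 'g \<Rightarrow> 'g \<Rightarrow> complex" where
  "tconv_integrand \<Omega> f g t s = f s * g (- s + t) * \<Omega> s (- s + t)"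

definition tconv ::
  "'g::group_add measure \<Rightarrow> ('g \<Rightarrow> 'g \<Rightarrow> complex) \<Rightarrow> ('g \<Rightarrow> complex) \<Rightarrow> ('g \<Rightarrow> complex) \<Rightarrow> 'g \<Rightarrow> complex" where
  "tconv M \<Omega> f g t = (\<integral>s. tconv_integrand \<Omega> f g t s \<partial>M)"

definition tinvol :: "('g::group_add \<Rightarrow> 'g \<Rightarrow> complex) \<Rightarrow> ('g \<Rightarrow> complex) \<Rightarrow> 'g \<Rightarrow> complex" where
  "tinvol \<Omega> f s = cnj (f (- s)) * cnj (\<Omega> s (- s))"

section \<open>Banach *-algebras and symmetry\<close>

text \<open>
  A possibly non-unital complex *-algebra. The field \<open>one\<close> inherited from rings is meaningful
  only when the algebra has an identity (i.e. when \<^const>\<open>Group.monoid\<close> holds); no axiom below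
  mentions it.
\<close>

record 'a star_algebra = "(complex, 'a) module" +
  invol :: "'a \<Rightarrow> 'a"
  vnorm :: "'a \<Rightarrow> real"

text \<open>
  As usual for weighted Orlicz algebras, the norm is submultiplicative only up to a constant.
\<close>

definition banach_star_algebra :: "'a star_algebra \<Rightarrow> bool" where
  "banach_star_algebra A \<longleftrightarrow>
     Module.module (ring_of_type_algebra :: complex ring) A \<and>
     \<comment> \<open>associative algebra\<close>
     (\<forall>x\<in>carrier A. \<forall>y\<in>carrier A. x \<otimes>\<^bsub>A\<^esub> y \<in> carrier A) \<and>
     (\<forall>x\<in>carrier A. \<forall>y\<in>carrier A. \<forall>z\<in>carrier A.
        (x \<otimes>\<^bsub>A\<^esub> y) \<otimes>\<^bsub>A\<^esub> z = x \<otimes>\<^bsub>A\<^esub> (y \<otimes>\<^bsub>A\<^esub> z) \<and>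
        (x \<oplus>\<^bsub>A\<^esub> y) \<otimes>\<^bsub>A\<^esub> z = (x \<otimes>\<^bsub>A\<^esub> z) \<oplus>\<^bsub>A\<^esub> (y \<otimes>\<^bsub>A\<^esub> z) \<and>
        x \<otimes>\<^bsub>A\<^esub> (y \<oplus>\<^bsub>A\<^esub> z) = (x \<otimes>\<^bsub>A\<^esub> y) \<oplus>\<^bsub>A\<^esub> (x \<otimes>\<^bsub>A\<^esub> z)) \<and>
     (\<forall>c. \<forall>x\<in>carrier A. \<forall>y\<in>carrier A.
        (c \<odot>\<^bsub>A\<^esub> x) \<otimes>\<^bsub>A\<^esub> y = c \<odot>\<^bsub>A\<^esub> (x \<otimes>\<^bsub>A\<^esub> y) \<and>
        x \<otimes>\<^bsub>A\<^esub> (c \<odot>\<^bsub>A\<^esub> y) = c \<odot>\<^bsub>A\<^esub> (x \<otimes>\<^bsub>A\<^esub> y)) \<and>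
     \<comment> \<open>complete norm\<close>
     (\<forall>x\<in>carrier A. 0 \<le> vnorm A x \<and> (vnorm A x = 0 \<longleftrightarrow> x = \<zero>\<^bsub>A\<^esub>)) \<and>
     (\<forall>c. \<forall>x\<in>carrier A. vnorm A (c \<odot>\<^bsub>A\<^esub> x) = norm c * vnorm A x) \<and>
     (\<forall>x\<in>carrier A. \<forall>y\<in>carrier A. vnorm A (x \<oplus>\<^bsub>A\<^esub> y) \<le> vnorm A x + vnorm A y) \<and>
     (\<exists>C>0. \<forall>x\<in>carrier A. \<forall>y\<in>carrier A. vnorm A (x \<otimes>\<^bsub>A\<^esub> y) \<le> C * vnorm A x * vnorm A y) \<and>
     (\<forall>F::nat \<Rightarrow> 'a. range F \<subseteq> carrier A \<longrightarrow>
        (\<forall>e>0. \<exists>N. \<forall>m\<ge>N. \<forall>n\<ge>N. vnorm A (F m \<ominus>\<^bsub>A\<^esub> F n) < e) \<longrightarrow>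
        (\<exists>x\<in>carrier A. (\<lambda>n. vnorm A (F n \<ominus>\<^bsub>A\<^esub> x)) \<longlonglongrightarrow> 0)) \<and>
     \<comment> \<open>isometric involution\<close>
     (\<forall>x\<in>carrier A. invol A x \<in> carrier A \<and> invol A (invol A x) = x \<and>
        vnorm A (invol A x) = vnorm A x) \<and>
     (\<forall>x\<in>carrier A. \<forall>y\<in>carrier A.
        invol A (x \<oplus>\<^bsub>A\<^esub> y) = invol A x \<oplus>\<^bsub>A\<^esub> invol A y \<and>
        invol A (x \<otimes>\<^bsub>A\<^esub> y) = invol A y \<otimes>\<^bsub>A\<^esub> invol A x) \<and>
     (\<forall>c. \<forall>x\<in>carrier A. invol A (c \<odot>\<^bsub>A\<^esub> x) = cnj c \<odot>\<^bsub>A\<^esub> invol A x)"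

definition unitization :: "'a star_algebra \<Rightarrow> (complex \<times> 'a) star_algebra" where
  "unitization A =
     \<lparr>carrier = UNIV \<times> carrier A,
      monoid.mult = (\<lambda>(c, x) (d, y).
        (c * d, ((c \<odot>\<^bsub>A\<^esub> y) \<oplus>\<^bsub>A\<^esub> (d \<odot>\<^bsub>A\<^esub> x)) \<oplus>\<^bsub>A\<^esub> (x \<otimes>\<^bsub>A\<^esub> y))),
      one = (1, \<zero>\<^bsub>A\<^esub>),
      zero = (0, \<zero>\<^bsub>A\<^esub>),
      add = (\<lambda>(c, x) (d, y). (c + d, x \<oplus>\<^bsub>A\<^esub> y)),
      smult = (\<lambda>c (d, x). (c * d, c \<odot>\<^bsub>A\<^esub> x)),
      invol = (\<lambda>(c, x). (cnj c, invol A x)),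
      vnorm = (\<lambda>(c, x). norm c + vnorm A x)\<rparr>"

definition unital_spectrum :: "'a star_algebra \<Rightarrow> 'a \<Rightarrow> complex set" where
  "unital_spectrum A a = {c. (c \<odot>\<^bsub>A\<^esub> \<one>\<^bsub>A\<^esub>) \<ominus>\<^bsub>A\<^esub> a \<notin> Units A}"

definition spectrum :: "'a star_algebra \<Rightarrow> 'a \<Rightarrow> complex set" where
  "spectrum A a =
     (if Group.monoid A then unital_spectrum A a
      else unital_spectrum (unitization A) (0, a))"

definition symmetric_star_algebra :: "'a star_algebra \<Rightarrow> bool" where
  "symmetric_star_algebra A \<longleftrightarrow>
     (\<forall>a\<in>carrier A. spectrum A (invol A a \<otimes>\<^bsub>A\<^esub> a) \<subseteq> complex_of_real ` {0..})"

section \<open>Twisted Orlicz algebras\<close>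

definition ae_rel :: "'g measure \<Rightarrow> (('g \<Rightarrow> complex) \<times> ('g \<Rightarrow> complex)) set" where
  "ae_rel M = {(f, g). f \<in> borel_measurable M \<and> g \<in> borel_measurable M \<and> (AE s in M. f s = g s)}"

definition ae_class :: "'g measure \<Rightarrow> ('g \<Rightarrow> complex) \<Rightarrow> ('g \<Rightarrow> complex) set" where
  "ae_class M f = ae_rel M `` {f}"

definition rep :: "('g \<Rightarrow> complex) set \<Rightarrow> 'g \<Rightarrow> complex" where
  "rep F = (SOME f. f \<in> F)"

definition tconv_class ::
  "'g::group_add measure \<Rightarrow> ('g \<Rightarrow> 'g \<Rightarrow> complex) \<Rightarrow>
     ('g \<Rightarrow> complex) set \<Rightarrow> ('g \<Rightarrow> complex) set \<Rightarrow> ('g \<Rightarrow> complex) set" where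
  "tconv_class M \<Omega> F H = ae_class M (tconv M \<Omega> (rep F) (rep H))"

text \<open>
  The field \<open>one\<close> is the identity element if there is one, and arbitrary otherwise.
\<close>

definition orlicz_algebra ::
  "'g::topological_group_add measure \<Rightarrow> (real \<Rightarrow> ennreal) \<Rightarrow> (real \<Rightarrow> ennreal) \<Rightarrow> ('g \<Rightarrow> real) \<Rightarrow>
     ('g \<Rightarrow> 'g \<Rightarrow> complex) \<Rightarrow> ('g \<Rightarrow> complex) set star_algebra" where
  "orlicz_algebra M \<Phi> \<Psi> \<omega> \<Omega> =
     (let L = worlicz_space M \<Phi> \<omega> // ae_rel M in
      \<lparr>carrier = L,
       monoid.mult = tconv_class M \<Omega>,
       one = (THE E. E \<in> L \<and> (\<forall>F\<in>L. tconv_class M \<Omega> E F = F \<and> tconv_class M \<Omega> F E = F)),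
       zero = ae_class M (\<lambda>_. 0),
       add = (\<lambda>F H. ae_class M (\<lambda>s. rep F s + rep H s)),
       smult = (\<lambda>c F. ae_class M (\<lambda>s. c * rep F s)),
       invol = (\<lambda>F. ae_class M (tinvol \<Omega> (rep F))),
       vnorm = (\<lambda>F. enn2real (worlicz_norm M \<Psi> \<omega> (rep F)))\<rparr>)"

text \<open>
  The first clause says that $f \circledast g$ is defined (the integral converges absolutely for
  almost every $t$) and that the twisted convolution is bounded on the weighted Orlicz space.
\<close>

definition symmetric_twisted_orlicz_algebra ::
  "'g::topological_group_add measure \<Rightarrow> (real \<Rightarrow> ennreal) \<Rightarrow> (real \<Rightarrow> ennreal) \<Rightarrow> ('g \<Rightarrow> real) \<Rightarrow>
     ('g \<Rightarrow> 'g \<Rightarrow> complex) \<Rightarrow> bool" where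
  "symmetric_twisted_orlicz_algebra M \<Phi> \<Psi> \<omega> \<Omega> \<longleftrightarrow>
     (\<exists>C>0. \<forall>f\<in>worlicz_space M \<Phi> \<omega>. \<forall>g\<in>worlicz_space M \<Phi> \<omega>.
        (AE t in M. integrable M (tconv_integrand \<Omega> f g t)) \<and>
        tconv M \<Omega> f g \<in> worlicz_space M \<Phi> \<omega> \<and>
        worlicz_norm M \<Psi> \<omega> (tconv M \<Omega> f g)
          \<le> ennreal C * worlicz_norm M \<Psi> \<omega> f * worlicz_norm M \<Psi> \<omega> g) \<and>
     banach_star_algebra (orlicz_algebra M \<Phi> \<Psi> \<omega> \<Omega>) \<and>
     symmetric_star_algebra (orlicz_algebra M \<Phi> \<Psi> \<omega> \<Omega>)"

end

theory Submission
  imports Defs "HOL-Real_Asymp.Real_Asymp"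
begin

text \<open>
  Write \<open>A\<close> for the weighted Orlicz space, \<open>\<omega>\<close> for the weight and \<open>\<tau>\<close> for the word length. Three inequalities carry the theorem.

  The weight satisfies \<open>\<omega> (s + t) \<le> C * (\<omega> s + \<omega> t)\<close>, and the Orlicz norm is invariant under both translations because
  a group of polynomial growth is unimodular (\<open>unimodular\<close>). Hence
  \<open>\<parallel>f \<circledast> g\<parallel> \<le> C * (\<parallel>f\<parallel> * \<parallel>g\<parallel>\<^sub>1 + \<parallel>f\<parallel>\<^sub>1 * \<parallel>g\<parallel>)\<close> (\<open>wnorm_tconv\<close>).
  Second, \<open>\<beta> > d / l\<close> implies that \<open>\<omega>\<^sup>-\<^sup>1 * (1 + \<tau>) powr \<delta>\<close> lies in the dual Orlicz class for some \<open>\<delta> > 0\<close>, so \<open>A\<close> embeds into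
  \<open>L\<^sup>1\<close> even after multiplication by \<open>(1 + \<tau>) powr \<delta>\<close> (\<open>weighted_L1_embedding\<close>). With the first inequality this gives the algebra;
  completeness follows from Fatou's lemma and the fact that finiteness of the norm decides about membership (\<open>orlicz_space_iff\<close>).
  Third, splitting the group into the ball of radius \<open>k\<close> and its complement,
  \<open>\<parallel>f\<parallel>\<^sub>1 \<le> E * k ^ d * \<parallel>f\<parallel>\<^sub>2 + K * k powr (- \<delta>) * \<parallel>f\<parallel>\<close> for all \<open>k \<ge> 1\<close> (\<open>L1_interpolation\<close>).

  Symmetry is a comparison of growth rates. Let \<open>h = a\<^sup>* \<circledast> a\<close> and let \<open>x = \<gamma> + h\<close> in the unitization. By the first
  inequality \<open>\<parallel>x ^ (2 * n)\<parallel>\<close> is bounded by a multiple of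
  \<open>\<parallel>x ^ n\<parallel> * \<parallel>x ^ n\<parallel>\<^sub>1\<close>, so the spectral radius of \<open>x\<close> in \<open>A\<close> is that of \<open>L\<^sup>1\<close>. Elements of
  \<open>A\<close> need not be square integrable, but writing \<open>h = b + e\<close> with \<open>b\<close> bounded and \<open>\<parallel>e\<parallel>\<^sub>1 < \<epsilon>\<close>,
  \<open>\<parallel>x ^ (n + 1)\<parallel>\<^sub>1 \<le> (norm \<gamma> + \<epsilon>) * \<parallel>x ^ n\<parallel>\<^sub>1 + \<parallel>x ^ n \<circledast> b\<parallel>\<^sub>1\<close>, and the last term is controlled by the third inequality
  and the norm of \<open>x\<close> as an operator on \<open>L\<^sup>2\<close>. Taking \<open>k\<close> of exponential size in \<open>n\<close> shows that the rate of \<open>\<parallel>x ^ n\<parallel>\<close> is at most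
  the larger of \<open>norm \<gamma>\<close> and this operator norm (\<open>growth_rate\<close>, \<open>upow_growth\<close>). Now \<open>h\<close> acts on \<open>L\<^sup>2\<close> as a positive operator of norm at
  most \<open>\<parallel>a\<parallel>\<^sub>1\<^sup>2\<close>, so if \<open>2 * Re \<gamma> \<le> - \<parallel>a\<parallel>\<^sub>1\<^sup>2\<close> the operator norm of \<open>x\<close> is at most \<open>norm \<gamma>\<close> (\<open>shifted_square_bound\<close>).
  For \<open>z\<close> outside \<open>[0, \<infinity>)\<close> such a \<open>\<gamma>\<close> exists with \<open>norm \<gamma> < norm (z + \<gamma>)\<close>, and the Neumann series of
  \<open>z - h = (z + \<gamma>) - x\<close> converges in the unitization of \<open>A\<close>.

  Since the group need not have a countable base, convolution integrands are Borel functions on \<open>G \<times> G\<close> that may fail to be measurable for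
  the product of the two Borel algebras. Tonelli's theorem is therefore proved for Borel functions and Radon measures
  (\<open>radon_tonelli\<close>).
\<close>

section \<open>Tonelli's theorem for Borel functions on a product of Radon measures\<close>

text \<open>The part of the Radon property that iterated integration uses. The Borel sets of a product of two
  spaces without countable base need not be generated by the measurable rectangles, so the integrals over the
  product are compared here on its open sets.\<close>

locale radon_measure =
  fixes M :: "'a::t2_space measure"
  assumes sets_eq: "sets M = sets borel"
    and inner_open: "open V \<Longrightarrow> emeasure M V = (SUP K\<in>{K. compact K \<and> K \<subseteq> V}. emeasure M K)"
    and exhaustion: "\<exists>V::nat \<Rightarrow> 'a set. incseq V \<and> (\<Union>n. V n) = UNIV \<and>
      (\<forall>n. open (V n) \<and> emeasure M (V n) < \<infinity>)"
begin

lemma space_eq: "space M = UNIV"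
  using sets_eq by (metis sets_eq_imp_space_eq space_borel)

lemma borel_measurable_eq: "borel_measurable M = borel_measurable borel"
  by (rule measurable_cong_sets) (auto simp: sets_eq)

lemma open_sets: "open V \<Longrightarrow> V \<in> sets M"
  by (simp add: sets_eq)

lemma compact_sets: "compact K \<Longrightarrow> K \<in> sets M"
  by (simp add: sets_eq compact_imp_closed)

lemma sigma_finite: "sigma_finite_measure M"
proof
  obtain V :: "nat \<Rightarrow> 'a set" where V: "(\<Union>n. V n) = UNIV" "\<And>n. open (V n)" "\<And>n. emeasure M (V n) < \<infinity>"
    using exhaustion by auto
  show "\<exists>A. countable A \<and> A \<subseteq> sets M \<and> \<Union> A = space M \<and> (\<forall>a\<in>A. emeasure M a \<noteq> \<infinity>)"
    using V by (intro exI[of _ "range V"]) (auto simp: space_eq open_sets less_top[symmetric])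
qed

end

definition open_rectangles :: "('a::topological_space \<times> 'b::topological_space) set set" where
  "open_rectangles = {\<Union>(A, B)\<in>I. A \<times> B | I. finite I \<and> (\<forall>(A, B)\<in>I. open A \<and> open B)}"

lemma open_rectangles_UN:
  assumes "finite J" "\<And>j. j \<in> J \<Longrightarrow> R j \<in> open_rectangles"
  shows "(\<Union>j\<in>J. R j) \<in> open_rectangles"
proof -
  define P where "P j I \<longleftrightarrow> finite I \<and> (\<forall>(A, B)\<in>I. open A \<and> open B) \<and> R j = (\<Union>(A, B)\<in>I. A \<times> B)" for j I
  have "\<exists>I. P j I" if j: "j \<in> J" for j
  proof -
    have "\<exists>I. R j = (\<Union>(A, B)\<in>I. A \<times> B) \<and> finite I \<and> (\<forall>(A, B)\<in>I. open A \<and> open B)"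
      using assms(2)[OF j] by (simp only: open_rectangles_def mem_Collect_eq)
    then obtain I where "R j = (\<Union>(A, B)\<in>I. A \<times> B) \<and> finite I \<and> (\<forall>(A, B)\<in>I. open A \<and> open B)" ..
    then have "P j I" unfolding P_def by simp
    then show ?thesis ..
  qed
  then have "\<exists>I. \<forall>j\<in>J. P j (I j)" by (intro bchoice) blast
  then obtain I where "\<forall>j\<in>J. P j (I j)" ..
  note I = bspec[OF this, unfolded P_def]
  have "(\<Union>j\<in>J. R j) = (\<Union>j\<in>J. \<Union>(A, B)\<in>I j. A \<times> B)"
    by (rule SUP_cong) (use I in auto)
  also have "\<dots> = (\<Union>(A, B)\<in>(\<Union>j\<in>J. I j). A \<times> B)"
    by blast
  finally have "(\<Union>j\<in>J. R j) = (\<Union>(A, B)\<in>(\<Union>j\<in>J. I j). A \<times> B)" .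
  moreover have "finite (\<Union>j\<in>J. I j)" using I assms(1) by auto
  moreover have "\<forall>(A, B)\<in>(\<Union>j\<in>J. I j). open A \<and> open B" using I by fast
  ultimately show ?thesis
    unfolding open_rectangles_def by blast
qed

lemma open_rectangles_open: "R \<in> open_rectangles \<Longrightarrow> open R"
  unfolding open_rectangles_def by (auto intro!: open_UN open_Times)

lemma sets_slice:
  assumes "E \<in> sets (borel :: ('a::topological_space \<times> 'b::topological_space) measure)"
  shows "{y. (x, y) \<in> E} \<in> sets borel" "{x. (x, y) \<in> E} \<in> sets borel"
proof -
  have "(\<lambda>y::'b. (x, y)) \<in> borel_measurable borel" "(\<lambda>x::'a. (x, y)) \<in> borel_measurable borel"
    by (auto intro!: borel_measurable_continuous_onI continuous_intros)
  from this[THEN measurable_sets, OF assms]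
  show "{y. (x, y) \<in> E} \<in> sets borel" "{x. (x, y) \<in> E} \<in> sets borel"
    by (auto simp: vimage_def)
qed

text \<open>A compact subset of the slice at \<open>x0\<close> is covered by the sides of finitely many open boxes inside \<open>W\<close>; the
  intersection of the other sides is the neighbourhood \<open>T\<close>.\<close>

lemma (in radon_measure) slice_inner_approx:
  fixes W :: "('b::topological_space \<times> 'a) set"
  assumes "open W" and a: "a < emeasure M {y. (x0, y) \<in> W}"
  shows "\<exists>T R. open T \<and> x0 \<in> T \<and> R \<in> open_rectangles \<and> R \<subseteq> W \<and>
    (\<forall>x\<in>T. a < emeasure M {y. (x, y) \<in> R})"
proof -
  have "open ((\<lambda>y. (x0, y)) -` W)"
    by (intro open_vimage assms continuous_intros)
  then have oW: "open {y. (x0, y) \<in> W}" by (simp add: vimage_def)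
  obtain K where K: "compact K" "K \<subseteq> {y. (x0, y) \<in> W}" "a < emeasure M K"
    using a unfolding inner_open[OF oW] by (auto simp: less_SUP_iff)
  have "\<forall>y\<in>K. \<exists>A B. open A \<and> open B \<and> x0 \<in> A \<and> y \<in> B \<and> A \<times> B \<subseteq> W"
  proof
    fix y assume "y \<in> K"
    then have "(x0, y) \<in> W" using K(2) by blast
    then show "\<exists>A B. open A \<and> open B \<and> x0 \<in> A \<and> y \<in> B \<and> A \<times> B \<subseteq> W"
      by (rule open_prod_elim[OF assms(1)]) auto
  qed
  then obtain A B where AB: "\<And>y. y \<in> K \<Longrightarrow> open (A y) \<and> open (B y) \<and> x0 \<in> A y \<and> y \<in> B y \<and> A y \<times> B y \<subseteq> W"
    by metis
  obtain Y where Y: "Y \<subseteq> K" "finite Y" "K \<subseteq> (\<Union>y\<in>Y. B y)"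
    using compactE_image[OF K(1), of K B] AB by blast
  define T where "T = (\<Inter>y\<in>Y. A y)"
  define R where "R = (\<Union>y\<in>Y. T \<times> B y)"
  have "open T" "x0 \<in> T" unfolding T_def using AB Y by auto
  moreover have "R \<in> open_rectangles"
    unfolding R_def open_rectangles_def using Y AB \<open>open T\<close>
    by (auto intro!: exI[of _ "(\<lambda>y. (T, B y)) ` Y"])
  moreover have "R \<subseteq> W" unfolding R_def T_def using AB Y by fast
  moreover have "a < emeasure M {y. (x, y) \<in> R}" if "x \<in> T" for x
  proof -
    have "K \<subseteq> {y. (x, y) \<in> R}" using Y(3) that by (auto simp: R_def)
    moreover have "{y. (x, y) \<in> R} \<in> sets M"
      using sets_slice(1)[of R x] open_rectangles_open[OF \<open>R \<in> open_rectangles\<close>] by (auto simp: sets_eq)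
    ultimately show ?thesis using K(3) by (meson emeasure_mono less_le_trans)
  qed
  ultimately show ?thesis by blast
qed

lemma (in radon_measure) open_slice_levels:
  fixes W :: "('b::topological_space \<times> 'a) set"
  assumes "open W"
  shows "open {x. a < emeasure M {y. (x, y) \<in> W}}"
proof (subst open_subopen, safe)
  fix x0 assume a: "a < emeasure M {y. (x0, y) \<in> W}"
  obtain T R where T: "open T" "x0 \<in> T" "R \<in> open_rectangles" "R \<subseteq> W"
      "\<And>x. x \<in> T \<Longrightarrow> a < emeasure M {y. (x, y) \<in> R}"
    using slice_inner_approx[OF assms a] by metis
  have "a < emeasure M {y. (x, y) \<in> W}" if "x \<in> T" for x
  proof -
    have "emeasure M {y. (x, y) \<in> R} \<le> emeasure M {y. (x, y) \<in> W}"
      using T(4) sets_slice(1)[of W x] assms by (intro emeasure_mono) (auto simp: sets_eq)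
    then show ?thesis using T(5)[OF that] by simp
  qed
  then show "\<exists>T. open T \<and> x0 \<in> T \<and> T \<subseteq> {x. a < emeasure M {y. (x, y) \<in> W}}"
    using T by blast
qed

text \<open>Serves to choose the compact sets for all layers of a layer cake at once.\<close>

lemma less_sum_SUP_choice:
  fixes g :: "'i \<Rightarrow> 'x \<Rightarrow> ennreal"
  assumes "finite I" "\<And>k. k \<in> I \<Longrightarrow> S k \<noteq> {}" "a < c + (\<Sum>k\<in>I. SUP x\<in>S k. g k x)"
  shows "\<exists>x. (\<forall>k\<in>I. x k \<in> S k) \<and> a < c + (\<Sum>k\<in>I. g k (x k))"
  using assms
proof (induction I arbitrary: c rule: finite_induct)
  case (insert i I)
  let ?s = "\<Sum>k\<in>I. SUP x\<in>S k. g k x"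
  have "a < (c + ?s) + (SUP x\<in>S i. g i x)"
    using insert.prems insert.hyps by (simp add: add_ac)
  also have "\<dots> = (SUP x\<in>S i. (c + ?s) + g i x)"
    using insert.prems by (subst ennreal_SUP_add_right) auto
  finally obtain y where y: "y \<in> S i" "a < (c + ?s) + g i y" by (auto simp: less_SUP_iff)
  then have "a < (c + g i y) + ?s" by (simp add: add_ac)
  from insert.IH[OF _ this] insert.prems obtain x where
    x: "\<forall>k\<in>I. x k \<in> S k" "a < (c + g i y) + (\<Sum>k\<in>I. g k (x k))" by auto
  have "(\<Sum>k\<in>I. g k ((x(i := y)) k)) = (\<Sum>k\<in>I. g k (x k))"
    using insert.hyps by (intro sum.cong) auto
  then show ?case
    using x y insert.hyps by (intro exI[of _ "x(i := y)"]) (auto simp: add_ac)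
qed auto

lemma sum_indicator_card:
  "finite I \<Longrightarrow> (\<Sum>k\<in>I. indicator (V k) x :: ennreal) = of_nat (card {k\<in>I. x \<in> V k})"
  by (simp add: indicator_def Int_def)

text \<open>The \<open>n\<close>-th sum is the staircase of step \<open>1 / Suc n\<close> below \<open>y\<close>, cut off at height \<open>Suc n\<close>.\<close>

lemma layer_sum_liminf:
  fixes y :: ennreal
  shows "y \<le> liminf (\<lambda>n. ennreal (1 / real (Suc n)) * of_nat (card {k\<in>{1..(Suc n)\<^sup>2}. ennreal (real k / real (Suc n)) < y}))"
    (is "_ \<le> liminf ?h")
proof (rule dense_le)
  fix b assume "b < y"
  then obtain b' where b': "b < b'" "b' < y" using dense by blast
  obtain r where r: "b = ennreal r" "0 \<le> r" using b' by (cases b) auto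
  obtain r' where r': "b' = ennreal r'" "0 \<le> r'" using b' by (cases b') auto
  have rr: "r < r'" using b'(1) r r' by (simp add: ennreal_less_iff)
  obtain N where N: "r' \<le> real N" "1 / (r' - r) \<le> real N"
    by (metis linear order.trans real_arch_simple)
  have "b \<le> ?h n" if n: "n \<ge> N" for n
  proof -
    let ?m = "nat \<lfloor>real (Suc n) * r'\<rfloor>"
    have "{1..?m} \<subseteq> {k\<in>{1..(Suc n)\<^sup>2}. ennreal (real k / real (Suc n)) < y}"
    proof safe
      fix k assume k: "k \<in> {1..?m}"
      then have "real k \<le> real ?m" by simp
      also have "\<dots> \<le> real (Suc n) * r'" using r' by (intro of_nat_floor) auto
      finally have k2: "real k \<le> real (Suc n) * r'" .
      then have "real k / real (Suc n) \<le> r'" by (simp add: field_simps)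
      then have "ennreal (real k / real (Suc n)) \<le> b'" unfolding r' by (rule ennreal_leI)
      then show "ennreal (real k / real (Suc n)) < y" using b' by simp
      have "real k \<le> real (Suc n) * real (Suc n)"
        using k2 N(1) n by (meson le_Suc_eq mult_left_mono of_nat_0_le_iff of_nat_mono order.trans)
      then have "real k \<le> real ((Suc n)\<^sup>2)" by (simp only: power2_eq_square of_nat_mult)
      then have "k \<le> (Suc n)\<^sup>2" by (simp only: of_nat_le_iff)
      then show "k \<in> {1..(Suc n)\<^sup>2}" using k by simp
    qed
    then have "card {1..?m} \<le> card {k\<in>{1..(Suc n)\<^sup>2}. ennreal (real k / real (Suc n)) < y}"
      by (intro card_mono) auto
    then have "?m \<le> card {k\<in>{1..(Suc n)\<^sup>2}. ennreal (real k / real (Suc n)) < y}" by simp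
    then have 1: "ennreal (1 / real (Suc n)) * of_nat ?m \<le> ?h n"
      by (intro mult_left_mono) auto
    have "1 \<le> (r' - r) * real (Suc n)"
    proof -
      have "1 = (r' - r) * (1 / (r' - r))" using rr by simp
      also have "\<dots> \<le> (r' - r) * real (Suc n)" using rr N(2) n by (intro mult_left_mono) auto
      finally show ?thesis .
    qed
    then have "real (Suc n) * r \<le> real (Suc n) * r' - 1" by (simp add: algebra_simps)
    also have "\<dots> \<le> real ?m" using r' by (simp add: of_nat_nat)
    finally have "r \<le> 1 / real (Suc n) * real ?m" by (simp add: field_simps)
    then have "b \<le> ennreal (1 / real (Suc n)) * of_nat ?m"
      unfolding r by (metis ennreal_leI ennreal_mult ennreal_of_nat_eq_real_of_nat of_nat_0_le_iff zero_le_divide_1_iff)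
    then show ?thesis using 1 by simp
  qed
  then show "b \<le> liminf ?h"
    by (intro Liminf_bounded) (auto simp: eventually_sequentially)
qed

text \<open>The layer cake formula with inner regularity: the superlevel sets of \<open>x \<mapsto> N {y. (x, y) \<in> W}\<close> are open, compact
  sets fill them up to a small error, and above each of these compact sets finitely many boxes inside \<open>W\<close> suffice.\<close>

lemma open_iterated_approx:
  fixes M :: "'a::t2_space measure" and N :: "'b::t2_space measure"
  assumes M: "radon_measure M" and N: "radon_measure N" and W: "open W"
    and a: "a < (\<integral>\<^sup>+x. emeasure N {y. (x, y) \<in> W} \<partial>M)"
  shows "\<exists>R\<in>open_rectangles. R \<subseteq> W \<and> a < (\<integral>\<^sup>+x. emeasure N {y. (x, y) \<in> R} \<partial>M)"
proof -
  interpret M: radon_measure M by fact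
  interpret N: radon_measure N by fact
  let ?h = "\<lambda>x. emeasure N {y. (x, y) \<in> W}"
  let ?V = "\<lambda>n k. {x. ennreal (real k / real (Suc n)) < ?h x}"
  have oV: "open (?V n k)" for n k by (rule N.open_slice_levels[OF W])
  let ?H = "\<lambda>n x. ennreal (1 / real (Suc n)) * (\<Sum>k\<in>{1..(Suc n)\<^sup>2}. indicator (?V n k) x)"
  have Hm[measurable]: "?H n \<in> borel_measurable M" for n
    using M.open_sets[OF oV] by measurable
  have H: "?H n x = ennreal (1 / real (Suc n)) * of_nat (card {k\<in>{1..(Suc n)\<^sup>2}. ennreal (real k / real (Suc n)) < ?h x})" for n x
    by (subst sum_indicator_card) auto
  have "a < (\<integral>\<^sup>+x. liminf (\<lambda>n. ?H n x) \<partial>M)"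
    using a by (rule less_le_trans) (auto simp only: H intro!: nn_integral_mono layer_sum_liminf)
  also have "\<dots> \<le> liminf (\<lambda>n. \<integral>\<^sup>+x. ?H n x \<partial>M)" by (rule nn_integral_liminf) (rule Hm)
  finally have "eventually (\<lambda>n. a < (\<integral>\<^sup>+x. ?H n x \<partial>M)) sequentially" by (rule less_LiminfD)
  then have "\<exists>n. a < (\<integral>\<^sup>+x. ?H n x \<partial>M)"
    by (rule eventually_happens'[OF sequentially_bot])
  then obtain n where n: "a < (\<integral>\<^sup>+x. ?H n x \<partial>M)" by blast
  let ?I = "{1..(Suc n)\<^sup>2}"
  have intH: "(\<integral>\<^sup>+x. ennreal (1 / real (Suc n)) * (\<Sum>k\<in>?I. indicator (V k) x) \<partial>M) =
      (\<Sum>k\<in>?I. ennreal (1 / real (Suc n)) * emeasure M (V k))"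
    if "\<And>k. k \<in> ?I \<Longrightarrow> V k \<in> sets M" for V :: "nat \<Rightarrow> 'a set"
  proof -
    have "(\<integral>\<^sup>+x. ennreal (1 / real (Suc n)) * (\<Sum>k\<in>?I. indicator (V k) x) \<partial>M) =
        ennreal (1 / real (Suc n)) * (\<integral>\<^sup>+x. (\<Sum>k\<in>?I. indicator (V k) x) \<partial>M)"
      using that by (intro nn_integral_cmult) auto
    also have "(\<integral>\<^sup>+x. (\<Sum>k\<in>?I. indicator (V k) x) \<partial>M) = (\<Sum>k\<in>?I. \<integral>\<^sup>+x. indicator (V k) x \<partial>M)"
      using that by (intro nn_integral_sum) auto
    also have "\<dots> = (\<Sum>k\<in>?I. emeasure M (V k))"
      using that by (intro sum.cong) auto
    finally show ?thesis by (simp add: sum_distrib_left)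
  qed
  have less: "a < 0 + (\<Sum>k\<in>?I. SUP K\<in>{K. compact K \<and> K \<subseteq> ?V n k}. ennreal (1 / real (Suc n)) * emeasure M K)"
    using n unfolding intH[OF M.open_sets[OF oV]] M.inner_open[OF oV] by (simp add: SUP_mult_left_ennreal)
  have "{K. compact K \<and> K \<subseteq> ?V n k} \<noteq> {}" for k
    using compact_empty by blast
  from less_sum_SUP_choice[OF finite_atLeastAtMost this less]
  obtain K where K0: "(\<forall>k\<in>?I. K k \<in> {K. compact K \<and> K \<subseteq> ?V n k}) \<and>
      a < 0 + (\<Sum>k\<in>?I. ennreal (1 / real (Suc n)) * emeasure M (K k))" ..
  have K: "compact (K k) \<and> K k \<subseteq> ?V n k" if "k \<in> ?I" for k
    using bspec[OF conjunct1[OF K0] that] by (rule CollectD)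
  have aK: "a < (\<Sum>k\<in>?I. ennreal (1 / real (Suc n)) * emeasure M (K k))"
    using conjunct2[OF K0] by (simp only: add_0)
  have "\<exists>R. R \<in> open_rectangles \<and> R \<subseteq> W \<and>
      (\<forall>x\<in>K k. ennreal (real k / real (Suc n)) < emeasure N {y. (x, y) \<in> R})" if k: "k \<in> ?I" for k
  proof -
    let ?a = "ennreal (real k / real (Suc n))"
    have "\<exists>T R. open T \<and> x0 \<in> T \<and> R \<in> open_rectangles \<and> R \<subseteq> W \<and>
        (\<forall>x\<in>T. ?a < emeasure N {y. (x, y) \<in> R})" if "x0 \<in> K k" for x0
      using K[OF k] that by (intro N.slice_inner_approx W) auto
    then obtain T R where XR: "\<And>x0. x0 \<in> K k \<Longrightarrow> open (T x0) \<and> x0 \<in> T x0 \<and> R x0 \<in> open_rectangles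
        \<and> R x0 \<subseteq> W \<and> (\<forall>x\<in>T x0. ?a < emeasure N {y. (x, y) \<in> R x0})" by metis
    obtain J where J: "J \<subseteq> K k" "finite J" "K k \<subseteq> (\<Union>x\<in>J. T x)"
      using compactE_image[of "K k" "K k" T] K[OF k] XR by blast
    have RJ: "(\<Union>j\<in>J. R j) \<in> open_rectangles" using J XR by (intro open_rectangles_UN) auto
    have "?a < emeasure N {y. (x, y) \<in> (\<Union>j\<in>J. R j)}" if xk: "x \<in> K k" for x
    proof -
      obtain j where j: "j \<in> J" "x \<in> T j" using J xk by blast
      have "emeasure N {y. (x, y) \<in> R j} \<le> emeasure N {y. (x, y) \<in> (\<Union>j\<in>J. R j)}"
        using j sets_slice(1)[of "\<Union>j\<in>J. R j" x] open_rectangles_open[OF RJ]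
        by (intro emeasure_mono) (auto simp: N.sets_eq)
      moreover have "?a < emeasure N {y. (x, y) \<in> R j}" using XR J j by blast
      ultimately show ?thesis by simp
    qed
    moreover have "(\<Union>j\<in>J. R j) \<subseteq> W" using XR J by blast
    ultimately show ?thesis using RJ by blast
  qed
  then obtain R where R: "\<And>k. k \<in> ?I \<Longrightarrow> R k \<in> open_rectangles \<and> R k \<subseteq> W \<and>
      (\<forall>x\<in>K k. ennreal (real k / real (Suc n)) < emeasure N {y. (x, y) \<in> R k})" by metis
  define Q where "Q = (\<Union>k\<in>?I. R k)"
  have Q: "Q \<in> open_rectangles" "Q \<subseteq> W"
    unfolding Q_def using R by (blast intro: open_rectangles_UN)+
  have le: "ennreal (1 / real (Suc n)) * (\<Sum>k\<in>?I. indicator (K k) x) \<le> emeasure N {y. (x, y) \<in> Q}" for x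
  proof -
    let ?C = "{k\<in>?I. x \<in> K k}"
    have s: "(\<Sum>k\<in>?I. indicator (K k) x :: ennreal) = of_nat (card ?C)"
      by (subst sum_indicator_card) auto
    show ?thesis
    proof (cases "?C = {}")
      case True then show ?thesis unfolding s True by simp
    next
      case False
      \<comment> \<open>if \<open>x\<close> lies in \<open>c\<close> of the compact sets, the last of them has index \<open>m \<ge> c\<close>, and \<open>R m\<close> alone has a slice of measure at least \<open>m / Suc n\<close>\<close>
      define m where "m = Max ?C"
      have m: "m \<in> ?C" unfolding m_def using False by (intro Max_in) auto
      have "?C \<subseteq> {1..m}" unfolding m_def by auto
      then have "card ?C \<le> m" using card_mono[of "{1..m}" ?C] by simp
      then have "1 / real (Suc n) * real (card ?C) \<le> real m / real (Suc n)"
        by (simp add: divide_right_mono)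
      then have "ennreal (1 / real (Suc n)) * of_nat (card ?C) \<le> ennreal (real m / real (Suc n))"
        by (metis ennreal_leI ennreal_mult ennreal_of_nat_eq_real_of_nat of_nat_0_le_iff zero_le_divide_1_iff)
      also have "\<dots> \<le> emeasure N {y. (x, y) \<in> R m}" using R m by (auto intro: less_imp_le)
      also have "\<dots> \<le> emeasure N {y. (x, y) \<in> Q}"
        using m sets_slice(1)[of Q x] open_rectangles_open[OF Q(1)]
        by (intro emeasure_mono) (auto simp: N.sets_eq Q_def)
      finally show ?thesis unfolding s .
    qed
  qed
  have "a < (\<integral>\<^sup>+x. ennreal (1 / real (Suc n)) * (\<Sum>k\<in>?I. indicator (K k) x) \<partial>M)"
    using aK K M.compact_sets by (subst intH) auto
  also have "\<dots> \<le> (\<integral>\<^sup>+x. emeasure N {y. (x, y) \<in> Q} \<partial>M)"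
    by (intro nn_integral_mono le)
  finally show ?thesis using Q by blast
qed

lemma rectangles_iterated_eq:
  fixes M :: "'a::t2_space measure" and N :: "'b::t2_space measure"
  assumes M: "radon_measure M" and N: "radon_measure N" and R: "R \<in> open_rectangles"
  shows "(\<integral>\<^sup>+x. emeasure N {y. (x, y) \<in> R} \<partial>M) = (\<integral>\<^sup>+y. emeasure M {x. (x, y) \<in> R} \<partial>N)"
proof -
  interpret M: radon_measure M by fact
  interpret N: radon_measure N by fact
  interpret pair_sigma_finite M N
    using M.sigma_finite N.sigma_finite by (simp add: pair_sigma_finite_def)
  have "R \<in> sets (M \<Otimes>\<^sub>M N)"
  proof -
    obtain I where I: "R = (\<Union>(A, B)\<in>I. A \<times> B)" "finite I" "\<forall>(A, B)\<in>I. open A \<and> open B"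
      using R by (auto simp: open_rectangles_def)
    then show ?thesis unfolding I(1)
      by (intro sets.finite_UN) (auto intro!: pair_measureI M.open_sets N.open_sets)
  qed
  then have "(\<lambda>(x, y). indicator R (x, y) :: ennreal) \<in> borel_measurable (M \<Otimes>\<^sub>M N)" by simp
  from Fubini'[OF this]
  have "(\<integral>\<^sup>+ y. (\<integral>\<^sup>+ x. indicator R (x, y) \<partial>M) \<partial>N) = (\<integral>\<^sup>+ x. (\<integral>\<^sup>+ y. indicator R (x, y) \<partial>N) \<partial>M)" .
  moreover have "(\<integral>\<^sup>+ x. indicator R (x, y) \<partial>M) = emeasure M {x. (x, y) \<in> R}" for y
  proof -
    have "{x. (x, y) \<in> R} \<in> sets M"
      using sets_slice(2)[of R y] open_rectangles_open[OF R] by (auto simp: M.sets_eq)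
    from nn_integral_indicator[OF this] show ?thesis by (simp add: indicator_def)
  qed
  moreover have "(\<integral>\<^sup>+ y. indicator R (x, y) \<partial>N) = emeasure N {y. (x, y) \<in> R}" for x
  proof -
    have "{y. (x, y) \<in> R} \<in> sets N"
      using sets_slice(1)[of R x] open_rectangles_open[OF R] by (auto simp: N.sets_eq)
    from nn_integral_indicator[OF this] show ?thesis by (simp add: indicator_def)
  qed
  ultimately show ?thesis by simp
qed

lemma open_iterated_le:
  fixes M :: "'a::t2_space measure" and N :: "'b::t2_space measure"
  assumes M: "radon_measure M" and N: "radon_measure N" and W: "open W"
  shows "(\<integral>\<^sup>+x. emeasure N {y. (x, y) \<in> W} \<partial>M) \<le> (\<integral>\<^sup>+y. emeasure M {x. (x, y) \<in> W} \<partial>N)"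
proof (rule dense_le)
  interpret M: radon_measure M by fact
  fix a assume "a < (\<integral>\<^sup>+x. emeasure N {y. (x, y) \<in> W} \<partial>M)"
  from open_iterated_approx[OF M N W this] obtain R where R: "R \<in> open_rectangles" "R \<subseteq> W"
    "a < (\<integral>\<^sup>+x. emeasure N {y. (x, y) \<in> R} \<partial>M)" by blast
  have "emeasure M {x. (x, y) \<in> R} \<le> emeasure M {x. (x, y) \<in> W}" for y
    using R(2) sets_slice(2)[of W y] W by (intro emeasure_mono) (auto simp: M.sets_eq)
  then have "(\<integral>\<^sup>+y. emeasure M {x. (x, y) \<in> R} \<partial>N) \<le> (\<integral>\<^sup>+y. emeasure M {x. (x, y) \<in> W} \<partial>N)"
    by (intro nn_integral_mono)
  then show "a \<le> (\<integral>\<^sup>+y. emeasure M {x. (x, y) \<in> W} \<partial>N)"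
    using R(3) rectangles_iterated_eq[OF M N R(1)] by simp
qed

lemma open_iterated_eq:
  fixes M :: "'a::t2_space measure" and N :: "'b::t2_space measure"
  assumes M: "radon_measure M" and N: "radon_measure N" and W: "open W"
  shows "(\<integral>\<^sup>+x. emeasure N {y. (x, y) \<in> W} \<partial>M) = (\<integral>\<^sup>+y. emeasure M {x. (x, y) \<in> W} \<partial>N)"
proof (rule antisym[OF open_iterated_le[OF M N W]])
  have "open ((\<lambda>(y, x). (x, y)) -` W)"
    by (intro open_vimage W) (auto simp: split_beta' intro!: continuous_intros)
  from open_iterated_le[OF N M this]
  show "(\<integral>\<^sup>+y. emeasure M {x. (x, y) \<in> W} \<partial>N) \<le> (\<integral>\<^sup>+x. emeasure N {y. (x, y) \<in> W} \<partial>M)"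
    by simp
qed

text \<open>For open sets the function is lower semicontinuous. The passage to Borel sets is a Dynkin argument, run inside
  sets of finite measure so that complements can be subtracted.\<close>

lemma (in radon_measure) measurable_slice:
  fixes E :: "('b::t2_space \<times> 'a) set"
  assumes E: "E \<in> sets borel"
  shows "(\<lambda>x. emeasure M {y. (x, y) \<in> E}) \<in> borel_measurable borel"
proof -
  have lsc: "(\<lambda>x. emeasure M {y. (x, y) \<in> W}) \<in> borel_measurable borel" if "open W" for W :: "('b \<times> 'a) set"
    using open_slice_levels[OF that] by (intro borel_measurableI_greater) auto
  obtain V :: "nat \<Rightarrow> 'a set" where V: "incseq V" "(\<Union>n. V n) = UNIV" "\<And>n. open (V n)" "\<And>n. emeasure M (V n) < \<infinity>"
    using exhaustion by auto
  have Vs[simp]: "{y. P y \<and> y \<in> V n} \<in> sets M" if "{y. P y} \<in> sets M" for P n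
    using that V(3)[of n] by (auto simp: sets_eq intro!: sets.Int[of "{y. P y}" _ "V n", simplified Int_def, simplified])
  have sl: "{y. (x, y) \<in> A} \<in> sets M" if "A \<in> sets borel" for A :: "('b \<times> 'a) set" and x
    using sets_slice(1)[OF that] by (simp add: sets_eq)
  have *: "(\<lambda>x. emeasure M {y. (x, y) \<in> E \<and> y \<in> V n}) \<in> borel_measurable borel" for n
  proof -
    have gen: "sets (borel :: ('b \<times> 'a) measure) = sigma_sets UNIV {S. open S}" by (simp add: borel_def)
    have E': "E \<in> sigma_sets UNIV {S. open S}" using E by (simp add: gen)
    have "Int_stable {S::('b \<times> 'a) set. open S}" "{S::('b \<times> 'a) set. open S} \<subseteq> Pow UNIV"
      by (auto simp: Int_stable_def)
    then show ?thesis using E'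
    proof (induct rule: sigma_sets_induct_disjoint)
      case (basic W)
      have "open ((\<lambda>p. snd p) -` V n :: ('b \<times> 'a) set)" by (intro open_vimage V continuous_intros)
      then have "open (W \<inter> snd -` V n)" using basic by auto
      from lsc[OF this] show ?case by simp
    next
      case (compl A)
      have A: "A \<in> sets borel" using compl by (simp add: gen)
      have "emeasure M {y. (x, y) \<in> UNIV - A \<and> y \<in> V n} = emeasure M (V n) - emeasure M {y. (x, y) \<in> A \<and> y \<in> V n}" for x
      proof -
        have "{y. (x, y) \<in> UNIV - A \<and> y \<in> V n} = V n - {y. (x, y) \<in> A \<and> y \<in> V n}" by auto
        moreover have "emeasure M {y. (x, y) \<in> A \<and> y \<in> V n} \<noteq> \<infinity>"
        proof -
          have "emeasure M {y. (x, y) \<in> A \<and> y \<in> V n} \<le> emeasure M (V n)"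
            using V(3) by (intro emeasure_mono) (auto simp: sets_eq)
          then show ?thesis using V(4)[of n] by (auto simp: top_unique)
        qed
        ultimately show ?thesis using V(3) Vs[OF sl[OF A]]
          by (simp add: emeasure_Diff open_sets subset_eq)
      qed
      then show ?case using compl by simp
    next
      case (union A)
      have A: "A i \<in> sets borel" for i using union by (auto simp: gen)
      have "emeasure M {y. (x, y) \<in> (\<Union>i. A i) \<and> y \<in> V n} = (\<Sum>i. emeasure M {y. (x, y) \<in> A i \<and> y \<in> V n})" for x
      proof -
        have "{y. (x, y) \<in> (\<Union>i. A i) \<and> y \<in> V n} = (\<Union>i. {y. (x, y) \<in> A i \<and> y \<in> V n})" by auto
        moreover have "disjoint_family (\<lambda>i. {y. (x, y) \<in> A i \<and> y \<in> V n})"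
          using union(1) by (auto simp: disjoint_family_on_def)
        ultimately show ?thesis using Vs[OF sl[OF A]] by (simp add: suminf_emeasure image_subset_iff)
      qed
      then show ?case using union by simp
    qed auto
  qed
  have "emeasure M {y. (x, y) \<in> E} = (SUP n. emeasure M {y. (x, y) \<in> E \<and> y \<in> V n})" for x
  proof -
    have "{y. (x, y) \<in> E} = (\<Union>n. {y. (x, y) \<in> E \<and> y \<in> V n})" using V(2) by auto
    moreover have "incseq (\<lambda>n. {y. (x, y) \<in> E \<and> y \<in> V n})" using V(1) by (auto simp: incseq_def)
    ultimately show ?thesis using Vs[OF sl[OF E]] by (simp add: SUP_emeasure_incseq image_subset_iff)
  qed
  then show ?thesis using * by simp
qed


lemma measurable_Pair_slice:
  assumes "f \<in> borel_measurable (borel :: ('a::topological_space \<times> 'b::topological_space) measure)"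
  shows "(\<lambda>y. f (x, y)) \<in> borel_measurable borel" "(\<lambda>x. f (x, y)) \<in> borel_measurable borel"
  by (rule measurable_compose[OF _ assms], intro borel_measurable_continuous_onI continuous_intros)+

lemma radon_measurable_nn_integral:
  fixes N :: "'b::t2_space measure" and f :: "'a::t2_space \<times> 'b \<Rightarrow> ennreal"
  assumes N: "radon_measure N" and f: "f \<in> borel_measurable borel"
  shows "(\<lambda>x. \<integral>\<^sup>+y. f (x, y) \<partial>N) \<in> borel_measurable borel"
proof -
  interpret N: radon_measure N by fact
  note [simp] = N.borel_measurable_eq
  show ?thesis using f
  proof induct
    case (cong u v)
    then have "u = v" by (auto simp: fun_eq_iff)
    then show ?case using cong by simp
  next
    case (set E)
    have "(\<integral>\<^sup>+y. indicator E (x, y) \<partial>N) = emeasure N {y. (x, y) \<in> E}" for x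
      using sets_slice(1)[OF set, of x] nn_integral_indicator[of "{y. (x, y) \<in> E}" N]
      by (simp add: N.sets_eq indicator_def)
    then show ?case using N.measurable_slice[OF set] by simp
  next
    case (mult u c)
    then show ?case by (simp add: nn_integral_cmult measurable_Pair_slice)
  next
    case (add u v)
    then show ?case by (simp add: nn_integral_add measurable_Pair_slice)
  next
    case (seq U)
    then show ?case
      by (simp add: nn_integral_monotone_convergence_SUP measurable_Pair_slice incseq_def le_fun_def image_comp)
  qed
qed

text \<open>The iterated integral in one fixed order is integration against a measure on the product, so the two
  orders can be compared on open sets only.\<close>

lemma iterated_measure:
  fixes M :: "'a::t2_space measure" and N :: "'b::t2_space measure"
  assumes M: "sets M = sets borel" and N: "radon_measure N"
  shows "\<exists>P. sets P = sets borel \<and> (\<forall>f\<in>borel_measurable borel.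
    (\<integral>\<^sup>+p. f p \<partial>P) = (\<integral>\<^sup>+x. \<integral>\<^sup>+y. f (x, y) \<partial>N \<partial>M))"
proof -
  interpret N: radon_measure N by fact
  have bM: "borel_measurable M = borel_measurable borel" by (rule measurable_cong_sets) (auto simp: M)
  define \<mu> where "\<mu> E = (\<integral>\<^sup>+x. emeasure N {y. (x, y) \<in> E} \<partial>M)" for E :: "('a \<times> 'b) set"
  define P where "P = measure_of UNIV (sets borel) \<mu>"
  have sP: "sets P = sets borel" "space P = UNIV"
    using sets.sigma_sets_eq[of "borel :: ('a \<times> 'b) measure"] by (simp_all add: P_def space_measure_of_conv)
  have add: "countably_additive (sets P) \<mu>"
    unfolding countably_additive_def
  proof (intro allI impI)
    fix E :: "nat \<Rightarrow> ('a \<times> 'b) set" assume "range E \<subseteq> sets P" and dis: "disjoint_family E"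
    then have E: "E i \<in> sets borel" for i using sP by auto
    have "(\<Sum>i. emeasure N {y. (x, y) \<in> E i}) = emeasure N {y. (x, y) \<in> (\<Union>i. E i)}" for x
    proof -
      have "{y. (x, y) \<in> (\<Union>i. E i)} = (\<Union>i. {y. (x, y) \<in> E i})" by auto
      moreover have "disjoint_family (\<lambda>i. {y. (x, y) \<in> E i})" using dis by (auto simp: disjoint_family_on_def)
      ultimately show ?thesis using sets_slice(1)[OF E] by (simp add: suminf_emeasure image_subset_iff N.sets_eq)
    qed
    moreover have "(\<lambda>x. emeasure N {y. (x, y) \<in> E i}) \<in> borel_measurable M" for i
      using N.measurable_slice[OF E] by (simp add: bM)
    ultimately show "(\<Sum>i. \<mu> (E i)) = \<mu> (\<Union>i. E i)" unfolding \<mu>_def by (simp add: nn_integral_suminf[symmetric])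
  qed
  have eP: "emeasure P E = \<mu> E" if "E \<in> sets borel" for E
    by (rule emeasure_measure_of[OF P_def _ _ add]) (use that sP in \<open>auto simp: positive_def \<mu>_def\<close>)
  have bP: "borel_measurable P = borel_measurable borel" by (rule measurable_cong_sets) (auto simp: sP)
  have "(\<integral>\<^sup>+p. f p \<partial>P) = (\<integral>\<^sup>+x. \<integral>\<^sup>+y. f (x, y) \<partial>N \<partial>M)" if "f \<in> borel_measurable borel" for f
    using that
  proof induct
    case (cong u v)
    then have "u = v" by (auto simp: fun_eq_iff)
    then show ?case using cong by simp
  next
    case (set E)
    have "(\<integral>\<^sup>+y. indicator E (x, y) \<partial>N) = emeasure N {y. (x, y) \<in> E}" for x
      using sets_slice(1)[OF set, of x] nn_integral_indicator[of "{y. (x, y) \<in> E}" N]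
      by (simp add: N.sets_eq indicator_def)
    then show ?case using eP[OF set] set by (simp add: \<mu>_def sP)
  next
    case (mult u c)
    then show ?case
      by (simp add: nn_integral_cmult bP bM N.borel_measurable_eq measurable_Pair_slice radon_measurable_nn_integral[OF N])
  next
    case (add u v)
    then show ?case
      by (simp add: nn_integral_add bP bM N.borel_measurable_eq measurable_Pair_slice radon_measurable_nn_integral[OF N])
  next
    case (seq V)
    have V: "V i (x, y) \<le> V j (x, y)" if "i \<le> j" for i j x y
      using \<open>incseq V\<close> that by (auto simp: incseq_def le_fun_def)
    have "(\<integral>\<^sup>+p. (SUP i. V i p) \<partial>P) = (SUP i. \<integral>\<^sup>+p. V i p \<partial>P)"
      using seq(1) \<open>incseq V\<close> by (intro nn_integral_monotone_convergence_SUP) (simp_all add: bP)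
    moreover have "(\<integral>\<^sup>+y. (SUP i. V i (x, y)) \<partial>N) = (SUP i. \<integral>\<^sup>+y. V i (x, y) \<partial>N)" for x
      using measurable_Pair_slice(1)[OF seq(1)] V
      by (intro nn_integral_monotone_convergence_SUP) (auto simp: incseq_def le_fun_def N.borel_measurable_eq)
    moreover have "(\<integral>\<^sup>+x. (SUP i. \<integral>\<^sup>+y. V i (x, y) \<partial>N) \<partial>M) = (SUP i. \<integral>\<^sup>+x. \<integral>\<^sup>+y. V i (x, y) \<partial>N \<partial>M)"
      using radon_measurable_nn_integral[OF N seq(1)] V
      by (intro nn_integral_monotone_convergence_SUP) (auto simp: incseq_def le_fun_def bM intro!: nn_integral_mono)
    ultimately show ?case using seq(3) by (simp add: image_comp)
  qed
  then show ?thesis using sP by blast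
qed

theorem radon_tonelli:
  fixes M :: "'a::t2_space measure" and N :: "'b::t2_space measure" and f :: "'a \<times> 'b \<Rightarrow> ennreal"
  assumes M: "radon_measure M" and N: "radon_measure N" and f: "f \<in> borel_measurable borel"
  shows "(\<integral>\<^sup>+x. \<integral>\<^sup>+y. f (x, y) \<partial>N \<partial>M) = (\<integral>\<^sup>+y. \<integral>\<^sup>+x. f (x, y) \<partial>M \<partial>N)"
proof -
  interpret M: radon_measure M by fact
  interpret N: radon_measure N by fact
  obtain P where P: "sets P = sets borel" "\<And>f. f \<in> borel_measurable borel \<Longrightarrow>
      (\<integral>\<^sup>+p. f p \<partial>P) = (\<integral>\<^sup>+x. \<integral>\<^sup>+y. f (x, y) \<partial>N \<partial>M)"
    using iterated_measure[OF M.sets_eq N] by blast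
  obtain P' where P': "sets P' = sets borel" "\<And>f. f \<in> borel_measurable borel \<Longrightarrow>
      (\<integral>\<^sup>+p. f p \<partial>P') = (\<integral>\<^sup>+y. \<integral>\<^sup>+x. f (y, x) \<partial>M \<partial>N)"
    using iterated_measure[OF N.sets_eq M] by blast
  define sw where "sw p = (snd p, fst p)" for p :: "'b \<times> 'a"
  have sw: "sw \<in> borel_measurable borel" unfolding sw_def by (intro borel_measurable_continuous_onI continuous_intros)
  have swP: "sw \<in> measurable P' borel" using sw measurable_cong_sets[OF P'(1) refl] by blast
  have D: "(\<integral>\<^sup>+p. f p \<partial>distr P' borel sw) = (\<integral>\<^sup>+y. \<integral>\<^sup>+x. f (x, y) \<partial>M \<partial>N)" if "f \<in> borel_measurable borel" for f
    using nn_integral_distr[OF swP] P'(2)[OF measurable_compose[OF sw that]] that by (simp add: sw_def)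
  have slN: "(\<integral>\<^sup>+y. indicator E (x, y) \<partial>N) = emeasure N {y. (x, y) \<in> E}"
    and slM: "(\<integral>\<^sup>+x. indicator E (x, z) \<partial>M) = emeasure M {x. (x, z) \<in> E}" if "E \<in> sets borel" for E x z
    using sets_slice(1)[OF that, of x] nn_integral_indicator[of "{y. (x, y) \<in> E}" N]
      sets_slice(2)[OF that, of z] nn_integral_indicator[of "{x. (x, z) \<in> E}" M]
    by (simp_all add: N.sets_eq M.sets_eq indicator_def)
  have eP: "emeasure P E = (\<integral>\<^sup>+x. emeasure N {y. (x, y) \<in> E} \<partial>M)" if "E \<in> sets borel" for E
    using P(2)[of "indicator E"] that by (simp add: P(1) slN)
  have eD: "emeasure (distr P' borel sw) E = (\<integral>\<^sup>+y. emeasure M {x. (x, y) \<in> E} \<partial>N)" if "E \<in> sets borel" for E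
    using D[of "indicator E"] that by (simp add: slM)
  obtain V :: "nat \<Rightarrow> 'a set" where V: "incseq V" "(\<Union>n. V n) = UNIV" "\<And>n. open (V n)" "\<And>n. emeasure M (V n) < \<infinity>"
    using M.exhaustion by auto
  obtain V' :: "nat \<Rightarrow> 'b set" where V': "incseq V'" "(\<Union>n. V' n) = UNIV" "\<And>n. open (V' n)" "\<And>n. emeasure N (V' n) < \<infinity>"
    using N.exhaustion by auto
  define Q where "Q n = V n \<times> V' n" for n
  have Q: "open (Q n)" for n unfolding Q_def by (intro open_Times V V')
  have QP: "emeasure P (Q n) \<noteq> \<infinity>" for n
  proof -
    have "emeasure P (Q n) = (\<integral>\<^sup>+x. emeasure N (V' n) * indicator (V n) x \<partial>M)"
      using Q[of n] by (subst eP) (auto simp: Q_def indicator_def intro!: nn_integral_cong)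
    also have "\<dots> = emeasure N (V' n) * emeasure M (V n)"
      using V by (intro nn_integral_cmult_indicator) (simp add: M.open_sets)
    finally show ?thesis using V(4)[of n] V'(4)[of n] by (simp add: ennreal_mult_eq_top_iff less_top)
  qed
  have QU: "(\<Union>n. Q n) = UNIV"
  proof safe
    fix x :: 'a and y :: 'b
    obtain m n where "x \<in> V m" "y \<in> V' n" using V(2) V'(2) by blast
    then have "(x, y) \<in> Q (max m n)"
      using V(1) V'(1) unfolding incseq_def Q_def by (meson SigmaI max.cobounded1 max.cobounded2 subsetD)
    then show "(x, y) \<in> (\<Union>n. Q n)" by blast
  qed auto
  have "P = distr P' borel sw"
  proof (rule measure_eqI_generator_eq[where E="{S. open S}" and \<Omega>=UNIV and A=Q])
    show "emeasure P W = emeasure (distr P' borel sw) W" if "W \<in> {S. open S}" for W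
      using that open_iterated_eq[OF M N] by (simp add: eP eD)
  qed (use Q QU QP P(1) in \<open>auto simp: Int_stable_def borel_def\<close>)
  then show ?thesis using P(2)[OF f] D[OF f] by simp
qed

text \<open>Reduces complex integrals to four nonnegative ones.\<close>

lemma integral_eq_parts:
  fixes f :: "'a \<Rightarrow> complex"
  assumes "integrable M f"
  shows "integral\<^sup>L M f = complex_of_real (enn2real (\<integral>\<^sup>+x. ennreal (Re (f x)) \<partial>M) - enn2real (\<integral>\<^sup>+x. ennreal (- Re (f x)) \<partial>M))
    + \<i> * complex_of_real (enn2real (\<integral>\<^sup>+x. ennreal (Im (f x)) \<partial>M) - enn2real (\<integral>\<^sup>+x. ennreal (- Im (f x)) \<partial>M))"
proof -
  have "Re (integral\<^sup>L M f) = enn2real (\<integral>\<^sup>+x. ennreal (Re (f x)) \<partial>M) - enn2real (\<integral>\<^sup>+x. ennreal (- Re (f x)) \<partial>M)"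
    using assms real_lebesgue_integral_def[of M "\<lambda>x. Re (f x)"] by simp
  moreover have "Im (integral\<^sup>L M f) = enn2real (\<integral>\<^sup>+x. ennreal (Im (f x)) \<partial>M) - enn2real (\<integral>\<^sup>+x. ennreal (- Im (f x)) \<partial>M)"
    using assms real_lebesgue_integral_def[of M "\<lambda>x. Im (f x)"] by simp
  ultimately show ?thesis by (simp add: complex_eq_iff)
qed

text \<open>The points where the integral diverges form a measurable set, and there its value is \<open>0\<close> by convention;
  elsewhere \<open>integral_eq_parts\<close> applies.\<close>

lemma radon_measurable_integral:
  fixes N :: "'b::t2_space measure" and f :: "'a::t2_space \<times> 'b \<Rightarrow> complex"
  assumes N: "radon_measure N" and f: "f \<in> borel_measurable borel"
  shows "(\<lambda>x. \<integral>y. f (x, y) \<partial>N) \<in> borel_measurable borel"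
proof -
  interpret N: radon_measure N by fact
  have fx[measurable]: "(\<lambda>y. f (x, y)) \<in> borel_measurable N" for x
    using measurable_Pair_slice(1)[OF f] by (simp add: N.borel_measurable_eq)
  have m: "(\<lambda>x. \<integral>\<^sup>+y. ennreal (g (f (x, y))) \<partial>N) \<in> borel_measurable borel" if "g \<in> borel_measurable borel" for g :: "complex \<Rightarrow> real"
    using radon_measurable_nn_integral[OF N, of "\<lambda>p. ennreal (g (f p))"] measurable_compose[OF f that] by simp
  have [measurable]: "(\<lambda>x. \<integral>\<^sup>+y. ennreal (Re (f (x, y))) \<partial>N) \<in> borel_measurable borel"
    "(\<lambda>x. \<integral>\<^sup>+y. ennreal (- Re (f (x, y))) \<partial>N) \<in> borel_measurable borel"
    "(\<lambda>x. \<integral>\<^sup>+y. ennreal (Im (f (x, y))) \<partial>N) \<in> borel_measurable borel"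
    "(\<lambda>x. \<integral>\<^sup>+y. ennreal (- Im (f (x, y))) \<partial>N) \<in> borel_measurable borel"
    "(\<lambda>x. \<integral>\<^sup>+y. ennreal (norm (f (x, y))) \<partial>N) \<in> borel_measurable borel"
    by (rule m, measurable)+
  have eq: "(\<integral>y. f (x, y) \<partial>N) = (if (\<integral>\<^sup>+y. ennreal (norm (f (x, y))) \<partial>N) < \<infinity>
    then complex_of_real (enn2real (\<integral>\<^sup>+y. ennreal (Re (f (x, y))) \<partial>N) - enn2real (\<integral>\<^sup>+y. ennreal (- Re (f (x, y))) \<partial>N))
    + \<i> * complex_of_real (enn2real (\<integral>\<^sup>+y. ennreal (Im (f (x, y))) \<partial>N) - enn2real (\<integral>\<^sup>+y. ennreal (- Im (f (x, y))) \<partial>N)) else 0)" for x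
  proof (cases "integrable N (\<lambda>y. f (x, y))")
    case True
    then show ?thesis using integral_eq_parts[OF True] by (simp add: integrable_iff_bounded)
  next
    case False
    then show ?thesis by (simp add: not_integrable_integral_eq integrable_iff_bounded)
  qed
  show ?thesis unfolding eq by measurable
qed

lemma radon_iterated_integral:
  fixes M :: "'a::t2_space measure" and N :: "'b::t2_space measure" and f :: "'a \<times> 'b \<Rightarrow> complex"
  assumes M: "radon_measure M" and N: "radon_measure N" and f: "f \<in> borel_measurable borel"
    and fin: "(\<integral>\<^sup>+x. \<integral>\<^sup>+y. ennreal (norm (f (x, y))) \<partial>N \<partial>M) < \<infinity>"
  shows "AE x in M. integrable N (\<lambda>y. f (x, y))"
    and "(\<integral>x. \<integral>y. f (x, y) \<partial>N \<partial>M) =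
      complex_of_real (enn2real (\<integral>\<^sup>+x. \<integral>\<^sup>+y. ennreal (Re (f (x, y))) \<partial>N \<partial>M) - enn2real (\<integral>\<^sup>+x. \<integral>\<^sup>+y. ennreal (- Re (f (x, y))) \<partial>N \<partial>M))
      + \<i> * complex_of_real (enn2real (\<integral>\<^sup>+x. \<integral>\<^sup>+y. ennreal (Im (f (x, y))) \<partial>N \<partial>M) - enn2real (\<integral>\<^sup>+x. \<integral>\<^sup>+y. ennreal (- Im (f (x, y))) \<partial>N \<partial>M))"
proof -
  interpret M: radon_measure M by fact
  interpret N: radon_measure N by fact
  have fx[measurable]: "(\<lambda>y. f (x, y)) \<in> borel_measurable N" for x
    using measurable_Pair_slice(1)[OF f] by (simp add: N.borel_measurable_eq)
  have m: "(\<lambda>x. \<integral>\<^sup>+y. ennreal (g (f (x, y))) \<partial>N) \<in> borel_measurable M" if "g \<in> borel_measurable borel" for g :: "complex \<Rightarrow> real"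
    using radon_measurable_nn_integral[OF N, of "\<lambda>p. ennreal (g (f p))"] measurable_compose[OF f that]
    by (simp add: M.borel_measurable_eq)
  have norm_m[measurable]: "(\<lambda>x. \<integral>\<^sup>+y. ennreal (norm (f (x, y))) \<partial>N) \<in> borel_measurable M"
    by (rule m) measurable
  have AEfin: "AE x in M. (\<integral>\<^sup>+y. ennreal (norm (f (x, y))) \<partial>N) \<noteq> \<infinity>"
    using fin by (intro nn_integral_PInf_AE norm_m) auto
  then show AEint: "AE x in M. integrable N (\<lambda>y. f (x, y))"
    by eventually_elim (auto simp: integrable_iff_bounded less_top)
  define e where "e g x = enn2real (\<integral>\<^sup>+y. ennreal (g (f (x, y))) \<partial>N)" for g x
  have e: "integrable M (e g)" "integral\<^sup>L M (e g) = enn2real (\<integral>\<^sup>+x. \<integral>\<^sup>+y. ennreal (g (f (x, y))) \<partial>N \<partial>M)"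
    if g: "g \<in> borel_measurable borel" "\<And>z. g z \<le> norm z" for g :: "complex \<Rightarrow> real"
  proof -
    have [measurable]: "e g \<in> borel_measurable M" unfolding e_def using m[OF g(1)] by measurable
    have gle: "(\<integral>\<^sup>+y. ennreal (g (f (x, y))) \<partial>N) \<le> (\<integral>\<^sup>+y. ennreal (norm (f (x, y))) \<partial>N)" for x
      by (intro nn_integral_mono ennreal_leI g)
    have "AE x in M. ennreal (e g x) = (\<integral>\<^sup>+y. ennreal (g (f (x, y))) \<partial>N)"
      using AEfin
    proof eventually_elim
      case (elim x)
      then have "(\<integral>\<^sup>+y. ennreal (norm (f (x, y))) \<partial>N) < \<infinity>" by (simp add: less_top)
      from le_less_trans[OF gle this] show ?case by (simp add: e_def)
    qed
    then have eq: "(\<integral>\<^sup>+x. ennreal (e g x) \<partial>M) = (\<integral>\<^sup>+x. \<integral>\<^sup>+y. ennreal (g (f (x, y))) \<partial>N \<partial>M)"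
      by (rule nn_integral_cong_AE)
    also have "\<dots> \<le> (\<integral>\<^sup>+x. \<integral>\<^sup>+y. ennreal (norm (f (x, y))) \<partial>N \<partial>M)"
      by (intro nn_integral_mono ennreal_leI g)
    finally have lt: "(\<integral>\<^sup>+x. ennreal (e g x) \<partial>M) < \<infinity>" using fin by (rule le_less_trans)
    have nn: "0 \<le> e g x" for x by (simp add: e_def)
    show "integrable M (e g)"
      using lt nn by (intro integrableI_nonneg) auto
    show "integral\<^sup>L M (e g) = enn2real (\<integral>\<^sup>+x. \<integral>\<^sup>+y. ennreal (g (f (x, y))) \<partial>N \<partial>M)"
      using nn by (subst integral_eq_nn_integral) (auto simp: eq)
  qed
  have le: "Re z \<le> norm z" "- Re z \<le> norm z" "Im z \<le> norm z" "- Im z \<le> norm z" for z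
    using abs_Re_le_cmod[of z] abs_Im_le_cmod[of z] by linarith+
  have eR: "integrable M (e Re)" "integrable M (e (\<lambda>z. - Re z))" "integrable M (e Im)" "integrable M (e (\<lambda>z. - Im z))"
    by (auto intro!: e le)
  have "(\<integral>x. \<integral>y. f (x, y) \<partial>N \<partial>M) = (\<integral>x. complex_of_real (e Re x - e (\<lambda>z. - Re z) x) + \<i> * complex_of_real (e Im x - e (\<lambda>z. - Im z) x) \<partial>M)"
  proof (rule integral_cong_AE)
    show "(\<lambda>x. \<integral>y. f (x, y) \<partial>N) \<in> borel_measurable M"
      using radon_measurable_integral[OF N f] by (simp add: M.borel_measurable_eq)
    show "(\<lambda>x. complex_of_real (e Re x - e (\<lambda>z. - Re z) x) + \<i> * complex_of_real (e Im x - e (\<lambda>z. - Im z) x)) \<in> borel_measurable M"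
      using eR[THEN borel_measurable_integrable] by measurable
    show "AE x in M. (\<integral>y. f (x, y) \<partial>N) = complex_of_real (e Re x - e (\<lambda>z. - Re z) x) + \<i> * complex_of_real (e Im x - e (\<lambda>z. - Im z) x)"
      using AEint by eventually_elim (simp add: integral_eq_parts e_def)
  qed
  also have "\<dots> = complex_of_real (integral\<^sup>L M (e Re) - integral\<^sup>L M (e (\<lambda>z. - Re z)))
     + \<i> * complex_of_real (integral\<^sup>L M (e Im) - integral\<^sup>L M (e (\<lambda>z. - Im z)))"
    using eR by simp
  finally show "(\<integral>x. \<integral>y. f (x, y) \<partial>N \<partial>M) =
      complex_of_real (enn2real (\<integral>\<^sup>+x. \<integral>\<^sup>+y. ennreal (Re (f (x, y))) \<partial>N \<partial>M) - enn2real (\<integral>\<^sup>+x. \<integral>\<^sup>+y. ennreal (- Re (f (x, y))) \<partial>N \<partial>M))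
      + \<i> * complex_of_real (enn2real (\<integral>\<^sup>+x. \<integral>\<^sup>+y. ennreal (Im (f (x, y))) \<partial>N \<partial>M) - enn2real (\<integral>\<^sup>+x. \<integral>\<^sup>+y. ennreal (- Im (f (x, y))) \<partial>N \<partial>M))"
    by (simp add: e le)
qed

theorem radon_fubini:
  fixes M :: "'a::t2_space measure" and N :: "'b::t2_space measure" and f :: "'a \<times> 'b \<Rightarrow> complex"
  assumes M: "radon_measure M" and N: "radon_measure N" and f: "f \<in> borel_measurable borel"
    and fin: "(\<integral>\<^sup>+x. \<integral>\<^sup>+y. ennreal (norm (f (x, y))) \<partial>N \<partial>M) < \<infinity>"
  shows "(\<integral>x. \<integral>y. f (x, y) \<partial>N \<partial>M) = (\<integral>y. \<integral>x. f (x, y) \<partial>M \<partial>N)"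
proof -
  have sw: "(\<lambda>p. f (snd p, fst p)) \<in> borel_measurable (borel :: ('b \<times> 'a) measure)"
    by (rule measurable_compose[OF _ f]) (intro borel_measurable_continuous_onI continuous_intros)
  have T: "(\<integral>\<^sup>+x. \<integral>\<^sup>+y. ennreal (g (f (x, y))) \<partial>N \<partial>M) = (\<integral>\<^sup>+y. \<integral>\<^sup>+x. ennreal (g (f (x, y))) \<partial>M \<partial>N)"
    if "g \<in> borel_measurable borel" for g :: "complex \<Rightarrow> real"
    using radon_tonelli[OF M N, of "\<lambda>p. ennreal (g (f p))"] measurable_compose[OF f that] by simp
  have fin': "(\<integral>\<^sup>+y. \<integral>\<^sup>+x. ennreal (norm (f (x, y))) \<partial>M \<partial>N) < \<infinity>"
    using fin by (subst T[symmetric]) auto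
  have "(\<integral>y. \<integral>x. f (x, y) \<partial>M \<partial>N) =
      complex_of_real (enn2real (\<integral>\<^sup>+y. \<integral>\<^sup>+x. ennreal (Re (f (x, y))) \<partial>M \<partial>N) - enn2real (\<integral>\<^sup>+y. \<integral>\<^sup>+x. ennreal (- Re (f (x, y))) \<partial>M \<partial>N))
      + \<i> * complex_of_real (enn2real (\<integral>\<^sup>+y. \<integral>\<^sup>+x. ennreal (Im (f (x, y))) \<partial>M \<partial>N) - enn2real (\<integral>\<^sup>+y. \<integral>\<^sup>+x. ennreal (- Im (f (x, y))) \<partial>M \<partial>N))"
    using radon_iterated_integral(2)[OF N M sw] fin' by simp
  also have "\<dots> = (\<integral>x. \<integral>y. f (x, y) \<partial>N \<partial>M)"
    unfolding radon_iterated_integral(2)[OF M N f fin]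
    using T[of Re] T[of "\<lambda>z. - Re z"] T[of Im] T[of "\<lambda>z. - Im z"] by simp
  finally show ?thesis ..
qed

section \<open>Haar measure on a group of polynomial growth\<close>

lemma power_set_0 [simp]: "power_set U 0 = {0}"
  by (auto simp: power_set_def)

lemma power_set_Suc: "power_set U (Suc n) = (\<lambda>(u, v). u + v) ` (U \<times> power_set U n)"
proof (intro equalityI subsetI)
  fix x assume "x \<in> power_set U (Suc n)"
  then obtain us where us: "x = sum_list us" "length us = Suc n" "set us \<subseteq> U" by (auto simp: power_set_def)
  then obtain u vs where "us = u # vs" by (cases us) auto
  with us show "x \<in> (\<lambda>(u, v). u + v) ` (U \<times> power_set U n)"
    by (auto simp: power_set_def intro!: image_eqI[of _ _ "(u, sum_list vs)"])
next
  fix x assume "x \<in> (\<lambda>(u, v). u + v) ` (U \<times> power_set U n)"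
  then obtain u vs where "u \<in> U" "length vs = n" "set vs \<subseteq> U" "x = u + sum_list vs"
    by (auto simp: power_set_def)
  then show "x \<in> power_set U (Suc n)"
    unfolding power_set_def by (intro CollectI exI[of _ "u # vs"]) auto
qed

lemma power_set_add:
  assumes "x \<in> power_set U m" "y \<in> power_set U n"
  shows "x + y \<in> power_set U (m + n)"
proof -
  obtain us vs where "x = sum_list us" "length us = m" "set us \<subseteq> U" "y = sum_list vs" "length vs = n" "set vs \<subseteq> U"
    using assms by (auto simp: power_set_def)
  then show ?thesis unfolding power_set_def by (intro CollectI exI[of _ "us @ vs"]) auto
qed

lemma power_set_1 [simp]: "power_set U (Suc 0) = U"
  by (force simp: power_set_Suc)

lemma sum_list_uminus_rev: "sum_list (rev (map uminus us)) = - sum_list (us :: 'a::group_add list)"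
  by (induction us) (simp_all add: minus_add)

lemma power_set_uminus:
  assumes "uminus ` U = U" "x \<in> power_set U n"
  shows "- x \<in> power_set U n"
proof -
  obtain us where "x = sum_list us" "length us = n" "set us \<subseteq> U"
    using assms by (auto simp: power_set_def)
  then show ?thesis
    unfolding power_set_def using assms(1)
    by (intro CollectI exI[of _ "rev (map uminus us)"]) (auto simp: sum_list_uminus_rev simp del: rev_map)
qed

lemma power_set_mono:
  assumes "0 \<in> U" "m \<le> n"
  shows "power_set U m \<subseteq> power_set U n"
proof
  fix x assume x: "x \<in> power_set U m"
  have "sum_list (replicate k 0) = (0::'a)" for k by (induction k) auto
  then have "0 \<in> power_set U k" for k
    using assms(1) unfolding power_set_def by (intro CollectI exI[of _ "replicate k 0"]) auto
  from power_set_add[OF x this[of "n - m"]] show "x \<in> power_set U n" using assms(2) by simp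
qed

lemma compact_power_set:
  fixes U :: "'g::topological_group_add set"
  assumes "compact U"
  shows "compact (power_set U n)"
proof (induction n)
  case (Suc n)
  have "compact ((\<lambda>p. fst p + snd p) ` (U \<times> power_set U n))"
    using assms Suc by (intro compact_continuous_image compact_Times continuous_intros)
  then show ?case by (simp add: power_set_Suc split_beta')
qed simp

lemma le_one_of_poly_growth:
  fixes r K :: real
  assumes "\<And>n. r ^ n \<le> K * (real n * real k + real m) ^ d"
  shows "r \<le> 1"
proof (rule ccontr)
  assume "\<not> r \<le> 1"
  then have r: "r > 1" by simp
  have "(\<lambda>n. (K * (real n * real k + real m) ^ d) / r ^ n) \<longlonglongrightarrow> 0"
  proof (cases "k = 0")
    case True
    have "(\<lambda>n. (K * real m ^ d) / r ^ n) \<longlonglongrightarrow> 0" using r by real_asymp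
    then show ?thesis using True by simp
  next
    case False
    then have k: "real k > 0" by simp
    show ?thesis using r k by real_asymp
  qed
  moreover have "1 \<le> (K * (real n * real k + real m) ^ d) / r ^ n" for n
    using assms[of n] r by (simp add: field_simps)
  ultimately have "(1::real) \<le> 0" by (intro LIMSEQ_le_const[of _ 0]) auto
  then show False by simp
qed

locale poly_growth_group =
  fixes M :: "'g::{topological_group_add, t2_space} measure" and U :: "'g set" and d :: nat
  assumes haar: "left_haar_measure M" and gen: "generating_nbhd U" and growth: "growth_bound M U d"
begin

lemma U: "compact U" "uminus ` U = U" "0 \<in> interior U" "0 \<in> U" "(\<Union>n\<in>{1..}. power_set U n) = UNIV"
  using gen interior_subset[of U] by (auto simp: generating_nbhd_def)

lemma sets_M [measurable_cong]: "sets M = sets borel"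
  using haar by (simp add: left_haar_measure_def)

lemma space_M [simp]: "space M = UNIV"
  using sets_M by (metis sets_eq_imp_space_eq space_borel)

lemma borel_measurable_M [simp]: "borel_measurable M = borel_measurable borel"
  by (rule measurable_cong_sets) (auto simp: sets_M)

lemma emeasure_compact: "compact K \<Longrightarrow> emeasure M K < \<infinity>"
  using haar by (auto simp: left_haar_measure_def)

lemma emeasure_translate: "A \<in> sets borel \<Longrightarrow> emeasure M ((\<lambda>s. x + s) ` A) = emeasure M A"
  using haar by (auto simp: left_haar_measure_def)

lemma translate_vimage: "((\<lambda>s. x + s) -` A) = (\<lambda>s. - x + s) ` (A :: 'g set)"
proof (intro equalityI subsetI)
  fix s assume "s \<in> (\<lambda>s. x + s) -` A"
  then show "s \<in> (\<lambda>s. - x + s) ` A" by (intro image_eqI[of _ _ "x + s"]) (auto simp: add.assoc[symmetric])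
qed (auto simp: add.assoc[symmetric])

lemma borel_compose:
  assumes "f \<in> borel_measurable borel" "continuous_on UNIV h"
  shows "(\<lambda>x. f (h x)) \<in> borel_measurable borel"
  by (rule measurable_compose[OF borel_measurable_continuous_onI[OF assms(2)] assms(1)])

lemma distr_translate: "distr M borel (\<lambda>s. x + s) = M"
proof (rule measure_eqI)
  have m: "(\<lambda>s. x + s) \<in> measurable M borel"
    by (simp add: borel_measurable_continuous_onI continuous_intros)
  fix A assume "A \<in> sets (distr M borel (\<lambda>s. x + s))"
  then have A: "A \<in> sets borel" by simp
  show "emeasure (distr M borel (\<lambda>s. x + s)) A = emeasure M A"
    using A m by (subst emeasure_distr) (auto simp: translate_vimage emeasure_translate)
qed (simp add: sets_M)

lemma nn_integral_translate:
  assumes "f \<in> borel_measurable borel"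
  shows "(\<integral>\<^sup>+s. f (x + s) \<partial>M) = (\<integral>\<^sup>+s. f s \<partial>M)"
proof -
  have "(\<integral>\<^sup>+s. f s \<partial>M) = (\<integral>\<^sup>+s. f s \<partial>distr M borel (\<lambda>s. x + s))" by (simp add: distr_translate)
  also have "\<dots> = (\<integral>\<^sup>+s. f (x + s) \<partial>M)"
    using assms by (intro nn_integral_distr) (simp_all add: borel_measurable_continuous_onI continuous_intros)
  finally show ?thesis ..
qed

lemma power_set_exhausts: "(\<Union>n. power_set U n) = UNIV"
  using U(5) by blast

text \<open>Open sets between consecutive powers of \<open>U\<close>, which exhaust the group.\<close>

definition open_power :: "nat \<Rightarrow> 'g set" where
  "open_power n = (\<Union>x\<in>power_set U n. (\<lambda>s. x + s) ` interior U)"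

lemma open_translate: "open A \<Longrightarrow> open ((\<lambda>s. x + s) ` (A :: 'g set))"
  using open_vimage[of A "\<lambda>s. - x + s"] translate_vimage[of "- x" A] by (simp add: continuous_intros)

lemma open_power: "open (open_power n)" "power_set U n \<subseteq> open_power n" "open_power n \<subseteq> power_set U (Suc n)"
proof -
  show "open (open_power n)" unfolding open_power_def by (intro open_UN ballI open_translate open_interior)
  show "power_set U n \<subseteq> open_power n" unfolding open_power_def using U(3) by force
  show "open_power n \<subseteq> power_set U (Suc n)"
  proof
    fix y assume "y \<in> open_power n"
    then obtain x s where "x \<in> power_set U n" "s \<in> U" "y = x + s"
      unfolding open_power_def using interior_subset by blast
    then show "y \<in> power_set U (Suc n)" using power_set_add[of x U n s "Suc 0"] by simp
  qed
qed

lemma radon: "radon_measure M"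
proof
  show "sets M = sets borel" by (rule sets_M)
  show "emeasure M V = (SUP K\<in>{K. compact K \<and> K \<subseteq> V}. emeasure M K)" if "open V" for V
    using haar that unfolding left_haar_measure_def by blast
  have "incseq open_power" unfolding incseq_def open_power_def using power_set_mono[OF U(4)] by blast
  moreover have "(\<Union>n. open_power n) = UNIV" using power_set_exhausts open_power(2) by blast
  moreover have "emeasure M (open_power n) < \<infinity>" for n
  proof -
    have "emeasure M (open_power n) \<le> emeasure M (power_set U (Suc n))"
      using open_power(3) compact_power_set[OF U(1)] by (intro emeasure_mono) (auto simp: sets_M compact_imp_closed)
    then show ?thesis using emeasure_compact[OF compact_power_set[OF U(1)]] by (rule le_less_trans)
  qed
  ultimately show "\<exists>V::nat \<Rightarrow> 'g set. incseq V \<and> (\<Union>n. V n) = UNIV \<and> (\<forall>n. open (V n) \<and> emeasure M (V n) < \<infinity>)"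
    using open_power(1) by blast
qed

text \<open>If a nonempty open set were null, finitely many of its translates would cover each compact set
  \<open>power_set U n\<close>, and the whole group would be null.\<close>

lemma emeasure_open_pos:
  assumes "open V" "x \<in> V"
  shows "0 < emeasure M V"
proof (rule ccontr)
  assume "\<not> 0 < emeasure M V"
  then have V0: "emeasure M V = 0" by simp
  have "emeasure M (power_set U n) = 0" for n
  proof -
    have o: "\<And>y. y \<in> power_set U n \<Longrightarrow> open ((\<lambda>s. (y - x) + s) ` V)" using open_translate assms(1) by blast
    have c: "power_set U n \<subseteq> (\<Union>y\<in>power_set U n. (\<lambda>s. (y - x) + s) ` V)"
      using assms(2) by (force intro: image_eqI[of _ _ x])
    obtain Y where Y: "Y \<subseteq> power_set U n" "finite Y" "power_set U n \<subseteq> (\<Union>y\<in>Y. (\<lambda>s. (y - x) + s) ` V)"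
      by (rule compactE_image[OF compact_power_set[OF U(1)] o c])
    have "(\<lambda>s. (y - x) + s) ` V \<in> null_sets M" for y
      using emeasure_translate[of V "y - x"] open_translate[OF assms(1)] V0 assms(1) by (auto simp: null_sets_def sets_M)
    then have "(\<Union>y\<in>Y. (\<lambda>s. (y - x) + s) ` V) \<in> null_sets M" using Y(2) by (intro null_sets.finite_UN) auto
    moreover have "power_set U n \<in> sets M" using compact_power_set[OF U(1)] by (simp add: sets_M compact_imp_closed)
    ultimately show ?thesis using null_sets_subset[OF _ _ Y(3)] by blast
  qed
  then have "(\<Union>n. power_set U n) \<in> null_sets M"
    using compact_power_set[OF U(1)] by (intro null_sets_UN) (auto simp: null_sets_def sets_M compact_imp_closed)
  then have "emeasure M (space M) = 0" by (simp add: power_set_exhausts null_sets_def)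
  then show False using haar by (simp add: left_haar_measure_def)
qed

text \<open>Comparing the two orders of integration of \<open>indicator A (x + x0) * g (- y + (x + x0))\<close> expresses the
  right translate and the inverse of \<open>M\<close> through the single function \<open>x \<mapsto> M {y. y + x \<in> A}\<close>.\<close>

lemma modular_identity:
  fixes g :: "'g \<Rightarrow> ennreal"
  assumes A: "A \<in> sets borel" and g: "g \<in> borel_measurable borel"
  shows "emeasure M {s. s + x0 \<in> A} * (\<integral>\<^sup>+y. g (- y) \<partial>M) =
    (\<integral>\<^sup>+x. g (x + x0) * emeasure M {y. y + (x + x0) \<in> A} \<partial>M)"
proof -
  have iA: "(indicator A :: 'g \<Rightarrow> ennreal) \<in> borel_measurable borel" using A by simp
  have iA': "{s. s + z \<in> A} \<in> sets M" for z
    using measurable_sets[OF borel_measurable_continuous_onI[of "\<lambda>s. s + z"] A] by (simp add: vimage_def continuous_intros sets_M)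
  have iAe: "(\<integral>\<^sup>+s. indicator A (s + z) \<partial>M) = emeasure M {s. s + z \<in> A}" for z
    using nn_integral_indicator[OF iA'[of z]] by (simp add: indicator_def)
  have "emeasure M {s. s + x0 \<in> A} * (\<integral>\<^sup>+y. g (- y) \<partial>M) = (\<integral>\<^sup>+x. indicator A (x + x0) * (\<integral>\<^sup>+y. g (- y) \<partial>M) \<partial>M)"
    unfolding iAe[symmetric]
    by (intro nn_integral_multc[symmetric]) (simp add: borel_compose[OF iA] continuous_intros)
  also have "\<dots> = (\<integral>\<^sup>+x. \<integral>\<^sup>+y. indicator A (x + x0) * g (- y + (x + x0)) \<partial>M \<partial>M)"
  proof (intro nn_integral_cong)
    fix x
    have gm: "(\<lambda>y. g (- y)) \<in> borel_measurable borel" by (intro borel_compose[OF g] continuous_intros)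
    have "(\<integral>\<^sup>+y. g (- y) \<partial>M) = (\<integral>\<^sup>+y. g (- y + (x + x0)) \<partial>M)"
      using nn_integral_translate[OF gm, of "- (x + x0)"] by (simp add: minus_add add.assoc)
    moreover have "(\<lambda>y. g (- y + (x + x0))) \<in> borel_measurable borel" by (intro borel_compose[OF g] continuous_intros)
    ultimately show "indicator A (x + x0) * (\<integral>\<^sup>+y. g (- y) \<partial>M) = (\<integral>\<^sup>+y. indicator A (x + x0) * g (- y + (x + x0)) \<partial>M)"
      by (simp add: nn_integral_cmult)
  qed
  also have "\<dots> = (\<integral>\<^sup>+y. \<integral>\<^sup>+x. indicator A (x + x0) * g (- y + (x + x0)) \<partial>M \<partial>M)"
  proof -
    have "(\<lambda>p. indicator A (fst p + x0) * g (- snd p + (fst p + x0))) \<in> borel_measurable (borel :: ('g \<times> 'g) measure)"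
      by (intro borel_measurable_times_ennreal borel_compose[OF iA] borel_compose[OF g] continuous_intros)
    from radon_tonelli[OF radon radon this] show ?thesis by simp
  qed
  also have "\<dots> = (\<integral>\<^sup>+y. \<integral>\<^sup>+x. indicator A (y + (x + x0)) * g (x + x0) \<partial>M \<partial>M)"
  proof (rule nn_integral_cong)
    fix y
    have "(\<lambda>x. indicator A (x + x0) * g (- y + (x + x0))) \<in> borel_measurable borel"
      by (intro borel_measurable_times_ennreal borel_compose[OF iA] borel_compose[OF g] continuous_intros)
    from nn_integral_translate[OF this, of y]
    show "(\<integral>\<^sup>+x. indicator A (x + x0) * g (- y + (x + x0)) \<partial>M) = (\<integral>\<^sup>+x. indicator A (y + (x + x0)) * g (x + x0) \<partial>M)"
      by (simp add: add.assoc)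
  qed
  also have "\<dots> = (\<integral>\<^sup>+x. \<integral>\<^sup>+y. indicator A (y + (x + x0)) * g (x + x0) \<partial>M \<partial>M)"
  proof -
    have "(\<lambda>p. indicator A (fst p + (snd p + x0)) * g (snd p + x0)) \<in> borel_measurable (borel :: ('g \<times> 'g) measure)"
      by (intro borel_measurable_times_ennreal borel_compose[OF iA] borel_compose[OF g] continuous_intros)
    from radon_tonelli[OF radon radon this] show ?thesis by simp
  qed
  also have "\<dots> = (\<integral>\<^sup>+x. g (x + x0) * emeasure M {y. y + (x + x0) \<in> A} \<partial>M)"
  proof (intro nn_integral_cong)
    fix x
    have "(\<lambda>y. indicator A (y + (x + x0)) :: ennreal) \<in> borel_measurable borel"
      by (intro borel_compose[OF iA] continuous_intros)
    then show "(\<integral>\<^sup>+y. indicator A (y + (x + x0)) * g (x + x0) \<partial>M) = g (x + x0) * emeasure M {y. y + (x + x0) \<in> A}"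
      by (simp add: nn_integral_cmult iAe mult.commute)
  qed
  finally show ?thesis .
qed

text \<open>The modular function of the group, up to inversion of the argument and the constant factor \<open>modular 0\<close>.\<close>

definition modular :: "'g \<Rightarrow> ennreal" where
  "modular x = emeasure M {y. y + x \<in> interior U}"

lemma modular_vimage_open: "open {y::'g. y + x \<in> interior U}"
  using open_vimage[of "interior U" "\<lambda>y. y + x"] by (simp add: vimage_def continuous_intros)

lemma modular_pos: "0 < modular x"
  unfolding modular_def using U(3) by (intro emeasure_open_pos[OF modular_vimage_open, of "- x"]) simp

lemma modular_le: "- x \<in> power_set U k \<Longrightarrow> modular x \<le> emeasure M (power_set U (Suc k))"
  unfolding modular_def
proof (intro emeasure_mono)
  assume x: "- x \<in> power_set U k"
  show "{y. y + x \<in> interior U} \<subseteq> power_set U (Suc k)"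
  proof safe
    fix y assume "y + x \<in> interior U"
    then have "y + x \<in> power_set U (Suc 0)" using interior_subset by auto
    from power_set_add[OF this x] show "y \<in> power_set U (Suc k)" by (simp add: add.assoc)
  qed
  show "power_set U (Suc k) \<in> sets M" using compact_power_set[OF U(1)] by (simp add: sets_M compact_imp_closed)
qed

lemma modular_finite: "modular x < \<infinity>"
proof -
  obtain k where "- x \<in> power_set U k" using power_set_exhausts by blast
  from le_less_trans[OF modular_le[OF this] emeasure_compact[OF compact_power_set[OF U(1)]]] show ?thesis .
qed

lemma modular_measurable: "modular \<in> borel_measurable borel"
proof -
  have "(\<lambda>p. indicator (interior U) (snd p + fst p) :: ennreal) \<in> borel_measurable (borel :: ('g \<times> 'g) measure)"
    by (rule measurable_compose[OF borel_measurable_continuous_onI]) (auto intro!: continuous_intros)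
  from radon_measurable_nn_integral[OF radon this]
  have "(\<lambda>x. \<integral>\<^sup>+y. indicator (interior U) (y + x) \<partial>M) \<in> borel_measurable borel" by simp
  moreover have "(\<integral>\<^sup>+y. indicator (interior U) (y + x) \<partial>M) = modular x" for x
    using modular_vimage_open[of x] nn_integral_indicator[of "{y. y + x \<in> interior U}" M]
    by (simp add: modular_def indicator_def sets_M)
  ultimately show ?thesis by simp
qed

text \<open>Uniqueness of Haar measure for right translates. For \<open>g = indicator B / modular\<close> the right-hand side of
  \<open>modular_identity\<close> is the measure of a right translate of \<open>B\<close>, while \<open>x0\<close> enters its left-hand side only through the
  factor \<open>modular x0\<close>.\<close>

lemma emeasure_right_translate_modular:
  assumes B: "B \<in> sets borel"
  shows "emeasure M {x. x + x0 \<in> B} * modular 0 = modular x0 * emeasure M B"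
proof -
  define c where "c = (\<integral>\<^sup>+y. indicator B (- y) / modular (- y) \<partial>M)"
  have g: "(\<lambda>x. indicator B x / modular x) \<in> borel_measurable borel"
    using B modular_measurable by measurable
  have cancel: "indicator B z / modular z * modular z = indicator B z" for z
    using modular_pos[of z] modular_finite[of z] by (simp add: ennreal_divide_times ennreal_times_divide mult_divide_eq_ennreal ennreal_mult_divide_eq)
  have *: "modular x0 * c = emeasure M {x. x + x0 \<in> B}" for x0
  proof -
    have iB: "{x. x + x0 \<in> B} \<in> sets M"
      using measurable_sets[OF borel_measurable_continuous_onI[of "\<lambda>s. s + x0"] B] by (simp add: vimage_def continuous_intros sets_M)
    have "modular x0 * c = (\<integral>\<^sup>+x. indicator B (x + x0) / modular (x + x0) * modular (x + x0) \<partial>M)"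
      using modular_identity[OF _ g, of "interior U" x0] by (simp add: c_def modular_def)
    also have "\<dots> = emeasure M {x. x + x0 \<in> B}"
      unfolding cancel using nn_integral_indicator[OF iB] by (simp add: indicator_def)
    finally show ?thesis .
  qed
  have "emeasure M {x. x + x0 \<in> B} * modular 0 = modular x0 * (modular 0 * c)"
    unfolding *[of x0, symmetric] by (simp add: mult_ac)
  then show ?thesis using *[of 0] by simp
qed

lemma modular_add: "modular (x + y) * modular 0 = modular x * modular y"
proof -
  have "{z. z + y \<in> interior U} \<in> sets borel" using modular_vimage_open by simp
  from emeasure_right_translate_modular[OF this, of x] show ?thesis
    by (simp add: modular_def add.assoc)
qed

text \<open>By \<open>modular_add\<close> a value above \<open>modular 0\<close> would grow exponentially along the multiples of \<open>x\<close>, whereas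
  \<open>modular_le\<close> bounds it there by the polynomially growing measures of the powers of \<open>U\<close>.\<close>

lemma modular_le_0: "modular x \<le> modular 0"
proof -
  define D where "D x = enn2real (modular x)" for x
  have D: "modular x = ennreal (D x)" "D x > 0" for x
    using modular_pos[of x] modular_finite[of x] by (auto simp: D_def enn2real_positive_iff)
  have add: "D (x + y) * D 0 = D x * D y" for x y
  proof -
    have "ennreal (D (x + y) * D 0) = ennreal (D x * D y)"
      using modular_add[of x y] D(2) by (simp add: D(1) ennreal_mult less_imp_le)
    then show ?thesis using D(2) by (simp add: less_imp_le)
  qed
  obtain k where k: "- x \<in> power_set U k" using power_set_exhausts by blast
  define p where "p n = ((+) x ^^ n) 0" for n
  have p: "p 0 = 0" "p (Suc n) = x + p n" for n by (simp_all add: p_def)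
  have p': "p (Suc n) = p n + x" for n by (induction n) (simp add: p, metis p(2) add.assoc)
  have pk: "- p n \<in> power_set U (n * k)" for n
  proof (induction n)
    case (Suc n)
    have "- p (Suc n) = - x + - p n" by (simp only: p' minus_add)
    then show ?case using power_set_add[OF k Suc] by simp
  qed (simp add: p(1))
  have Dp: "D (p n) = D 0 * (D x / D 0) ^ n" for n
  proof (induction n)
    case (Suc n)
    have "D (p (Suc n)) * D 0 = D x * D (p n)" unfolding p(2) by (rule add)
    then show ?case using Suc D(2)[of 0] by (simp add: field_simps)
  qed (simp add: p)
  obtain C where C: "C > 0" "\<And>n. n \<ge> 1 \<Longrightarrow> emeasure M (power_set U n) \<le> ennreal (C * real n ^ d)"
    using growth by (auto simp: growth_bound_def)
  have "(D x / D 0) ^ n \<le> (C / D 0) * (real n * real k + real 1) ^ d" for n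
  proof -
    have "ennreal (D (p n)) \<le> ennreal (C * real (Suc (n * k)) ^ d)"
      using modular_le[OF pk[of n]] C(2)[of "Suc (n * k)"] by (simp add: D(1)[symmetric])
    then have "D (p n) \<le> C * real (Suc (n * k)) ^ d" using C(1) by (simp add: ennreal_le_iff)
    then show ?thesis using D(2)[of 0] unfolding Dp by (simp add: field_simps)
  qed
  from le_one_of_poly_growth[OF this] have "D x \<le> D 0" using D(2)[of 0] by (simp add: field_simps)
  then show ?thesis by (simp add: D(1) ennreal_leI)
qed

lemma unimodular: "modular x = modular 0"
proof (rule antisym[OF modular_le_0])
  have "modular 0 * modular 0 = modular x * modular (- x)" using modular_add[of x "- x"] by simp
  also have "\<dots> \<le> modular x * modular 0" by (intro mult_left_mono modular_le_0) simp
  finally show "modular 0 \<le> modular x"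
    using modular_pos[of 0] modular_finite[of 0] by (simp add: ennreal_mult_le_mult_iff mult.commute)
qed

lemma modular_cancel: "modular 0 * a = modular 0 * b \<Longrightarrow> a = b"
  using modular_pos[of 0] modular_finite[of 0] by (auto simp: ennreal_mult_cancel_left)

lemma emeasure_right_translate:
  assumes "B \<in> sets borel"
  shows "emeasure M {x. x + x0 \<in> B} = emeasure M B"
  using emeasure_right_translate_modular[OF assms, of x0]
  by - (rule modular_cancel, simp add: unimodular[of x0] mult.commute)

lemma nn_integral_right_translate:
  assumes "f \<in> borel_measurable borel"
  shows "(\<integral>\<^sup>+s. f (s + x) \<partial>M) = (\<integral>\<^sup>+s. f s \<partial>M)"
proof -
  have m: "(\<lambda>s. s + x) \<in> measurable M borel"
    by (simp add: borel_measurable_continuous_onI continuous_intros)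
  have "distr M borel (\<lambda>s. s + x) = M"
    by (rule measure_eqI) (auto simp: sets_M emeasure_distr[OF m] vimage_def emeasure_right_translate)
  then have "(\<integral>\<^sup>+s. f s \<partial>M) = (\<integral>\<^sup>+s. f s \<partial>distr M borel (\<lambda>s. s + x))" by simp
  also have "\<dots> = (\<integral>\<^sup>+s. f (s + x) \<partial>M)"
    using assms by (intro nn_integral_distr m) simp
  finally show ?thesis ..
qed

lemma nn_integral_uminus:
  fixes f :: "'g \<Rightarrow> ennreal"
  assumes f: "f \<in> borel_measurable borel"
  shows "(\<integral>\<^sup>+s. f (- s) \<partial>M) = (\<integral>\<^sup>+s. f s \<partial>M)"
proof -
  have "modular 0 * (\<integral>\<^sup>+s. f (- s) \<partial>M) = (\<integral>\<^sup>+x. f x * modular x \<partial>M)"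
    using modular_identity[OF _ f, of "interior U" 0] by (simp add: modular_def)
  also have "\<dots> = (\<integral>\<^sup>+x. f x * modular 0 \<partial>M)"
    by (intro nn_integral_cong arg_cong2[where f="(*)"] refl unimodular)
  also have "\<dots> = (\<integral>\<^sup>+x. f x \<partial>M) * modular 0"
    using f by (intro nn_integral_multc) simp
  also have "\<dots> = modular 0 * (\<integral>\<^sup>+x. f x \<partial>M)" by (rule mult.commute)
  finally show ?thesis by (rule modular_cancel)
qed

end

section \<open>Word length and polynomial weights\<close>

context poly_growth_group
begin

lemma word_length_le_iff:
  assumes n: "n \<ge> 1"
  shows "word_length U x \<le> n \<longleftrightarrow> x \<in> power_set U n"
proof (cases "x = 0")
  case True
  have "0 \<in> power_set U 0" by simp
  then show ?thesis using True power_set_mono[OF U(4), of 0 n] by (auto simp: word_length_def)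
next
  case False
  let ?S = "{n. n \<ge> 1 \<and> x \<in> power_set U n}"
  have ne: "?S \<noteq> {}" using U(5) by blast
  then have I: "Inf ?S \<in> ?S" by (rule Inf_nat_def1)
  show ?thesis
  proof
    assume "word_length U x \<le> n"
    then show "x \<in> power_set U n" using I power_set_mono[OF U(4), of "Inf ?S" n] False by (auto simp: word_length_def)
  next
    assume "x \<in> power_set U n"
    then have "Inf ?S \<le> n" using n by (intro cInf_lower) auto
    then show "word_length U x \<le> n" using False by (simp add: word_length_def)
  qed
qed

lemma word_length_ge_1: "x \<noteq> 0 \<Longrightarrow> 1 \<le> word_length U x"
proof -
  assume x: "x \<noteq> 0"
  let ?S = "{n. n \<ge> 1 \<and> x \<in> power_set U n}"
  have "?S \<noteq> {}" using U(5) by blast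
  then have "Inf ?S \<in> ?S" by (rule Inf_nat_def1)
  then show ?thesis using x by (simp add: word_length_def)
qed

lemma word_length_0 [simp]: "word_length U 0 = 0"
  by (simp add: word_length_def)

lemma word_length_add: "word_length U (x + y) \<le> word_length U x + word_length U y"
proof (cases "x = 0 \<or> y = 0")
  case False
  then have 1: "1 \<le> word_length U x" "1 \<le> word_length U y" by (simp_all add: word_length_ge_1[simplified])
  have "x \<in> power_set U (word_length U x)" "y \<in> power_set U (word_length U y)"
    using word_length_le_iff[OF 1(1), of x] word_length_le_iff[OF 1(2), of y] by auto
  from power_set_add[OF this] show ?thesis
    using 1 by (subst word_length_le_iff) auto
qed auto

lemma word_length_uminus_le: "word_length U (- x) \<le> word_length U x"
proof (cases "x = 0")
  case False
  note 1 = word_length_ge_1[OF this]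
  have "x \<in> power_set U (word_length U x)" using word_length_le_iff[OF 1, of x] by auto
  from power_set_uminus[OF U(2) this] show ?thesis using 1 by (subst word_length_le_iff) auto
qed auto

lemma word_length_uminus [simp]: "word_length U (- x) = word_length U x"
  using word_length_uminus_le[of x] word_length_uminus_le[of "- x"] by simp

lemma word_length_measurable [measurable]: "(\<lambda>x. real (word_length U x)) \<in> borel_measurable borel"
proof (rule borel_measurableI_le)
  fix a :: real
  show "{x \<in> space borel. real (word_length U x) \<le> a} \<in> sets borel"
  proof (cases "a < 1")
    case True
    have "{x. real (word_length U x) \<le> a} = (if 0 \<le> a then {0} else {})"
      using True word_length_ge_1 by (force dest: word_length_ge_1)
    then show ?thesis by simp
  next
    case False
    have "real (word_length U x) \<le> a \<longleftrightarrow> word_length U x \<le> nat \<lfloor>a\<rfloor>" for x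
      using False by (simp add: le_nat_iff le_floor_iff)
    moreover have "1 \<le> nat \<lfloor>a\<rfloor>" using False by (simp add: le_nat_iff le_floor_iff)
    ultimately have "{x \<in> space borel. real (word_length U x) \<le> a} = power_set U (nat \<lfloor>a\<rfloor>)"
      by (auto simp: word_length_le_iff)
    then show ?thesis using compact_power_set[OF U(1)] by (simp add: compact_imp_closed)
  qed
qed

text \<open>Summing over the dyadic shells \<open>2 ^ k \<le> 1 + \<tau> < 2 ^ (k + 1)\<close>, each of measure
  \<open>O (2 ^ (k * d))\<close>.\<close>

lemma weight_integrable:
  fixes p :: real
  assumes p: "p > real d"
  shows "(\<integral>\<^sup>+x. ennreal ((1 + real (word_length U x)) powr (- p)) \<partial>M) < \<infinity>"
proof -
  obtain C where C: "C > 0" "\<And>n. n \<ge> 1 \<Longrightarrow> emeasure M (power_set U n) \<le> ennreal (C * real n ^ d)"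
    using growth by (auto simp: growth_bound_def)
  define q where "q = 2 powr (real d - p)"
  have q: "0 < q" "q < 1" using p by (auto simp: q_def powr_less_one)
  let ?P = "\<lambda>k. power_set U (2 ^ Suc k)"
  let ?c = "\<lambda>k::nat. (2 powr (- p)) ^ k"
  have Pm: "?P k \<in> sets M" for k using compact_power_set[OF U(1)] by (simp add: sets_M compact_imp_closed)
  have "ennreal ((1 + real (word_length U x)) powr (- p)) \<le> (\<Sum>k. ennreal (?c k) * indicator (?P k) x)" for x
  proof -
    obtain k where k: "2 ^ k \<le> Suc (word_length U x)" "Suc (word_length U x) < 2 ^ (k + 1)"
      using ex_power_ivl1[of 2 "Suc (word_length U x)"] by auto
    have "x \<in> ?P k" using k(2) by (subst word_length_le_iff[symmetric]) auto
    have "real (2 ^ k) \<le> 1 + real (word_length U x)" using k(1) of_nat_mono[of "2 ^ k" "Suc (word_length U x)"] by simp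
    then have "(1 + real (word_length U x)) powr (- p) \<le> (2 ^ k) powr (- p)"
      using p by (intro powr_mono2') auto
    also have "\<dots> = ?c k" by (simp add: powr_powr powr_realpow[symmetric] mult.commute)
    finally have "ennreal ((1 + real (word_length U x)) powr (- p)) \<le> ennreal (?c k) * indicator (?P k) x"
      using \<open>x \<in> ?P k\<close> by (simp add: ennreal_leI)
    also have "\<dots> \<le> (\<Sum>k. ennreal (?c k) * indicator (?P k) x)"
    proof -
      have "f k \<le> (\<Sum>k. f k)" for f :: "nat \<Rightarrow> ennreal"
        using sum_le_suminf[of f "{k}"] by simp
      then show ?thesis .
    qed
    finally show ?thesis .
  qed
  then have "(\<integral>\<^sup>+x. ennreal ((1 + real (word_length U x)) powr (- p)) \<partial>M) \<le>
      (\<integral>\<^sup>+x. (\<Sum>k. ennreal (?c k) * indicator (?P k) x) \<partial>M)"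
    by (intro nn_integral_mono)
  also have "\<dots> = (\<Sum>k. ennreal (?c k) * emeasure M (?P k))"
    using Pm by (simp add: nn_integral_suminf nn_integral_cmult_indicator del: power_Suc)
  also have "\<dots> \<le> (\<Sum>k. ennreal (C * 2 ^ d * q ^ k))"
  proof (intro suminf_le allI summableI)
    fix k :: nat
    have "ennreal (?c k) * emeasure M (?P k) \<le> ennreal (?c k) * ennreal (C * real (2 ^ Suc k) ^ d)"
      by (intro mult_left_mono C(2)) auto
    also have "\<dots> = ennreal (C * 2 ^ d * q ^ k)"
    proof -
      have "(2 powr - p) ^ k * (2 ^ k) ^ d = q ^ k"
      proof -
        have "((2::real) ^ k) ^ d = (2 powr real d) ^ k"
          by (simp add: powr_realpow power_mult[symmetric] mult.commute)
        then show ?thesis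
          by (simp add: q_def power_mult_distrib[symmetric] powr_add[symmetric])
      qed
      then have "?c k * (C * real (2 ^ Suc k) ^ d) = C * 2 ^ d * q ^ k"
        by (simp add: power_mult_distrib algebra_simps)
      moreover have "ennreal (?c k) * ennreal (C * real (2 ^ Suc k) ^ d) = ennreal (?c k * (C * real (2 ^ Suc k) ^ d))"
        using C(1) by (intro ennreal_mult[symmetric]) auto
      ultimately show ?thesis by (simp only:)
    qed
    finally show "ennreal (?c k) * emeasure M (?P k) \<le> ennreal (C * 2 ^ d * q ^ k)" .
  qed
  also have "\<dots> < \<infinity>"
  proof -
    have "summable (\<lambda>k. C * 2 ^ d * q ^ k)" using q by (intro summable_mult summable_geometric) simp
    then show ?thesis using C(1) q by (subst suminf_ennreal2) auto
  qed
  finally show ?thesis .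
qed

lemma poly_weight_measurable [measurable]: "poly_weight U \<beta> \<in> borel_measurable borel"
  unfolding poly_weight_def by measurable

lemma poly_weight_pos [simp]: "0 < poly_weight U \<beta> x" "0 \<le> poly_weight U \<beta> x"
  by (auto simp: poly_weight_def)

lemma poly_weight_uminus [simp]: "poly_weight U \<beta> (- x) = poly_weight U \<beta> x"
  by (simp add: poly_weight_def)

text \<open>Stronger than submultiplicativity: under a convolution the weight falls on one factor only, and the other is left
  with its unweighted norm.\<close>

lemma poly_weight_weakly_subadditive:
  assumes "\<beta> \<ge> 0"
  shows "poly_weight U \<beta> (x + y) \<le> 2 powr \<beta> * (poly_weight U \<beta> x + poly_weight U \<beta> y)"
proof -
  let ?a = "1 + real (word_length U x)" and ?b = "1 + real (word_length U y)"
  have "1 + real (word_length U (x + y)) \<le> 2 * max ?a ?b"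
    using word_length_add[of x y] by (simp add: max_def)
  then have "poly_weight U \<beta> (x + y) \<le> (2 * max ?a ?b) powr \<beta>"
    unfolding poly_weight_def using assms by (intro powr_mono2) auto
  also have "\<dots> = 2 powr \<beta> * max (?a powr \<beta>) (?b powr \<beta>)"
    using assms by (simp add: powr_mult max_def powr_mono2 powr_less_mono2 not_le antisym)
  also have "\<dots> \<le> 2 powr \<beta> * (poly_weight U \<beta> x + poly_weight U \<beta> y)"
    unfolding poly_weight_def by (intro mult_left_mono) auto
  finally show ?thesis .
qed

section \<open>Convolution\<close>

definition nconv :: "('g \<Rightarrow> ennreal) \<Rightarrow> ('g \<Rightarrow> ennreal) \<Rightarrow> 'g \<Rightarrow> ennreal" where
  "nconv F G t = (\<integral>\<^sup>+s. F s * G (- s + t) \<partial>M)"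

lemma nconv_measurable:
  assumes F: "F \<in> borel_measurable borel" and G: "G \<in> borel_measurable borel"
  shows "nconv F G \<in> borel_measurable borel"
proof -
  have "(\<lambda>p. F (snd p) * G (- snd p + fst p)) \<in> borel_measurable (borel :: ('g \<times> 'g) measure)"
    by (intro borel_measurable_times_ennreal borel_compose[OF F] borel_compose[OF G] continuous_intros)
  from radon_measurable_nn_integral[OF radon this] show ?thesis by (simp add: nconv_def[abs_def])
qed

text \<open>The two forms present the convolution as an average of left translates of \<open>G\<close>, respectively of right translates
  of \<open>F\<close>.\<close>

lemma nconv_pairing:
  assumes F: "F \<in> borel_measurable borel" and G: "G \<in> borel_measurable borel" and V: "V \<in> borel_measurable borel"
  shows "(\<integral>\<^sup>+t. nconv F G t * V t \<partial>M) = (\<integral>\<^sup>+s. F s * (\<integral>\<^sup>+t. G t * V (s + t) \<partial>M) \<partial>M)"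
    and "(\<integral>\<^sup>+t. nconv F G t * V t \<partial>M) = (\<integral>\<^sup>+t. G t * (\<integral>\<^sup>+s. F s * V (s + t) \<partial>M) \<partial>M)"
proof -
  have "(\<integral>\<^sup>+t. nconv F G t * V t \<partial>M) = (\<integral>\<^sup>+t. \<integral>\<^sup>+s. F s * G (- s + t) * V t \<partial>M \<partial>M)"
  proof (rule nn_integral_cong)
    fix t
    have "(\<lambda>s. F s * G (- s + t)) \<in> borel_measurable borel"
      by (intro borel_measurable_times_ennreal F borel_compose[OF G] continuous_intros)
    then show "nconv F G t * V t = (\<integral>\<^sup>+s. F s * G (- s + t) * V t \<partial>M)"
      by (simp add: nconv_def nn_integral_multc)
  qed
  also have "\<dots> = (\<integral>\<^sup>+s. \<integral>\<^sup>+t. F s * G (- s + t) * V t \<partial>M \<partial>M)"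
  proof -
    have "(\<lambda>p. F (snd p) * G (- snd p + fst p) * V (fst p)) \<in> borel_measurable (borel :: ('g \<times> 'g) measure)"
      by (intro borel_measurable_times_ennreal borel_compose[OF F] borel_compose[OF G] borel_compose[OF V] continuous_intros)
    from radon_tonelli[OF radon radon this] show ?thesis by simp
  qed
  also have "\<dots> = (\<integral>\<^sup>+s. \<integral>\<^sup>+t. F s * G t * V (s + t) \<partial>M \<partial>M)"
  proof (rule nn_integral_cong)
    fix s
    have "(\<lambda>t. F s * G (- s + t) * V t) \<in> borel_measurable borel"
      by (intro borel_measurable_times_ennreal borel_measurable_const V borel_compose[OF G] continuous_intros)
    from nn_integral_translate[OF this, of s]
    show "(\<integral>\<^sup>+t. F s * G (- s + t) * V t \<partial>M) = (\<integral>\<^sup>+t. F s * G t * V (s + t) \<partial>M)"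
      by (simp add: add.assoc[symmetric])
  qed
  finally have *: "(\<integral>\<^sup>+t. nconv F G t * V t \<partial>M) = (\<integral>\<^sup>+s. \<integral>\<^sup>+t. F s * G t * V (s + t) \<partial>M \<partial>M)" .
  also have "\<dots> = (\<integral>\<^sup>+s. F s * (\<integral>\<^sup>+t. G t * V (s + t) \<partial>M) \<partial>M)"
  proof (rule nn_integral_cong)
    fix s
    have "(\<lambda>t. G t * V (s + t)) \<in> borel_measurable borel"
      by (intro borel_measurable_times_ennreal G borel_compose[OF V] continuous_intros)
    then show "(\<integral>\<^sup>+t. F s * G t * V (s + t) \<partial>M) = F s * (\<integral>\<^sup>+t. G t * V (s + t) \<partial>M)"
      by (simp add: nn_integral_cmult mult.assoc)
  qed
  finally show "(\<integral>\<^sup>+t. nconv F G t * V t \<partial>M) = (\<integral>\<^sup>+s. F s * (\<integral>\<^sup>+t. G t * V (s + t) \<partial>M) \<partial>M)" .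
  note *
  also have "(\<integral>\<^sup>+s. \<integral>\<^sup>+t. F s * G t * V (s + t) \<partial>M \<partial>M) = (\<integral>\<^sup>+t. \<integral>\<^sup>+s. F s * G t * V (s + t) \<partial>M \<partial>M)"
  proof -
    have "(\<lambda>p. F (fst p) * G (snd p) * V (fst p + snd p)) \<in> borel_measurable (borel :: ('g \<times> 'g) measure)"
      by (intro borel_measurable_times_ennreal borel_compose[OF F] borel_compose[OF G] borel_compose[OF V] continuous_intros)
    from radon_tonelli[OF radon radon this] show ?thesis by simp
  qed
  also have "\<dots> = (\<integral>\<^sup>+t. G t * (\<integral>\<^sup>+s. F s * V (s + t) \<partial>M) \<partial>M)"
  proof (rule nn_integral_cong)
    fix t
    have "(\<lambda>s. F s * V (s + t)) \<in> borel_measurable borel"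
      by (intro borel_measurable_times_ennreal F borel_compose[OF V] continuous_intros)
    then show "(\<integral>\<^sup>+s. F s * G t * V (s + t) \<partial>M) = G t * (\<integral>\<^sup>+s. F s * V (s + t) \<partial>M)"
      by (simp add: nn_integral_cmult[symmetric] mult_ac)
  qed
  finally show "(\<integral>\<^sup>+t. nconv F G t * V t \<partial>M) = (\<integral>\<^sup>+t. G t * (\<integral>\<^sup>+s. F s * V (s + t) \<partial>M) \<partial>M)" .
qed

lemma nn_integral_nconv:
  assumes F: "F \<in> borel_measurable borel" and G: "G \<in> borel_measurable borel"
  shows "(\<integral>\<^sup>+t. nconv F G t \<partial>M) = (\<integral>\<^sup>+s. F s \<partial>M) * (\<integral>\<^sup>+s. G s \<partial>M)"
  using nconv_pairing(1)[OF F G, of "\<lambda>_. 1"] F by (simp add: nn_integral_multc)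

text \<open>Cauchy--Schwarz with respect to the measure with density \<open>a\<close>, then \<open>nn_integral_nconv\<close>.\<close>

lemma nconv_L2:
  fixes a :: "'g \<Rightarrow> real"
  assumes a: "a \<in> borel_measurable borel" "\<And>s. 0 \<le> a s" and G: "G \<in> borel_measurable borel"
  shows "(\<integral>\<^sup>+t. (nconv (\<lambda>s. ennreal (a s)) G t)\<^sup>2 \<partial>M) \<le> (\<integral>\<^sup>+s. ennreal (a s) \<partial>M)\<^sup>2 * (\<integral>\<^sup>+s. (G s)\<^sup>2 \<partial>M)"
proof -
  let ?F = "\<lambda>s. ennreal (a s)" and ?r = "\<lambda>s. ennreal (sqrt (a s))"
  have r: "?r s * ?r s = ?F s" for s using a(2)[of s] by (simp add: ennreal_mult[symmetric])
  have Fm: "?F \<in> borel_measurable borel" and rm: "?r \<in> borel_measurable borel" using a(1) by measurable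
  have Gm: "(\<lambda>s. (G s)\<^sup>2) \<in> borel_measurable borel" using G by measurable
  have "(nconv ?F G t)\<^sup>2 \<le> (\<integral>\<^sup>+s. ?F s \<partial>M) * nconv ?F (\<lambda>s. (G s)\<^sup>2) t" for t
  proof -
    have "(\<lambda>s. ?r s * G (- s + t)) \<in> borel_measurable M"
      unfolding borel_measurable_M by (intro borel_measurable_times_ennreal rm borel_compose[OF G] continuous_intros)
    moreover have "?r \<in> borel_measurable M" using rm by simp
    ultimately have "(\<integral>\<^sup>+s. ?r s * (?r s * G (- s + t)) \<partial>M)\<^sup>2 \<le> (\<integral>\<^sup>+s. (?r s)\<^sup>2 \<partial>M) * (\<integral>\<^sup>+s. (?r s * G (- s + t))\<^sup>2 \<partial>M)"
      by (rule Cauchy_Schwarz_nn_integral[rotated])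
    moreover have "?r s * (?r s * G (- s + t)) = ?F s * G (- s + t)" for s by (metis mult.assoc r)
    moreover have "(?r s)\<^sup>2 = ?F s" for s by (simp add: power2_eq_square r)
    ultimately show ?thesis by (simp add: nconv_def power_mult_distrib)
  qed
  then have "(\<integral>\<^sup>+t. (nconv ?F G t)\<^sup>2 \<partial>M) \<le> (\<integral>\<^sup>+t. (\<integral>\<^sup>+s. ?F s \<partial>M) * nconv ?F (\<lambda>s. (G s)\<^sup>2) t \<partial>M)"
    by (intro nn_integral_mono)
  also have "\<dots> = (\<integral>\<^sup>+s. ?F s \<partial>M) * ((\<integral>\<^sup>+s. ?F s \<partial>M) * (\<integral>\<^sup>+s. (G s)\<^sup>2 \<partial>M))"
    using nconv_measurable[OF Fm Gm] by (simp add: nn_integral_cmult nn_integral_nconv[OF Fm Gm])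
  finally show ?thesis by (simp add: power2_eq_square mult.assoc)
qed

lemma nn_integral_reflect:
  fixes f :: "'g \<Rightarrow> ennreal"
  assumes f: "f \<in> borel_measurable borel"
  shows "(\<integral>\<^sup>+s. f (- s + t) \<partial>M) = (\<integral>\<^sup>+s. f s \<partial>M)"
proof -
  have "(\<lambda>s. f (s + t)) \<in> borel_measurable borel" by (intro borel_compose[OF f] continuous_intros)
  from nn_integral_uminus[OF this] show ?thesis using nn_integral_right_translate[OF f] by simp
qed

lemma AE_eq_reflect:
  fixes g g' :: "'g \<Rightarrow> complex"
  assumes g: "g \<in> borel_measurable borel" "g' \<in> borel_measurable borel" and eq: "AE s in M. g s = g' s"
  shows "AE s in M. g (- s + t) = g' (- s + t)"
proof -
  let ?h = "\<lambda>s. ennreal (norm (g s - g' s))"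
  have h: "?h \<in> borel_measurable borel" using g by measurable
  have "(\<integral>\<^sup>+s. ?h s \<partial>M) = 0" using eq h by (subst nn_integral_0_iff_AE) auto
  then have "(\<integral>\<^sup>+s. ?h (- s + t) \<partial>M) = 0" using nn_integral_reflect[OF h] by simp
  moreover have "(\<lambda>s. ?h (- s + t)) \<in> borel_measurable M"
    unfolding borel_measurable_M by (intro borel_compose[OF h] continuous_intros)
  ultimately show ?thesis by (simp add: nn_integral_0_iff_AE)
qed

lemma distr_uminus: "distr M borel uminus = M"
proof -
  have m: "uminus \<in> measurable M borel" by (simp add: borel_measurable_continuous_onI continuous_intros)
  show ?thesis
  proof (rule measure_eqI)
    fix A assume "A \<in> sets (distr M borel uminus)"
    then have A: "A \<in> sets borel" by simp
    then have "{s. - s \<in> A} \<in> sets M" using measurable_sets[OF m A] by (simp add: vimage_def sets_M)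
    then have "emeasure M {s. - s \<in> A} = (\<integral>\<^sup>+s. indicator A (- s) \<partial>M)"
      using nn_integral_indicator[of "{s. - s \<in> A}" M] by (simp add: indicator_def)
    also have "\<dots> = emeasure M A" using A by (subst nn_integral_uminus) (auto simp: sets_M)
    finally show "emeasure (distr M borel uminus) A = emeasure M A"
      using A by (simp add: emeasure_distr[OF m] vimage_def)
  qed (simp add: sets_M)
qed

lemma integral_translate:
  fixes f :: "'g \<Rightarrow> complex"
  assumes "f \<in> borel_measurable borel"
  shows "(\<integral>s. f (x + s) \<partial>M) = (\<integral>s. f s \<partial>M)"
  using integral_distr[of "\<lambda>s. x + s" M borel f] assms
  by (simp add: distr_translate distr_uminus borel_measurable_continuous_onI continuous_intros)

lemma integral_uminus:
  fixes f :: "'g \<Rightarrow> complex"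
  assumes "f \<in> borel_measurable borel"
  shows "(\<integral>s. f (- s) \<partial>M) = (\<integral>s. f s \<partial>M)"
  using integral_distr[of "uminus" M borel f] assms
  by (simp add: distr_translate distr_uminus borel_measurable_continuous_onI continuous_intros)

end

section \<open>Twisted convolution on integrable functions\<close>

locale twisted_group = poly_growth_group +
  fixes \<Omega> :: "'a::{topological_group_add, t2_space} \<Rightarrow> 'a \<Rightarrow> complex"
  assumes cocycle: "circle_cocycle \<Omega>"
begin

lemma norm_cocycle [simp]: "norm (\<Omega> r s) = 1"
  using cocycle by (simp add: circle_cocycle_def)

lemma cocycle_eq: "\<Omega> r s * \<Omega> (r + s) t = \<Omega> s t * \<Omega> r (s + t)"
  using cocycle by (simp add: circle_cocycle_def)

lemma cocycle_0 [simp]: "\<Omega> r 0 = 1" "\<Omega> 0 r = 1"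
  using cocycle by (simp_all add: circle_cocycle_def)

lemma cocycle_cnj [simp]: "\<Omega> r s * cnj (\<Omega> r s) = 1" "cnj (\<Omega> r s) * \<Omega> r s = 1"
  using norm_cocycle[of r s] by (simp_all add: complex_norm_square[symmetric] mult.commute)

lemma cocycle_inverse_eq: "\<Omega> s (- s) = \<Omega> (- s) s"
  using cocycle_eq[of s "- s" s] by simp

lemma cocycle_uminus: "\<Omega> s (- s + t) = \<Omega> (- s) s * cnj (\<Omega> (- s) t)"
proof -
  have "\<Omega> (- s) s = \<Omega> s (- s + t) * \<Omega> (- s) t"
    using cocycle_eq[of "- s" s "- s + t"] by (simp add: add.assoc[symmetric])
  then have "\<Omega> (- s) s * cnj (\<Omega> (- s) t) = \<Omega> s (- s + t) * (\<Omega> (- s) t * cnj (\<Omega> (- s) t))"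
    by (simp add: mult.assoc)
  then show ?thesis by simp
qed

lemma cocycle_measurable:
  assumes "continuous_on UNIV f" "continuous_on UNIV g"
  shows "(\<lambda>p. \<Omega> (f p) (g p)) \<in> borel_measurable borel"
proof -
  have c: "continuous_on UNIV (\<lambda>(r, s). \<Omega> r s)" using cocycle by (simp add: circle_cocycle_def)
  have "continuous_on UNIV (\<lambda>p. (f p, g p))" by (intro continuous_on_Pair assms)
  from continuous_on_compose2[OF c this] show ?thesis by (intro borel_measurable_continuous_onI) simp
qed

abbreviation mag :: "('a \<Rightarrow> complex) \<Rightarrow> 'a \<Rightarrow> ennreal" where
  "mag f \<equiv> (\<lambda>s. ennreal (norm (f s)))"

abbreviation tc :: "('a \<Rightarrow> complex) \<Rightarrow> ('a \<Rightarrow> complex) \<Rightarrow> 'a \<Rightarrow> complex" (infixl "\<circledast>" 70) where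
  "f \<circledast> g \<equiv> tconv M \<Omega> f g"

abbreviation L1 :: "('a \<Rightarrow> complex) set" where
  "L1 \<equiv> {f \<in> borel_measurable borel. (\<integral>\<^sup>+s. mag f s \<partial>M) < \<infinity>}"

abbreviation L2 :: "('a \<Rightarrow> complex) set" where
  "L2 \<equiv> {f \<in> borel_measurable borel. (\<integral>\<^sup>+s. (mag f s)\<^sup>2 \<partial>M) < \<infinity>}"

lemma mag_measurable: "f \<in> borel_measurable borel \<Longrightarrow> mag f \<in> borel_measurable borel"
  by measurable

lemma L1_iff_integrable: "f \<in> L1 \<longleftrightarrow> integrable M f"
  by (simp add: integrable_iff_bounded)

lemma tconv_integrand_measurable:
  assumes f: "f \<in> borel_measurable borel" and g: "g \<in> borel_measurable borel"
  shows "(\<lambda>p. tconv_integrand \<Omega> f g (fst p) (snd p)) \<in> borel_measurable (borel :: ('a \<times> 'a) measure)"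
    "tconv_integrand \<Omega> f g t \<in> borel_measurable borel"
  unfolding tconv_integrand_def
  by (intro borel_measurable_times borel_compose[OF f] borel_compose[OF g] cocycle_measurable f continuous_intros)+

lemma norm_tconv_integrand: "norm (tconv_integrand \<Omega> f g t s) = norm (f s) * norm (g (- s + t))"
  by (simp add: tconv_integrand_def norm_mult)

lemma nn_integral_tconv_integrand:
  "(\<integral>\<^sup>+s. ennreal (norm (tconv_integrand \<Omega> f g t s)) \<partial>M) = nconv (mag f) (mag g) t"
  by (simp add: nconv_def norm_tconv_integrand ennreal_mult)

lemma tconv_measurable [measurable]:
  assumes f: "f \<in> borel_measurable borel" and g: "g \<in> borel_measurable borel"
  shows "f \<circledast> g \<in> borel_measurable borel"
  using radon_measurable_integral[OF radon tconv_integrand_measurable(1)[OF f g]]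
  by (simp add: tconv_def[abs_def])

lemma norm_tconv_le: "ennreal (norm ((f \<circledast> g) t)) \<le> nconv (mag f) (mag g) t"
proof (cases "integrable M (tconv_integrand \<Omega> f g t)")
  case True
  from integral_norm_bound_ennreal[OF this] show ?thesis
    by (simp add: tconv_def nn_integral_tconv_integrand)
next
  case False
  then show ?thesis by (simp add: tconv_def not_integrable_integral_eq)
qed

lemma integrable_tconv_integrand:
  assumes "f \<in> borel_measurable borel" "g \<in> borel_measurable borel" "nconv (mag f) (mag g) t < \<infinity>"
  shows "integrable M (tconv_integrand \<Omega> f g t)"
  using assms tconv_integrand_measurable(2)[OF assms(1,2), of t]
  by (simp add: integrable_iff_bounded nn_integral_tconv_integrand)

lemma AE_nconv_finite:
  assumes F: "F \<in> borel_measurable borel" "(\<integral>\<^sup>+s. F s \<partial>M) < \<infinity>"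
    and G: "G \<in> borel_measurable borel" "(\<integral>\<^sup>+s. G s \<partial>M) < \<infinity>"
  shows "AE t in M. nconv F G t < \<infinity>"
proof -
  have "(\<integral>\<^sup>+t. nconv F G t \<partial>M) \<noteq> \<infinity>"
    using F G by (simp add: nn_integral_nconv[OF F(1) G(1)] ennreal_mult_eq_top_iff less_top)
  then have "AE t in M. nconv F G t \<noteq> \<infinity>"
    using nconv_measurable[OF F(1) G(1)] by (intro nn_integral_PInf_AE) simp_all
  then show ?thesis by eventually_elim (simp add: less_top)
qed

lemma AE_integrable_tconv:
  assumes "f \<in> L1" "g \<in> L1"
  shows "AE t in M. integrable M (tconv_integrand \<Omega> f g t)"
proof -
  have "AE t in M. nconv (mag f) (mag g) t < \<infinity>" using assms by (intro AE_nconv_finite mag_measurable) auto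
  then show ?thesis by eventually_elim (use assms in \<open>auto intro!: integrable_tconv_integrand\<close>)
qed

lemma L1_norm_tconv:
  assumes f: "f \<in> borel_measurable borel" and g: "g \<in> borel_measurable borel"
  shows "(\<integral>\<^sup>+t. mag (f \<circledast> g) t \<partial>M) \<le> (\<integral>\<^sup>+s. mag f s \<partial>M) * (\<integral>\<^sup>+s. mag g s \<partial>M)"
  using nn_integral_mono[of M "mag (f \<circledast> g)" "nconv (mag f) (mag g)", OF norm_tconv_le]
    nn_integral_nconv[OF mag_measurable[OF f] mag_measurable[OF g]] by simp

lemma L2_norm_tconv:
  assumes f: "f \<in> borel_measurable borel" and g: "g \<in> borel_measurable borel"
  shows "(\<integral>\<^sup>+t. (mag (f \<circledast> g) t)\<^sup>2 \<partial>M) \<le> (\<integral>\<^sup>+s. mag f s \<partial>M)\<^sup>2 * (\<integral>\<^sup>+s. (mag g s)\<^sup>2 \<partial>M)"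
proof -
  have "(\<integral>\<^sup>+t. (mag (f \<circledast> g) t)\<^sup>2 \<partial>M) \<le> (\<integral>\<^sup>+t. (nconv (mag f) (mag g) t)\<^sup>2 \<partial>M)"
    by (intro nn_integral_mono power_mono norm_tconv_le) simp
  also have "\<dots> \<le> (\<integral>\<^sup>+s. mag f s \<partial>M)\<^sup>2 * (\<integral>\<^sup>+s. (mag g s)\<^sup>2 \<partial>M)"
    using f g by (intro nconv_L2) auto
  finally show ?thesis .
qed

lemma L2_tconv: "f \<in> L1 \<Longrightarrow> g \<in> L2 \<Longrightarrow> f \<circledast> g \<in> L2"
proof -
  assume "f \<in> L1" "g \<in> L2"
  then have "(\<integral>\<^sup>+t. (mag (f \<circledast> g) t)\<^sup>2 \<partial>M) < \<infinity>"
    using L2_norm_tconv[of f g] by (auto simp: ennreal_mult_less_top power2_eq_square less_top intro: le_less_trans)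
  then show ?thesis using \<open>f \<in> L1\<close> \<open>g \<in> L2\<close> by (simp add: tconv_measurable)
qed

lemma tconv_cong_AE:
  assumes f: "f \<in> borel_measurable borel" "f' \<in> borel_measurable borel" "AE s in M. f s = f' s"
    and g: "g \<in> borel_measurable borel" "g' \<in> borel_measurable borel" "AE s in M. g s = g' s"
  shows "f \<circledast> g = f' \<circledast> g'"
proof
  fix t
  have "AE s in M. g (- s + t) = g' (- s + t)" by (rule AE_eq_reflect[OF g])
  then have "AE s in M. tconv_integrand \<Omega> f g t s = tconv_integrand \<Omega> f' g' t s"
    using f(3) by eventually_elim (simp add: tconv_integrand_def)
  then show "(f \<circledast> g) t = (f' \<circledast> g') t"
    unfolding tconv_def using f g
    by (intro integral_cong_AE) (simp_all add: tconv_integrand_measurable)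
qed

lemma tconv_add_left:
  assumes "f \<in> L1" "f' \<in> L1" "g \<in> L1"
  shows "AE t in M. ((\<lambda>s. f s + f' s) \<circledast> g) t = (f \<circledast> g) t + (f' \<circledast> g) t"
  using AE_integrable_tconv[OF assms(1,3)] AE_integrable_tconv[OF assms(2,3)]
proof eventually_elim
  case (elim t)
  have "tconv_integrand \<Omega> (\<lambda>s. f s + f' s) g t s = tconv_integrand \<Omega> f g t s + tconv_integrand \<Omega> f' g t s" for s
    by (simp add: tconv_integrand_def algebra_simps)
  then show ?case using elim by (simp add: tconv_def)
qed

lemma tconv_add_right:
  assumes "f \<in> L1" "g \<in> L1" "g' \<in> L1"
  shows "AE t in M. (f \<circledast> (\<lambda>s. g s + g' s)) t = (f \<circledast> g) t + (f \<circledast> g') t"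
  using AE_integrable_tconv[OF assms(1,2)] AE_integrable_tconv[OF assms(1,3)]
proof eventually_elim
  case (elim t)
  have "tconv_integrand \<Omega> f (\<lambda>s. g s + g' s) t s = tconv_integrand \<Omega> f g t s + tconv_integrand \<Omega> f g' t s" for s
    by (simp add: tconv_integrand_def algebra_simps)
  then show ?case using elim by (simp add: tconv_def)
qed

lemma tconv_scale_left: "((\<lambda>s. c * f s) \<circledast> g) = (\<lambda>t. c * (f \<circledast> g) t)"
proof
  fix t
  have "tconv_integrand \<Omega> (\<lambda>s. c * f s) g t s = c * tconv_integrand \<Omega> f g t s" for s
    by (simp add: tconv_integrand_def)
  then show "((\<lambda>s. c * f s) \<circledast> g) t = c * (f \<circledast> g) t" by (simp add: tconv_def)
qed

lemma tconv_scale_right: "(f \<circledast> (\<lambda>s. c * g s)) = (\<lambda>t. c * (f \<circledast> g) t)"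
proof
  fix t
  have "tconv_integrand \<Omega> f (\<lambda>s. c * g s) t s = c * tconv_integrand \<Omega> f g t s" for s
    by (simp add: tconv_integrand_def)
  then show "(f \<circledast> (\<lambda>s. c * g s)) t = c * (f \<circledast> g) t" by (simp add: tconv_def)
qed

text \<open>After the change of order the substitution of \<open>r + s\<close> for \<open>s\<close> matches the two products of cocycle values by the
  cocycle identity.\<close>

lemma tconv_assoc_at:
  assumes f: "f \<in> borel_measurable borel" and g: "g \<in> borel_measurable borel" and h: "h \<in> borel_measurable borel"
    and fin: "nconv (nconv (mag f) (mag g)) (mag h) t < \<infinity>"
  shows "((f \<circledast> g) \<circledast> h) t = (f \<circledast> (g \<circledast> h)) t"
proof -
  define F where "F p = f (snd p) * g (- snd p + fst p) * \<Omega> (snd p) (- snd p + fst p) * h (- fst p + t) * \<Omega> (fst p) (- fst p + t)" for p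
  have F: "F \<in> borel_measurable borel"
    unfolding F_def
    by (intro borel_measurable_times borel_compose[OF f] borel_compose[OF g] borel_compose[OF h] cocycle_measurable continuous_intros)
  have gs: "(\<lambda>r. mag f r * mag g (- r + s)) \<in> borel_measurable borel" for s
    by (intro borel_measurable_times_ennreal mag_measurable[OF f] borel_compose[OF mag_measurable[OF g]] continuous_intros)
  have "(\<integral>\<^sup>+s. \<integral>\<^sup>+r. ennreal (norm (F (s, r))) \<partial>M \<partial>M) = nconv (nconv (mag f) (mag g)) (mag h) t"
    unfolding nconv_def[of "nconv (mag f) (mag g)"] unfolding nconv_def
    using gs by (intro nn_integral_cong) (simp add: F_def norm_mult ennreal_mult nn_integral_multc)
  then have fin': "(\<integral>\<^sup>+s. \<integral>\<^sup>+r. ennreal (norm (F (s, r))) \<partial>M \<partial>M) < \<infinity>" using fin by simp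
  have "((f \<circledast> g) \<circledast> h) t = (\<integral>s. \<integral>r. F (s, r) \<partial>M \<partial>M)"
    by (simp add: tconv_def tconv_integrand_def F_def)
  also have "\<dots> = (\<integral>r. \<integral>s. F (s, r) \<partial>M \<partial>M)"
    by (rule radon_fubini[OF radon radon F fin'])
  also have "\<dots> = (\<integral>r. f r * (g \<circledast> h) (- r + t) * \<Omega> r (- r + t) \<partial>M)"
  proof (rule Bochner_Integration.integral_cong[OF refl])
    fix r
    have "(\<integral>s. F (s, r) \<partial>M) = (\<integral>s. F (r + s, r) \<partial>M)"
    proof -
      have "(\<lambda>s. F (s, r)) \<in> borel_measurable borel" by (rule measurable_Pair_slice(2)[OF F])
      from integral_translate[OF this] show ?thesis by simp
    qed
    also have "\<dots> = (\<integral>s. f r * (g s * h (- s + (- r + t)) * \<Omega> s (- s + (- r + t))) * \<Omega> r (- r + t) \<partial>M)"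
    proof (rule Bochner_Integration.integral_cong[OF refl])
      fix s
      have "\<Omega> r s * \<Omega> (r + s) (- s + (- r + t)) = \<Omega> s (- s + (- r + t)) * \<Omega> r (- r + t)"
        using cocycle_eq[of r s "- s + (- r + t)"] by (simp only: add_minus_cancel)
      then have "f r * g s * h (- s + (- r + t)) * (\<Omega> r s * \<Omega> (r + s) (- s + (- r + t))) =
          f r * g s * h (- s + (- r + t)) * (\<Omega> s (- s + (- r + t)) * \<Omega> r (- r + t))" by simp
      then show "F (r + s, r) = f r * (g s * h (- s + (- r + t)) * \<Omega> s (- s + (- r + t))) * \<Omega> r (- r + t)"
        by (simp add: F_def minus_add add.assoc[symmetric] mult_ac)
    qed
    also have "\<dots> = f r * (g \<circledast> h) (- r + t) * \<Omega> r (- r + t)"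
      by (simp add: tconv_def tconv_integrand_def)
    finally show "(\<integral>s. F (s, r) \<partial>M) = f r * (g \<circledast> h) (- r + t) * \<Omega> r (- r + t)" .
  qed
  finally show ?thesis by (simp add: tconv_def[of _ _ f] tconv_integrand_def)
qed

lemma tconv_assoc:
  assumes "f \<in> L1" "g \<in> L1" "h \<in> L1"
  shows "AE t in M. ((f \<circledast> g) \<circledast> h) t = (f \<circledast> (g \<circledast> h)) t"
proof -
  have m: "mag f \<in> borel_measurable borel" "mag g \<in> borel_measurable borel" "mag h \<in> borel_measurable borel"
    using assms by (auto intro: mag_measurable)
  have "(\<integral>\<^sup>+s. nconv (mag f) (mag g) s \<partial>M) < \<infinity>"
    using assms by (auto simp: nn_integral_nconv[OF m(1,2)] ennreal_mult_less_top)
  then have "AE t in M. nconv (nconv (mag f) (mag g)) (mag h) t < \<infinity>"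
    using assms by (intro AE_nconv_finite nconv_measurable m) auto
  then show ?thesis by eventually_elim (use assms in \<open>auto intro: tconv_assoc_at\<close>)
qed

abbreviation inv_t :: "('a \<Rightarrow> complex) \<Rightarrow> 'a \<Rightarrow> complex" where
  "inv_t \<equiv> tinvol \<Omega>"

lemma tinvol_measurable: "f \<in> borel_measurable borel \<Longrightarrow> inv_t f \<in> borel_measurable borel"
  unfolding tinvol_def[abs_def]
proof (intro borel_measurable_times)
  assume f: "f \<in> borel_measurable borel"
  have cm: "(\<lambda>z. cnj z) \<in> borel_measurable borel" by (intro borel_measurable_continuous_onI continuous_intros)
  show "(\<lambda>s. cnj (f (- s))) \<in> borel_measurable borel"
    by (rule measurable_compose[OF borel_compose[OF f] cm]) (intro continuous_intros)
  show "(\<lambda>s. cnj (\<Omega> s (- s))) \<in> borel_measurable borel"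
    by (rule measurable_compose[OF cocycle_measurable cm]) (intro continuous_intros)+
qed

lemma norm_tinvol [simp]: "norm (inv_t f s) = norm (f (- s))"
  by (simp add: tinvol_def norm_mult)

lemma tinvol_tinvol [simp]: "inv_t (inv_t f) = f"
proof
  fix s
  have "inv_t (inv_t f) s = f s * (\<Omega> (- s) s * cnj (\<Omega> s (- s)))"
    by (simp add: tinvol_def)
  then show "inv_t (inv_t f) s = f s" using cocycle_inverse_eq[of s] by simp
qed

lemma L1_norm_tinvol: "f \<in> borel_measurable borel \<Longrightarrow> (\<integral>\<^sup>+s. mag (inv_t f) s \<partial>M) = (\<integral>\<^sup>+s. mag f s \<partial>M)"
  using nn_integral_uminus[of "mag f"] by (simp add: mag_measurable)

lemma L1_tinvol: "f \<in> L1 \<Longrightarrow> inv_t f \<in> L1"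
  using L1_norm_tinvol[of f] tinvol_measurable[of f] by simp

text \<open>An identity at every point: the substitution of \<open>t + s\<close> for \<open>s\<close> turns one integrand into the other, and where
  the integral diverges both sides are \<open>0\<close>.\<close>

lemma tinvol_tconv:
  assumes f: "f \<in> borel_measurable borel" and g: "g \<in> borel_measurable borel"
  shows "inv_t (f \<circledast> g) = inv_t g \<circledast> inv_t f"
proof
  fix t
  let ?k = "\<lambda>s. inv_t g s * inv_t f (- s + t) * \<Omega> s (- s + t)"
  have "(inv_t g \<circledast> inv_t f) t = (\<integral>s. ?k s \<partial>M)"
    by (simp add: tconv_def tconv_integrand_def)
  also have "\<dots> = (\<integral>s. ?k (t + s) \<partial>M)"
  proof -
    have "?k \<in> borel_measurable borel"
      by (intro borel_measurable_times tinvol_measurable g f borel_compose[OF tinvol_measurable[OF f]] cocycle_measurable continuous_intros)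
    from integral_translate[OF this] show ?thesis by simp
  qed
  also have "\<dots> = (\<integral>s. cnj (f s * g (- s + - t) * \<Omega> s (- s + - t)) * cnj (\<Omega> t (- t)) \<partial>M)"
  proof (rule Bochner_Integration.integral_cong[OF refl])
    fix s
    have a: "- (t + s) = - s + - t" by (simp only: minus_add)
    have b: "- (t + s) + t = - s" by (simp add: a add.assoc)
    have "cnj (\<Omega> (t + s) (- (t + s))) * cnj (\<Omega> (- s) s) * \<Omega> (t + s) (- s) =
        cnj (\<Omega> s (- s + - t)) * cnj (\<Omega> t (- t))"
    proof -
      have 1: "\<Omega> (t + s) (- s) * \<Omega> t (- t) = \<Omega> (- s) (- t) * \<Omega> (t + s) (- (t + s))"
        using cocycle_eq[of "t + s" "- s" "- t"] by (simp add: a add.assoc)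
      have 2: "\<Omega> s (- s) = \<Omega> (- s) (- t) * \<Omega> s (- s + - t)"
        using cocycle_eq[of s "- s" "- t"] by simp
      let ?A = "\<Omega> (t + s) (- (t + s))" and ?B = "\<Omega> (t + s) (- s)" and ?C = "\<Omega> t (- t)"
        and ?D = "\<Omega> (- s) (- t)" and ?E = "\<Omega> s (- s)" and ?F = "\<Omega> s (- s + - t)"
      have "cnj ?A * cnj ?E * ?B = cnj ?A * cnj ?E * (?B * ?C) * cnj ?C" by simp
      also have "\<dots> = (cnj ?A * ?A) * (cnj ?E * ?D) * cnj ?C" unfolding 1 by (simp only: mult_ac)
      also have "cnj ?E * ?D = (cnj ?D * ?D) * cnj ?F" unfolding 2 by simp
      finally show ?thesis by (simp add: cocycle_inverse_eq[of s, symmetric])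
    qed
    then have "cnj (g (- (t + s))) * cnj (f s) * (cnj (\<Omega> (t + s) (- (t + s))) * cnj (\<Omega> (- s) s) * \<Omega> (t + s) (- s)) =
      cnj (g (- (t + s))) * cnj (f s) * (cnj (\<Omega> s (- s + - t)) * cnj (\<Omega> t (- t)))" by simp
    then show "?k (t + s) = cnj (f s * g (- s + - t) * \<Omega> s (- s + - t)) * cnj (\<Omega> t (- t))"
      unfolding tinvol_def b by (simp add: a mult_ac)
  qed
  also have "\<dots> = cnj ((f \<circledast> g) (- t)) * cnj (\<Omega> t (- t))"
    by (simp add: tconv_def tconv_integrand_def del: complex_cnj_mult)
  finally show "inv_t (f \<circledast> g) t = (inv_t g \<circledast> inv_t f) t" by (simp add: tinvol_def)
qed

section \<open>The left regular representation on square integrable functions\<close>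

lemma L2_product_finite:
  assumes f: "f \<in> L2" and g: "g \<in> L2"
  shows "(\<integral>\<^sup>+t. mag f t * mag g t \<partial>M) < \<infinity>"
proof -
  have "(\<integral>\<^sup>+t. mag f t * mag g t \<partial>M)\<^sup>2 \<le> (\<integral>\<^sup>+t. (mag f t)\<^sup>2 \<partial>M) * (\<integral>\<^sup>+t. (mag g t)\<^sup>2 \<partial>M)"
    using f g by (intro Cauchy_Schwarz_nn_integral) (auto intro: mag_measurable)
  also have "\<dots> < \<infinity>" using f g by (auto simp: ennreal_mult_less_top)
  finally show ?thesis by (auto simp: power2_eq_square ennreal_mult_less_top less_top)
qed

text \<open>Fubini, with the substitutions of \<open>s + t\<close> for \<open>t\<close> and of \<open>- s\<close> for \<open>s\<close>; the second one uses unimodularity. The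
  cocycle values match by \<open>cocycle_uminus\<close>.\<close>

lemma adjoint_tconv:
  assumes a: "a \<in> L1" and \<eta>: "\<eta> \<in> L2" and \<xi>: "\<xi> \<in> L2"
  shows "(\<integral>t. (inv_t a \<circledast> \<eta>) t * cnj (\<xi> t) \<partial>M) = (\<integral>t. \<eta> t * cnj ((a \<circledast> \<xi>) t) \<partial>M)"
proof -
  have am: "a \<in> borel_measurable borel" and em: "\<eta> \<in> borel_measurable borel" and xm: "\<xi> \<in> borel_measurable borel"
    using a \<eta> \<xi> by auto
  note im = tinvol_measurable[OF am]
  have cm: "(\<lambda>z. cnj z) \<in> borel_measurable borel" by (intro borel_measurable_continuous_onI continuous_intros)
  have xm': "(\<lambda>t. cnj (\<xi> t)) \<in> borel_measurable borel" by (rule measurable_compose[OF xm cm])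
  define F where "F p = inv_t a (snd p) * \<eta> (- snd p + fst p) * \<Omega> (snd p) (- snd p + fst p) * cnj (\<xi> (fst p))" for p
  define H where "H p = inv_t a (- snd p) * \<eta> (fst p) * \<Omega> (- snd p) (fst p) * cnj (\<xi> (- snd p + fst p))" for p
  have F: "F \<in> borel_measurable borel" unfolding F_def
    by (intro borel_measurable_times borel_compose[OF im] borel_compose[OF em] borel_compose[OF xm'] cocycle_measurable continuous_intros)
  have H: "H \<in> borel_measurable borel" unfolding H_def
    by (intro borel_measurable_times borel_compose[OF im] borel_compose[OF em] borel_compose[OF xm'] cocycle_measurable continuous_intros)
  have finF: "(\<integral>\<^sup>+t. \<integral>\<^sup>+s. ennreal (norm (F (t, s))) \<partial>M \<partial>M) < \<infinity>"
  proof -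
    have "(\<integral>\<^sup>+t. \<integral>\<^sup>+s. ennreal (norm (F (t, s))) \<partial>M \<partial>M) = (\<integral>\<^sup>+t. nconv (mag (inv_t a)) (mag \<eta>) t * mag \<xi> t \<partial>M)"
    proof (rule nn_integral_cong)
      fix t
      have "(\<lambda>s. mag (inv_t a) s * mag \<eta> (- s + t)) \<in> borel_measurable borel"
        by (intro borel_measurable_times_ennreal mag_measurable[OF im] borel_compose[OF mag_measurable[OF em]] continuous_intros)
      then show "(\<integral>\<^sup>+s. ennreal (norm (F (t, s))) \<partial>M) = nconv (mag (inv_t a)) (mag \<eta>) t * mag \<xi> t"
        by (simp add: F_def norm_mult ennreal_mult nconv_def nn_integral_multc del: norm_tinvol)
    qed
    moreover have "(\<integral>\<^sup>+t. nconv (mag (inv_t a)) (mag \<eta>) t * mag \<xi> t \<partial>M) < \<infinity>"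
    proof -
      have "(\<integral>\<^sup>+t. nconv (mag (inv_t a)) (mag \<eta>) t * mag \<xi> t \<partial>M)\<^sup>2 \<le>
         (\<integral>\<^sup>+t. (nconv (mag (inv_t a)) (mag \<eta>) t)\<^sup>2 \<partial>M) * (\<integral>\<^sup>+t. (mag \<xi> t)\<^sup>2 \<partial>M)"
        using nconv_measurable[OF mag_measurable[OF im] mag_measurable[OF em]] mag_measurable[OF xm]
        by (intro Cauchy_Schwarz_nn_integral) auto
      also have "\<dots> \<le> ((\<integral>\<^sup>+s. mag (inv_t a) s \<partial>M)\<^sup>2 * (\<integral>\<^sup>+s. (mag \<eta> s)\<^sup>2 \<partial>M)) * (\<integral>\<^sup>+t. (mag \<xi> t)\<^sup>2 \<partial>M)"
        by (intro mult_right_mono nconv_L2) (use im em in \<open>auto simp del: norm_tinvol intro: mag_measurable\<close>)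
      also have "\<dots> < \<infinity>"
        using a \<eta> \<xi> L1_norm_tinvol[OF am] by (auto simp: ennreal_mult_less_top power2_eq_square simp del: norm_tinvol)
      finally show ?thesis by (auto simp: power2_eq_square ennreal_mult_less_top less_top)
    qed
    ultimately show ?thesis by simp
  qed
  have FH: "F (s + t, s) = H (t, - s)" for s t
    by (simp add: F_def H_def add.assoc[symmetric])
  have "(\<integral>t. (inv_t a \<circledast> \<eta>) t * cnj (\<xi> t) \<partial>M) = (\<integral>t. \<integral>s. F (t, s) \<partial>M \<partial>M)"
    by (simp add: tconv_def tconv_integrand_def F_def)
  also have "\<dots> = (\<integral>s. \<integral>t. F (t, s) \<partial>M \<partial>M)" by (rule radon_fubini[OF radon radon F finF])
  also have "\<dots> = (\<integral>s. \<integral>t. H (t, - s) \<partial>M \<partial>M)"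
    using integral_translate[OF measurable_Pair_slice(2)[OF F]] by (simp add: FH[symmetric])
  also have "\<dots> = (\<integral>s. \<integral>t. H (t, s) \<partial>M \<partial>M)"
  proof -
    have "(\<lambda>p. H (snd p, fst p)) \<in> borel_measurable (borel :: ('a \<times> 'a) measure)"
      by (intro borel_compose[OF H] continuous_intros)
    from radon_measurable_integral[OF radon this] have "(\<lambda>s. \<integral>t. H (t, s) \<partial>M) \<in> borel_measurable borel" by simp
    from integral_uminus[OF this] show ?thesis .
  qed
  also have "\<dots> = (\<integral>t. \<integral>s. H (t, s) \<partial>M \<partial>M)"
  proof (rule radon_fubini[OF radon radon H, symmetric])
    have Fn: "(\<lambda>p. ennreal (norm (F p))) \<in> borel_measurable borel" and Hn: "(\<lambda>p. ennreal (norm (H p))) \<in> borel_measurable borel"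
      using F H by measurable
    have "(\<integral>\<^sup>+t. \<integral>\<^sup>+s. ennreal (norm (H (t, s))) \<partial>M \<partial>M) = (\<integral>\<^sup>+t. \<integral>\<^sup>+s. ennreal (norm (H (t, - s))) \<partial>M \<partial>M)"
      using nn_integral_uminus[OF measurable_Pair_slice(1)[OF Hn]] by simp
    also have "\<dots> = (\<integral>\<^sup>+t. \<integral>\<^sup>+s. ennreal (norm (F (s + t, s))) \<partial>M \<partial>M)" by (simp add: FH)
    also have "\<dots> = (\<integral>\<^sup>+s. \<integral>\<^sup>+t. ennreal (norm (F (s + t, s))) \<partial>M \<partial>M)"
    proof -
      have "(\<lambda>p. ennreal (norm (F (snd p + fst p, snd p)))) \<in> borel_measurable borel"
        by (intro borel_compose[OF Fn] continuous_intros)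
      from radon_tonelli[OF radon radon this] show ?thesis by simp
    qed
    also have "\<dots> = (\<integral>\<^sup>+s. \<integral>\<^sup>+t. ennreal (norm (F (t, s))) \<partial>M \<partial>M)"
      using nn_integral_translate[OF measurable_Pair_slice(2)[OF Fn]] by simp
    also have "\<dots> = (\<integral>\<^sup>+t. \<integral>\<^sup>+s. ennreal (norm (F (t, s))) \<partial>M \<partial>M)"
      using radon_tonelli[OF radon radon Fn] by simp
    finally show "(\<integral>\<^sup>+t. \<integral>\<^sup>+s. ennreal (norm (H (t, s))) \<partial>M \<partial>M) < \<infinity>" using finF by simp
  qed
  also have "\<dots> = (\<integral>t. \<eta> t * cnj ((a \<circledast> \<xi>) t) \<partial>M)"
  proof (rule Bochner_Integration.integral_cong[OF refl])
    fix t
    have "H (t, s) = \<eta> t * cnj (tconv_integrand \<Omega> a \<xi> t s)" for s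
      by (simp add: H_def tinvol_def tconv_integrand_def cocycle_uminus mult_ac)
    then show "(\<integral>s. H (t, s) \<partial>M) = \<eta> t * cnj ((a \<circledast> \<xi>) t)" by (simp add: tconv_def)
  qed
  finally show ?thesis .
qed

text \<open>With \<open>N\<close> the \<open>L\<^sup>1\<close> norm of \<open>a\<close> and \<open>p = \<parallel>a \<circledast> \<xi>\<parallel>\<^sup>2\<close> the left-hand side is at most
  \<open>(N\<^sup>2 - 2 * Re c) * p + (cmod c)\<^sup>2 * \<parallel>\<xi>\<parallel>\<^sup>2\<close>, because the operator of \<open>a\<^sup>* \<circledast> a\<close> is
  positive with quadratic form \<open>p\<close>.\<close>

lemma shifted_square_bound:
  assumes a: "a \<in> L1" and \<xi>: "\<xi> \<in> L2" and c: "(\<integral>s. norm (a s) \<partial>M)\<^sup>2 \<le> 2 * Re c"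
  shows "(\<integral>\<^sup>+t. (ennreal (norm ((inv_t a \<circledast> (a \<circledast> \<xi>)) t - c * \<xi> t)))\<^sup>2 \<partial>M) \<le>
    ennreal ((norm c)\<^sup>2) * (\<integral>\<^sup>+t. (mag \<xi> t)\<^sup>2 \<partial>M)"
proof -
  define \<eta> where "\<eta> = a \<circledast> \<xi>"
  define \<kappa> where "\<kappa> = inv_t a \<circledast> \<eta>"
  define N where "N = (\<integral>s. norm (a s) \<partial>M)"
  have \<eta>: "\<eta> \<in> L2" unfolding \<eta>_def by (rule L2_tconv[OF a \<xi>])
  have \<kappa>: "\<kappa> \<in> L2" unfolding \<kappa>_def by (rule L2_tconv[OF L1_tinvol[OF a] \<eta>])
  have [measurable]: "\<xi> \<in> borel_measurable borel" "\<eta> \<in> borel_measurable borel" "\<kappa> \<in> borel_measurable borel"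
    using \<xi> \<eta> \<kappa> by auto
  have aN: "(\<integral>\<^sup>+s. mag a s \<partial>M) = ennreal N"
    using a unfolding N_def by (intro nn_integral_eq_integral) (auto simp: integrable_iff_bounded)
  have N0: "0 \<le> N" by (simp add: N_def)
  have sq: "integrable M (\<lambda>t. (norm (f t))\<^sup>2)" "(\<integral>\<^sup>+t. (mag f t)\<^sup>2 \<partial>M) = ennreal (\<integral>t. (norm (f t))\<^sup>2 \<partial>M)" if "f \<in> L2" for f
  proof -
    have e: "(mag f t)\<^sup>2 = ennreal ((norm (f t))\<^sup>2)" for t by (simp add: ennreal_power)
    show i: "integrable M (\<lambda>t. (norm (f t))\<^sup>2)"
      using that unfolding integrable_iff_bounded by (auto simp: e)
    show "(\<integral>\<^sup>+t. (mag f t)\<^sup>2 \<partial>M) = ennreal (\<integral>t. (norm (f t))\<^sup>2 \<partial>M)"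
      unfolding e using i by (intro nn_integral_eq_integral) auto
  qed
  have ip: "integrable M (\<lambda>t. f t * cnj (g t))" if "f \<in> L2" "g \<in> L2" for f g
  proof -
    have "(\<lambda>z. cnj z) \<in> borel_measurable borel" by (intro borel_measurable_continuous_onI continuous_intros)
    from measurable_compose[OF _ this] have "(\<lambda>t. cnj (g t)) \<in> borel_measurable borel" using that by auto
    then show ?thesis unfolding integrable_iff_bounded
      using that L2_product_finite[OF that] by (auto simp: norm_mult ennreal_mult)
  qed
  define p where "p = (\<integral>t. (norm (\<eta> t))\<^sup>2 \<partial>M)"
  have p0: "0 \<le> p" by (simp add: p_def)
  have kx: "(\<integral>t. \<kappa> t * cnj (\<xi> t) \<partial>M) = complex_of_real p"
    unfolding \<kappa>_def adjoint_tconv[OF a \<eta> \<xi>] \<eta>_def[symmetric] p_def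
    by (simp add: complex_norm_square[symmetric] flip: integral_complex_of_real)
  have kk: "(\<integral>t. (norm (\<kappa> t))\<^sup>2 \<partial>M) \<le> N\<^sup>2 * p"
  proof -
    have "(\<integral>\<^sup>+t. (mag \<kappa> t)\<^sup>2 \<partial>M) \<le> (ennreal N)\<^sup>2 * (\<integral>\<^sup>+t. (mag \<eta> t)\<^sup>2 \<partial>M)"
      using L2_norm_tconv[of "inv_t a" \<eta>] L1_norm_tinvol[of a] a \<eta> aN
      unfolding \<kappa>_def by (auto simp: tinvol_measurable simp del: norm_tinvol)
    then have "ennreal (\<integral>t. (norm (\<kappa> t))\<^sup>2 \<partial>M) \<le> ennreal (N\<^sup>2 * p)"
      unfolding sq(2)[OF \<kappa>] sq(2)[OF \<eta>] p_def[symmetric] using N0 p0 by (simp add: ennreal_power ennreal_mult)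
    then show ?thesis using N0 p0 by (simp add: ennreal_le_iff)
  qed
  have pt: "(norm (\<kappa> t - c * \<xi> t))\<^sup>2 = (norm (\<kappa> t))\<^sup>2 - 2 * Re (cnj c * (\<kappa> t * cnj (\<xi> t))) + (norm c)\<^sup>2 * (norm (\<xi> t))\<^sup>2" for t
    by (simp add: cmod_power2 power_mult_distrib algebra_simps) (simp add: power2_eq_square algebra_simps)
  have i1: "integrable M (\<lambda>t. Re (cnj c * (\<kappa> t * cnj (\<xi> t))))"
    using ip[OF \<kappa> \<xi>] by (intro integrable_Re integrable_mult_right) auto
  have "(\<integral>t. (norm (\<kappa> t - c * \<xi> t))\<^sup>2 \<partial>M) =
      (\<integral>t. (norm (\<kappa> t))\<^sup>2 \<partial>M) - 2 * Re (cnj c * complex_of_real p) + (norm c)\<^sup>2 * (\<integral>t. (norm (\<xi> t))\<^sup>2 \<partial>M)"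
  proof -
    have "(\<integral>t. A t - 2 * B t + n * D t \<partial>M) = (\<integral>t. A t \<partial>M) - 2 * (\<integral>t. B t \<partial>M) + n * (\<integral>t. D t \<partial>M)"
      if "integrable M A" "integrable M B" "integrable M D" for A B D :: "'a \<Rightarrow> real" and n
      using that by simp
    note lin = this[OF sq(1)[OF \<kappa>] i1 sq(1)[OF \<xi>], of "(norm c)\<^sup>2"]
    have "(\<integral>t. Re (cnj c * (\<kappa> t * cnj (\<xi> t))) \<partial>M) = Re (\<integral>t. cnj c * (\<kappa> t * cnj (\<xi> t)) \<partial>M)"
      using ip[OF \<kappa> \<xi>] by (intro integral_Re integrable_mult_right) auto
    also have "\<dots> = Re (cnj c * complex_of_real p)" by (simp only: integral_mult_right_zero kx)
    finally show ?thesis unfolding pt lin by (simp only:)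
  qed
  also have "\<dots> \<le> (norm c)\<^sup>2 * (\<integral>t. (norm (\<xi> t))\<^sup>2 \<partial>M)"
    using kk mult_right_mono[OF c p0] by (simp add: N_def)
  finally have *: "(\<integral>t. (norm (\<kappa> t - c * \<xi> t))\<^sup>2 \<partial>M) \<le> (norm c)\<^sup>2 * (\<integral>t. (norm (\<xi> t))\<^sup>2 \<partial>M)" .
  have int: "integrable M (\<lambda>t. (norm (\<kappa> t - c * \<xi> t))\<^sup>2)"
    unfolding pt
    by (intro Bochner_Integration.integrable_add Bochner_Integration.integrable_diff integrable_mult_right
        i1 sq(1)[OF \<kappa>] sq(1)[OF \<xi>])
  have "(\<integral>\<^sup>+t. (ennreal (norm (\<kappa> t - c * \<xi> t)))\<^sup>2 \<partial>M) = ennreal (\<integral>t. (norm (\<kappa> t - c * \<xi> t))\<^sup>2 \<partial>M)"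
    using int by (simp add: ennreal_power nn_integral_eq_integral)
  also have "\<dots> \<le> ennreal ((norm c)\<^sup>2) * ennreal (\<integral>t. (norm (\<xi> t))\<^sup>2 \<partial>M)"
    using * by (simp add: ennreal_mult[symmetric] ennreal_leI)
  finally show ?thesis unfolding sq(2)[OF \<xi>] \<kappa>_def \<eta>_def .
qed

end

section \<open>Orlicz norms\<close>

locale orlicz_pair =
  fixes \<Phi> \<Psi> :: "real \<Rightarrow> ennreal"
  assumes pair: "complementary_young_pair \<Phi> \<Psi>" and finite: "\<forall>x\<ge>0. \<Phi> x < \<infinity>"
    and cont: "continuous_on {0..} \<Phi>"
begin

definition phi :: "real \<Rightarrow> real" where "phi x = enn2real (\<Phi> x)"

lemma Phi_eq: "0 \<le> x \<Longrightarrow> \<Phi> x = ennreal (phi x)"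
  using finite by (simp add: phi_def)

lemma phi_nonneg [simp]: "0 \<le> phi x"
  by (simp add: phi_def)

lemma zero [simp]: "\<Phi> 0 = 0" "\<Psi> 0 = 0" "phi 0 = 0"
  using pair by (auto simp: complementary_young_pair_def young_function_def phi_def)

lemma Psi_convex:
  "0 \<le> x \<Longrightarrow> 0 \<le> y \<Longrightarrow> 0 \<le> u \<Longrightarrow> 0 \<le> v \<Longrightarrow> u + v = 1 \<Longrightarrow>
    \<Psi> (u * x + v * y) \<le> ennreal u * \<Psi> x + ennreal v * \<Psi> y"
  using pair by (auto simp: complementary_young_pair_def young_function_def)

lemma Psi_scale: "0 \<le> u \<Longrightarrow> u \<le> 1 \<Longrightarrow> 0 \<le> y \<Longrightarrow> \<Psi> (u * y) \<le> ennreal u * \<Psi> y"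
  using Psi_convex[of y 0 u "1 - u"] by simp

lemma phi_convex: "convex_on {0..} phi"
proof (rule convex_onI)
  fix t x y :: real assume t: "0 < t" "t < 1" and x: "x \<in> {0..}" and y: "y \<in> {0..}"
  have "\<Phi> ((1 - t) * x + t * y) \<le> ennreal (1 - t) * \<Phi> x + ennreal t * \<Phi> y"
    using pair t x y unfolding complementary_young_pair_def young_function_def by simp
  then have "ennreal (phi ((1 - t) * x + t * y)) \<le> ennreal ((1 - t) * phi x + t * phi y)"
    using t x y by (simp add: Phi_eq ennreal_mult)
  then have "phi ((1 - t) * x + t * y) \<le> (1 - t) * phi x + t * phi y"
    using t by (subst (asm) ennreal_le_iff) auto
  then show "phi ((1 - t) *\<^sub>R x + t *\<^sub>R y) \<le> (1 - t) * phi x + t * phi y" by simp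
qed (rule convex_real_interval)

lemma Psi_eq: "0 \<le> y \<Longrightarrow> \<Psi> y = (SUP x\<in>{0..}. ennreal (x * y - phi x))"
  using pair by (auto simp: complementary_young_pair_def complementary_def Phi_eq ennreal_minus intro!: SUP_cong)

lemma Phi_measurable: "f \<in> borel_measurable M \<Longrightarrow> (\<lambda>s. \<Phi> (norm (f s))) \<in> borel_measurable M"
proof -
  assume f: "f \<in> borel_measurable M"
  have "continuous_on UNIV (\<lambda>x::real. \<Phi> (max 0 x))"
    by (rule continuous_on_compose2[OF cont]) (auto intro!: continuous_intros)
  then have "(\<lambda>x. \<Phi> (max 0 x)) \<in> borel_measurable borel" by (rule borel_measurable_continuous_onI)
  moreover have "(\<lambda>s. norm (f s)) \<in> borel_measurable M" using f by measurable
  ultimately have "(\<lambda>s. \<Phi> (max 0 (norm (f s)))) \<in> borel_measurable M" by (rule measurable_compose[rotated])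
  then show ?thesis by simp
qed

text \<open>\<open>\<Psi>\<close> is a supremum of continuous functions.\<close>

lemma Psi_measurable: "f \<in> borel_measurable M \<Longrightarrow> (\<lambda>s. \<Psi> (norm (f s))) \<in> borel_measurable M"
proof -
  assume f: "f \<in> borel_measurable M"
  let ?P = "\<lambda>y. SUP x\<in>{0..}. ennreal (x * y - phi x)"
  have "?P \<in> borel_measurable borel"
  proof (rule borel_measurableI_greater)
    fix a :: ennreal
    have "open {y. a < ennreal (x * y - phi x)}" for x
      by (intro open_Collect_less continuous_intros continuous_on_ennreal)
    then have "open (\<Union>x\<in>{0..}. {y. a < ennreal (x * y - phi x)})" by blast
    moreover have "{y \<in> space borel. a < ?P y} = (\<Union>x\<in>{0..}. {y. a < ennreal (x * y - phi x)})"
      by (auto simp: less_SUP_iff)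
    ultimately show "{y \<in> space borel. a < ?P y} \<in> sets borel" by simp
  qed
  moreover have "(\<lambda>s. norm (f s)) \<in> borel_measurable M" using f by measurable
  ultimately have "(\<lambda>s. ?P (norm (f s))) \<in> borel_measurable M" by (rule measurable_compose[rotated])
  then show ?thesis by (simp add: Psi_eq)
qed

lemma Young: "0 \<le> x \<Longrightarrow> 0 \<le> y \<Longrightarrow> ennreal (x * y) \<le> \<Phi> x + \<Psi> y"
proof -
  assume "0 \<le> x" "0 \<le> y"
  then have "ennreal (x * y - phi x) \<le> \<Psi> y" by (auto simp: Psi_eq intro!: SUP_upper)
  then have "ennreal (phi x) + ennreal (x * y - phi x) \<le> \<Phi> x + \<Psi> y"
    using \<open>0 \<le> x\<close> by (simp add: Phi_eq add_left_mono)
  moreover have "ennreal (x * y) \<le> ennreal (phi x) + ennreal (x * y - phi x)"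
    by (cases "x * y \<ge> phi x") (auto simp: ennreal_plus[symmetric] ennreal_neg ennreal_leI simp del: ennreal_plus)
  ultimately show ?thesis by (rule order_trans[rotated])
qed

text \<open>The witness is a subgradient of \<open>phi\<close> at \<open>x\<close>.\<close>

lemma Young_equality:
  assumes x: "0 \<le> x"
  shows "\<exists>y\<ge>0. (x = 0 \<longrightarrow> y = 0) \<and> \<Phi> x + \<Psi> y \<le> ennreal (x * y)"
proof (cases "x = 0")
  case False
  then have x: "x > 0" using x by simp
  define y where "y = Inf ((\<lambda>t. (phi x - phi t) / (x - t)) ` ({x<..} \<inter> {0..}))"
  have sub: "phi x + y * (t - x) \<le> phi t" if "t \<ge> 0" for t
    using convex_le_Inf_differential[OF phi_convex, of x t] x that by (simp add: y_def)
  have "phi x \<le> y * x" using sub[of 0] by simp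
  then have "0 \<le> y * x" using phi_nonneg[of x] by linarith
  then have y: "0 \<le> y" using x by (simp add: zero_le_mult_iff)
  have "\<Psi> y \<le> ennreal (x * y - phi x)"
    unfolding Psi_eq[OF y]
  proof (rule SUP_least)
    fix t :: real assume "t \<in> {0..}"
    then show "ennreal (t * y - phi t) \<le> ennreal (x * y - phi x)"
      using sub[of t] by (intro ennreal_leI) (simp add: algebra_simps)
  qed
  then have "\<Phi> x + \<Psi> y \<le> ennreal (phi x) + ennreal (x * y - phi x)"
    using x by (simp add: Phi_eq add_left_mono)
  also have "\<dots> = ennreal (x * y)" using \<open>phi x \<le> y * x\<close> by (simp add: ennreal_plus[symmetric] mult.commute del: ennreal_plus)
  finally show ?thesis using y False by blast
qed auto

end

text \<open>The Orlicz norm as a functional of nonnegative functions, which applies to weighted functions and to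
  convolutions of absolute values alike.\<close>

definition gauge_norm :: "'g measure \<Rightarrow> (real \<Rightarrow> ennreal) \<Rightarrow> ('g \<Rightarrow> ennreal) \<Rightarrow> ennreal" where
  "gauge_norm M \<Psi> F = (SUP v\<in>{v \<in> borel_measurable M. (\<integral>\<^sup>+ s. \<Psi> (norm (v s :: complex)) \<partial>M) \<le> 1}.
     \<integral>\<^sup>+ s. F s * ennreal (norm (v s)) \<partial>M)"

lemma orlicz_norm_eq_gauge: "orlicz_norm M \<Psi> f = gauge_norm M \<Psi> (\<lambda>s. ennreal (norm (f s)))"
  by (simp add: orlicz_norm_def gauge_norm_def norm_mult ennreal_mult)

lemma gauge_norm_upper:
  fixes v :: "'g \<Rightarrow> complex"
  assumes "v \<in> borel_measurable M" "(\<integral>\<^sup>+ s. \<Psi> (norm (v s)) \<partial>M) \<le> 1"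
  shows "(\<integral>\<^sup>+ s. F s * ennreal (norm (v s)) \<partial>M) \<le> gauge_norm M \<Psi> F"
  unfolding gauge_norm_def using assms by (intro SUP_upper2[of v]) auto

lemma gauge_norm_least:
  assumes "\<And>v :: 'g \<Rightarrow> complex. v \<in> borel_measurable M \<Longrightarrow> (\<integral>\<^sup>+ s. \<Psi> (norm (v s)) \<partial>M) \<le> 1 \<Longrightarrow>
    (\<integral>\<^sup>+ s. F s * ennreal (norm (v s)) \<partial>M) \<le> B"
  shows "gauge_norm M \<Psi> F \<le> B"
  unfolding gauge_norm_def using assms by (intro SUP_least) auto

lemma gauge_norm_mono_AE:
  assumes "AE s in M. F s \<le> G s"
  shows "gauge_norm M \<Psi> F \<le> gauge_norm M \<Psi> G"
proof (rule gauge_norm_least)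
  fix v :: "'a \<Rightarrow> complex" assume v: "v \<in> borel_measurable M" "(\<integral>\<^sup>+ s. \<Psi> (norm (v s)) \<partial>M) \<le> 1"
  have "(\<integral>\<^sup>+ s. F s * ennreal (norm (v s)) \<partial>M) \<le> (\<integral>\<^sup>+ s. G s * ennreal (norm (v s)) \<partial>M)"
  proof (rule nn_integral_mono_AE)
    show "AE s in M. F s * ennreal (norm (v s)) \<le> G s * ennreal (norm (v s))"
      using assms by eventually_elim (simp add: mult_right_mono)
  qed
  also have "\<dots> \<le> gauge_norm M \<Psi> G" by (rule gauge_norm_upper[OF v])
  finally show "(\<integral>\<^sup>+ s. F s * ennreal (norm (v s)) \<partial>M) \<le> gauge_norm M \<Psi> G" .
qed

lemma gauge_norm_cong_AE:
  "AE s in M. F s = G s \<Longrightarrow> gauge_norm M \<Psi> F = gauge_norm M \<Psi> G"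
  by (intro antisym gauge_norm_mono_AE) auto

lemma gauge_norm_add:
  assumes "F \<in> borel_measurable M" "G \<in> borel_measurable M"
  shows "gauge_norm M \<Psi> (\<lambda>s. F s + G s) \<le> gauge_norm M \<Psi> F + gauge_norm M \<Psi> G"
proof (rule gauge_norm_least)
  fix v :: "'a \<Rightarrow> complex" assume v: "v \<in> borel_measurable M" "(\<integral>\<^sup>+ s. \<Psi> (norm (v s)) \<partial>M) \<le> 1"
  have "(\<integral>\<^sup>+ s. (F s + G s) * ennreal (norm (v s)) \<partial>M) =
    (\<integral>\<^sup>+ s. F s * ennreal (norm (v s)) \<partial>M) + (\<integral>\<^sup>+ s. G s * ennreal (norm (v s)) \<partial>M)"
    using assms v(1) by (simp add: distrib_right nn_integral_add)
  also have "\<dots> \<le> gauge_norm M \<Psi> F + gauge_norm M \<Psi> G"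
    by (intro add_mono gauge_norm_upper v)
  finally show "(\<integral>\<^sup>+ s. (F s + G s) * ennreal (norm (v s)) \<partial>M) \<le> gauge_norm M \<Psi> F + gauge_norm M \<Psi> G" .
qed

lemma gauge_norm_cmult:
  assumes "F \<in> borel_measurable M"
  shows "gauge_norm M \<Psi> (\<lambda>s. c * F s) = c * gauge_norm M \<Psi> F"
proof -
  have "(\<integral>\<^sup>+ s. c * F s * ennreal (norm (v s)) \<partial>M) = c * (\<integral>\<^sup>+ s. F s * ennreal (norm (v s)) \<partial>M)"
    if "v \<in> borel_measurable M" for v :: "'a \<Rightarrow> complex"
    using assms that by (simp add: nn_integral_cmult mult.assoc)
  then show ?thesis
    unfolding gauge_norm_def by (subst SUP_mult_left_ennreal) (auto intro!: SUP_cong)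
qed

lemma gauge_norm_liminf:
  fixes F :: "nat \<Rightarrow> 'a \<Rightarrow> ennreal"
  assumes "\<And>n. F n \<in> borel_measurable M" and "AE s in M. G s \<le> liminf (\<lambda>n. F n s)"
  shows "gauge_norm M \<Psi> G \<le> liminf (\<lambda>n. gauge_norm M \<Psi> (F n))"
proof (rule gauge_norm_least)
  fix v :: "'a \<Rightarrow> complex" assume v: "v \<in> borel_measurable M" "(\<integral>\<^sup>+ s. \<Psi> (norm (v s)) \<partial>M) \<le> 1"
  have "(\<integral>\<^sup>+ s. G s * ennreal (norm (v s)) \<partial>M) \<le> (\<integral>\<^sup>+ s. liminf (\<lambda>n. F n s * ennreal (norm (v s))) \<partial>M)"
  proof (rule nn_integral_mono_AE)
    show "AE s in M. G s * ennreal (norm (v s)) \<le> liminf (\<lambda>n. F n s * ennreal (norm (v s)))"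
      using assms(2)
    proof eventually_elim
      case (elim s)
      have "liminf (\<lambda>n. ennreal (norm (v s)) * F n s) = ennreal (norm (v s)) * liminf (\<lambda>n. F n s)"
        by (rule Liminf_compose_continuous_mono[where f="\<lambda>x. ennreal (norm (v s)) * x"])
          (auto simp: mono_def mult_left_mono intro!: ennreal_continuous_on_cmult)
      then have "liminf (\<lambda>n. F n s) * ennreal (norm (v s)) = liminf (\<lambda>n. F n s * ennreal (norm (v s)))"
        by (simp add: mult.commute)
      then show ?case using elim by (metis mult_right_mono zero_le)
    qed
  qed
  also have "\<dots> \<le> liminf (\<lambda>n. \<integral>\<^sup>+ s. F n s * ennreal (norm (v s)) \<partial>M)"
    using assms(1) v(1) by (intro nn_integral_liminf) auto
  also have "\<dots> \<le> liminf (\<lambda>n. gauge_norm M \<Psi> (F n))"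
    by (intro Liminf_mono always_eventually allI gauge_norm_upper v)
  finally show "(\<integral>\<^sup>+ s. G s * ennreal (norm (v s)) \<partial>M) \<le> liminf (\<lambda>n. gauge_norm M \<Psi> (F n))" .
qed

context orlicz_pair
begin

lemma orlicz_norm_finite:
  assumes "f \<in> orlicz_space M \<Phi>"
  shows "orlicz_norm M \<Psi> f < \<infinity>"
proof -
  obtain \<alpha> where f: "f \<in> borel_measurable M" and \<alpha>: "\<alpha> > 0" "(\<integral>\<^sup>+ s. \<Phi> (\<alpha> * norm (f s)) \<partial>M) < \<infinity>"
    using assms by (auto simp: orlicz_space_def)
  let ?B = "(\<integral>\<^sup>+ s. \<Phi> (\<alpha> * norm (f s)) \<partial>M) + 1"
  have "gauge_norm M \<Psi> (\<lambda>s. ennreal \<alpha> * ennreal (norm (f s))) \<le> ?B"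
  proof (rule gauge_norm_least)
    fix v :: "'a \<Rightarrow> complex" assume v: "v \<in> borel_measurable M" "(\<integral>\<^sup>+ s. \<Psi> (norm (v s)) \<partial>M) \<le> 1"
    have m: "(\<lambda>s. \<Phi> (\<alpha> * norm (f s))) \<in> borel_measurable M"
      using Phi_measurable[of "\<lambda>s. \<alpha> *\<^sub>R f s" M] f \<alpha> by simp
    have "(\<integral>\<^sup>+ s. ennreal \<alpha> * ennreal (norm (f s)) * ennreal (norm (v s)) \<partial>M) \<le>
        (\<integral>\<^sup>+ s. \<Phi> (\<alpha> * norm (f s)) + \<Psi> (norm (v s)) \<partial>M)"
      using \<alpha> Young[of "\<alpha> * norm (f _)" "norm (v _)"] by (intro nn_integral_mono) (simp add: ennreal_mult)
    also have "\<dots> = (\<integral>\<^sup>+ s. \<Phi> (\<alpha> * norm (f s)) \<partial>M) + (\<integral>\<^sup>+ s. \<Psi> (norm (v s)) \<partial>M)"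
      using m Psi_measurable[OF v(1)] by (rule nn_integral_add)
    also have "\<dots> \<le> ?B" using v(2) by (rule add_left_mono)
    finally show "(\<integral>\<^sup>+ s. ennreal \<alpha> * ennreal (norm (f s)) * ennreal (norm (v s)) \<partial>M) \<le> ?B" .
  qed
  moreover have "gauge_norm M \<Psi> (\<lambda>s. ennreal \<alpha> * ennreal (norm (f s))) = ennreal \<alpha> * orlicz_norm M \<Psi> f"
    using f by (subst gauge_norm_cmult) (auto simp: orlicz_norm_eq_gauge)
  moreover have "?B < \<infinity>" using \<alpha> by (simp add: less_top)
  ultimately have "ennreal \<alpha> * orlicz_norm M \<Psi> f < \<infinity>" by (metis le_less_trans)
  then show ?thesis using \<alpha> by (auto simp: ennreal_mult_less_top)
qed

text \<open>The functions of norm at most \<open>1\<close> are integrated by pairing a simple function \<open>r\<close> below \<open>\<bar>f\<bar>\<close>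
  with a function \<open>v\<close> that realises equality in Young's inequality.\<close>

lemma simple_modular_le_1:
  fixes f :: "'a \<Rightarrow> complex" and r :: "'a \<Rightarrow> real"
  assumes f: "f \<in> borel_measurable M" and nf: "orlicz_norm M \<Psi> f \<le> 1"
    and r: "simple_function M r" "\<And>s. 0 \<le> r s" "\<And>s. r s \<le> norm (f s)"
    and V: "V \<in> sets M" "emeasure M V < \<infinity>" "\<And>s. s \<in> space M \<Longrightarrow> s \<notin> V \<Longrightarrow> r s = 0"
  shows "(\<integral>\<^sup>+ s. \<Phi> (r s) \<partial>M) \<le> 1"
proof -
  obtain y where y: "\<And>x. 0 \<le> x \<Longrightarrow> 0 \<le> y x" "\<And>x. x = 0 \<Longrightarrow> y x = 0"
      "\<And>x. 0 \<le> x \<Longrightarrow> \<Phi> x + \<Psi> (y x) \<le> ennreal (x * y x)"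
    using Young_equality by (metis order_refl)
  define v where "v s = y (r s)" for s
  have vs: "simple_function M v" unfolding v_def using simple_function_compose1[OF r(1)] .
  have vm: "(\<lambda>s. complex_of_real (u * v s)) \<in> borel_measurable M" for u
    using borel_measurable_simple_function[OF vs] by measurable
  have rm: "r \<in> borel_measurable M" using borel_measurable_simple_function[OF r(1)] .
  have v0: "0 \<le> v s" for s unfolding v_def using y(1) r(2) by simp
  have Pv: "(\<lambda>s. \<Psi> (v s)) \<in> borel_measurable M"
    using Psi_measurable[OF vm[of 1]] v0 by simp
  have Pr: "(\<lambda>s. \<Phi> (r s)) \<in> borel_measurable M"
    using Phi_measurable[OF rm] r(2) by simp
  define m where "m = (\<integral>\<^sup>+ s. \<Psi> (v s) \<partial>M)"
  have sum: "(\<integral>\<^sup>+ s. \<Phi> (r s) \<partial>M) + m \<le> (\<integral>\<^sup>+ s. ennreal (r s * v s) \<partial>M)"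
    unfolding m_def nn_integral_add[OF Pr Pv, symmetric]
    by (intro nn_integral_mono) (simp add: v_def y(3) r(2))
  have pairing: "ennreal u * (\<integral>\<^sup>+ s. ennreal (r s * v s) \<partial>M) \<le> 1"
    if u: "0 \<le> u" "(\<integral>\<^sup>+ s. \<Psi> (u * v s) \<partial>M) \<le> 1" for u
  proof -
    have "ennreal u * (\<integral>\<^sup>+ s. ennreal (r s * v s) \<partial>M) = (\<integral>\<^sup>+ s. ennreal (r s) * ennreal (u * v s) \<partial>M)"
      using u v0 r(2) rm borel_measurable_simple_function[OF vs]
      by (subst nn_integral_cmult[symmetric]) (auto intro!: nn_integral_cong simp: ennreal_mult[symmetric] mult_ac)
    also have "\<dots> \<le> (\<integral>\<^sup>+ s. ennreal (norm (f s)) * ennreal (norm (complex_of_real (u * v s))) \<partial>M)"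
      using u v0 r(3) by (intro nn_integral_mono mult_mono) (auto intro!: ennreal_leI simp: norm_mult)
    also have "\<dots> \<le> gauge_norm M \<Psi> (\<lambda>s. ennreal (norm (f s)))"
      using u v0 by (intro gauge_norm_upper vm) (simp add: norm_mult)
    finally show ?thesis using nf by (simp add: orlicz_norm_eq_gauge)
  qed
  have mfin: "m < \<infinity>"
  proof -
    have fr: "finite (r ` space M)" using r(1) by (simp add: simple_function_def)
    define K where "K = (\<Sum>x\<in>r ` space M. ennreal (x * y x))"
    have "\<Psi> (v s) \<le> K * indicator V s" if s: "s \<in> space M" for s
    proof (cases "s \<in> V")
      case True
      have "\<Psi> (v s) \<le> \<Phi> (r s) + \<Psi> (v s)" by simp
      also have "\<dots> \<le> ennreal (r s * y (r s))" unfolding v_def by (rule y(3)[OF r(2)])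
      also have "\<dots> \<le> K" unfolding K_def using s by (intro member_le_sum fr) auto
      finally show ?thesis using True by simp
    next
      case False
      then show ?thesis using V(3)[OF s] y(2) by (simp add: v_def)
    qed
    then have "m \<le> (\<integral>\<^sup>+ s. K * indicator V s \<partial>M)" unfolding m_def by (intro nn_integral_mono)
    also have "\<dots> = K * emeasure M V" by (intro nn_integral_cmult_indicator V)
    also have "\<dots> < \<infinity>"
    proof -
      have "K < \<infinity>" unfolding K_def using fr by (simp add: less_top[symmetric])
      then show ?thesis using V(2) by (simp add: ennreal_mult_less_top)
    qed
    finally show ?thesis .
  qed
  show ?thesis
  proof (cases "m \<le> 1")
    case True
    then have "(\<integral>\<^sup>+ s. ennreal (r s * v s) \<partial>M) \<le> 1" using pairing[of 1] by (simp add: m_def)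
    then have "(\<integral>\<^sup>+ s. \<Phi> (r s) \<partial>M) + m \<le> 1" using sum by simp
    then show ?thesis by (meson add_increasing2 le_add_same_cancel1 order.trans zero_le le_iff_add)
  next
    case False
    \<comment> \<open>since \<open>\<Psi> (u * v) \<le> u * \<Psi> v\<close>, the function \<open>u * v\<close> is admissible, and pairing with it forces the integral of \<open>\<Phi> r\<close> to vanish\<close>
    define u where "u = 1 / enn2real m"
    have em: "m = ennreal (enn2real m)" using mfin by simp
    have m1: "1 < enn2real m" using False em by (metis ennreal_leI ennreal_1 not_le)
    then have u: "0 \<le> u" "u \<le> 1" by (auto simp: u_def)
    have um: "ennreal u * m = 1"
      using m1 by (subst em) (simp add: u_def ennreal_mult[symmetric])
    have "(\<integral>\<^sup>+ s. \<Psi> (u * v s) \<partial>M) \<le> (\<integral>\<^sup>+ s. ennreal u * \<Psi> (v s) \<partial>M)"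
      using u v0 by (intro nn_integral_mono Psi_scale)
    also have "\<dots> = 1" using Pv um by (simp add: nn_integral_cmult m_def)
    finally have "ennreal u * (\<integral>\<^sup>+ s. ennreal (r s * v s) \<partial>M) \<le> 1" using pairing u by blast
    moreover have "ennreal u * ((\<integral>\<^sup>+ s. \<Phi> (r s) \<partial>M) + m) \<le> ennreal u * (\<integral>\<^sup>+ s. ennreal (r s * v s) \<partial>M)"
      using sum by (rule mult_left_mono) simp
    ultimately have "ennreal u * ((\<integral>\<^sup>+ s. \<Phi> (r s) \<partial>M) + m) \<le> 1" by (rule order_trans[rotated])
    then have "ennreal u * (\<integral>\<^sup>+ s. \<Phi> (r s) \<partial>M) + 1 \<le> 1"
      by (simp only: distrib_left um)
    then have "ennreal u * (\<integral>\<^sup>+ s. \<Phi> (r s) \<partial>M) = 0" by simp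
    then show ?thesis using m1 by (simp add: u_def)
  qed
qed

lemma modular_le_1:
  fixes f :: "'a::t2_space \<Rightarrow> complex"
  assumes M: "radon_measure M" and f: "f \<in> borel_measurable M" and nf: "orlicz_norm M \<Psi> f \<le> 1"
  shows "(\<integral>\<^sup>+ s. \<Phi> (norm (f s)) \<partial>M) \<le> 1"
proof -
  interpret radon_measure M by fact
  obtain V :: "nat \<Rightarrow> 'a set" where V: "incseq V" "(\<Union>n. V n) = UNIV" "\<And>n. open (V n)" "\<And>n. emeasure M (V n) < \<infinity>"
    using exhaustion by auto
  have "(\<lambda>s. ennreal (norm (f s))) \<in> borel_measurable M" using f by measurable
  then obtain g where g: "\<And>n. simple_function M (g n)" "incseq g" "\<And>n s. g n s < \<infinity>" "\<And>s. (SUP n. g n s) = ennreal (norm (f s))"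
    by (rule borel_measurable_implies_simple_function_sequence') auto
  define r where "r n s = enn2real (g n s) * indicator (V n) s" for n s
  have r1: "simple_function M (r n)" for n
    unfolding r_def using V(3)
    by (intro simple_function_mult simple_function_compose1[OF g(1)] simple_function_indicator open_sets)
  have r0: "0 \<le> r n s" for n s by (simp add: r_def)
  have rle: "r n s \<le> norm (f s)" for n s
  proof -
    have "g n s \<le> ennreal (norm (f s))" unfolding g(4)[symmetric] by (rule SUP_upper) simp
    then have "enn2real (g n s) \<le> norm (f s)" by (simp add: enn2real_leI)
    then show ?thesis by (simp add: r_def indicator_def)
  qed
  have lim: "(\<lambda>n. r n s) \<longlonglongrightarrow> norm (f s)" for s
  proof -
    have "incseq (\<lambda>n. g n s)" using g(2) by (simp add: incseq_def le_fun_def)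
    from LIMSEQ_SUP[OF this] have "(\<lambda>n. g n s) \<longlonglongrightarrow> ennreal (norm (f s))" by (simp add: g(4))
    then have "(\<lambda>n. enn2real (g n s)) \<longlonglongrightarrow> norm (f s)" by (intro tendsto_enn2real) auto
    moreover obtain N where "s \<in> V N" using V(2) by blast
    then have "\<forall>n\<ge>N. r n s = enn2real (g n s)" using V(1) by (auto simp: r_def incseq_def indicator_def)
    then have "eventually (\<lambda>n. enn2real (g n s) = r n s) sequentially"
      by (intro eventually_sequentiallyI[of N]) simp
    ultimately show ?thesis by (rule Lim_transform_eventually)
  qed
  have "(\<integral>\<^sup>+ s. \<Phi> (norm (f s)) \<partial>M) = (\<integral>\<^sup>+ s. liminf (\<lambda>n. \<Phi> (r n s)) \<partial>M)"
  proof (rule nn_integral_cong)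
    fix s
    have "(\<lambda>n. \<Phi> (r n s)) \<longlonglongrightarrow> \<Phi> (norm (f s))"
      by (rule continuous_on_tendsto_compose[OF cont lim]) (auto simp: r0)
    then show "\<Phi> (norm (f s)) = liminf (\<lambda>n. \<Phi> (r n s))" by (simp add: lim_imp_Liminf)
  qed
  also have "\<dots> \<le> liminf (\<lambda>n. \<integral>\<^sup>+ s. \<Phi> (r n s) \<partial>M)"
    using Phi_measurable[OF borel_measurable_simple_function[OF r1]] r0 by (intro nn_integral_liminf) simp
  also have "\<dots> \<le> liminf (\<lambda>n. 1)"
  proof (intro Liminf_mono always_eventually allI)
    fix n
    show "(\<integral>\<^sup>+ s. \<Phi> (r n s) \<partial>M) \<le> 1"
      by (rule simple_modular_le_1[OF f nf r1 r0 rle open_sets[OF V(3)[of n]] V(4)[of n]]) (simp add: r_def)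
  qed
  finally show ?thesis by (simp add: Liminf_const)
qed

text \<open>The space is defined through \<open>\<Phi>\<close> and the norm through \<open>\<Psi>\<close>. This equivalence makes the norm alone decide about
  membership, for convolutions and for limits of Cauchy sequences.\<close>

lemma orlicz_space_iff:
  fixes f :: "'a::t2_space \<Rightarrow> complex"
  assumes M: "radon_measure M"
  shows "f \<in> orlicz_space M \<Phi> \<longleftrightarrow> f \<in> borel_measurable M \<and> orlicz_norm M \<Psi> f < \<infinity>"
proof safe
  assume f: "f \<in> borel_measurable M" and fin: "orlicz_norm M \<Psi> f < \<infinity>"
  define c where "c = 1 / (enn2real (orlicz_norm M \<Psi> f) + 1)"
  have c: "c > 0" by (simp add: c_def add_nonneg_pos)
  have "orlicz_norm M \<Psi> (\<lambda>s. complex_of_real c * f s) = ennreal c * orlicz_norm M \<Psi> f"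
    unfolding orlicz_norm_eq_gauge using c f by (subst gauge_norm_cmult[symmetric]) (auto simp: norm_mult ennreal_mult)
  also have "\<dots> = ennreal (c * enn2real (orlicz_norm M \<Psi> f))"
    using fin c by (simp add: ennreal_mult)
  also have "\<dots> \<le> 1" unfolding c_def by (subst ennreal_le_1) (simp add: divide_le_eq_1 add_nonneg_pos)
  finally have "(\<integral>\<^sup>+ s. \<Phi> (norm (complex_of_real c * f s)) \<partial>M) \<le> 1"
    using f by (intro modular_le_1[OF M]) auto
  then have "(\<integral>\<^sup>+ s. \<Phi> (c * norm (f s)) \<partial>M) < \<infinity>"
    using c by (simp add: norm_mult le_less_trans[OF _ ennreal_one_less_top])
  then show "f \<in> orlicz_space M \<Phi>" using c f by (auto simp: orlicz_space_def)
next
  assume "f \<in> orlicz_space M \<Phi>"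
  then show "f \<in> borel_measurable M" "orlicz_norm M \<Psi> f < \<infinity>"
    by (simp add: orlicz_space_def, rule orlicz_norm_finite)
qed

end

section \<open>The weighted Orlicz space as a convolution algebra\<close>

locale orlicz_group = twisted_group M U d \<Omega> + orlicz_pair \<Phi> \<Psi>
  for M :: "'a::{topological_group_add, t2_space} measure" and U d \<Omega> and \<Phi> \<Psi> +
  fixes l \<beta> :: real
  assumes l: "l \<ge> 1"
    and Psi_lim: "\<exists>L<\<infinity>. ((\<lambda>x. \<Psi> x / ennreal (x powr l)) \<longlongrightarrow> L) (at_right 0)"
    and beta: "\<beta> > real d / l"
begin

lemma beta_pos: "0 < \<beta>"
proof -
  have "0 \<le> real d / l" using l by simp
  then show ?thesis using beta by linarith
qed

abbreviation weight :: "'a \<Rightarrow> real" where "weight \<equiv> poly_weight U \<beta>"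

definition wnorm :: "('a \<Rightarrow> complex) \<Rightarrow> ennreal" where
  "wnorm f = gauge_norm M \<Psi> (\<lambda>s. mag f s * ennreal (weight s))"

abbreviation A :: "('a \<Rightarrow> complex) set" where
  "A \<equiv> {f \<in> borel_measurable borel. wnorm f < \<infinity>}"

lemma worlicz_norm_eq: "worlicz_norm M \<Psi> weight f = wnorm f"
  by (simp add: worlicz_norm_def orlicz_norm_eq_gauge wnorm_def norm_mult ennreal_mult less_imp_le)

lemma worlicz_space_eq: "worlicz_space M \<Phi> weight = A"
  unfolding worlicz_space_def orlicz_space_iff[OF radon] worlicz_norm_eq[symmetric] worlicz_norm_def
  by auto

lemma weighted_measurable: "f \<in> borel_measurable borel \<Longrightarrow> (\<lambda>s. mag f s * ennreal (weight s)) \<in> borel_measurable borel"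
  by (intro borel_measurable_times_ennreal mag_measurable measurable_compose[OF poly_weight_measurable measurable_ennreal])

lemma wnorm_cong_AE: "AE s in M. f s = g s \<Longrightarrow> wnorm f = wnorm g"
  unfolding wnorm_def by (intro gauge_norm_cong_AE) (auto elim: eventually_mono)

lemma wnorm_add:
  assumes "f \<in> borel_measurable borel" "g \<in> borel_measurable borel"
  shows "wnorm (\<lambda>s. f s + g s) \<le> wnorm f + wnorm g"
proof -
  have "wnorm (\<lambda>s. f s + g s) \<le> gauge_norm M \<Psi> (\<lambda>s. mag f s * ennreal (weight s) + mag g s * ennreal (weight s))"
    unfolding wnorm_def
    by (intro gauge_norm_mono_AE AE_I2)
      (auto simp: distrib_right[symmetric] ennreal_plus[symmetric] simp del: ennreal_plus intro!: mult_right_mono ennreal_leI norm_triangle_ineq)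
  also have "\<dots> \<le> wnorm f + wnorm g"
    unfolding wnorm_def using assms by (intro gauge_norm_add) auto
  finally show ?thesis .
qed

lemma wnorm_scale:
  assumes "f \<in> borel_measurable borel"
  shows "wnorm (\<lambda>s. c * f s) = ennreal (norm c) * wnorm f"
  unfolding wnorm_def using assms
  by (subst gauge_norm_cmult[symmetric]) (auto simp: norm_mult ennreal_mult mult.assoc)

lemma wnorm_mono:
  assumes "\<And>s. norm (f s) \<le> norm (g s)"
  shows "wnorm f \<le> wnorm g"
  unfolding wnorm_def using assms by (intro gauge_norm_mono_AE AE_I2 mult_right_mono ennreal_leI) auto

lemma wnorm_tinvol:
  assumes f: "f \<in> borel_measurable borel"
  shows "wnorm (inv_t f) = wnorm f"
proof -
  have le: "wnorm (inv_t f) \<le> wnorm f" if f: "f \<in> borel_measurable borel" for f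
    unfolding wnorm_def
  proof (rule gauge_norm_least)
    fix v :: "'a \<Rightarrow> complex" assume v: "v \<in> borel_measurable M" "(\<integral>\<^sup>+ s. \<Psi> (norm (v s)) \<partial>M) \<le> 1"
    have vm: "v \<in> borel_measurable borel" using v by simp
    have fv: "(\<lambda>s. mag f s * ennreal (weight s) * mag v (- s)) \<in> borel_measurable borel"
      by (intro borel_measurable_times_ennreal weighted_measurable[OF f] borel_compose[OF mag_measurable[OF vm]] continuous_intros)
    have "(\<integral>\<^sup>+ s. mag (inv_t f) s * ennreal (weight s) * mag v s \<partial>M) = (\<integral>\<^sup>+ s. mag f s * ennreal (weight s) * mag v (- s) \<partial>M)"
      using nn_integral_uminus[OF fv] by simp
    also have "\<dots> \<le> gauge_norm M \<Psi> (\<lambda>s. mag f s * ennreal (weight s))"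
    proof (rule gauge_norm_upper)
      show "(\<lambda>s. v (- s)) \<in> borel_measurable M" by (simp add: borel_compose[OF vm] continuous_intros)
      have "(\<lambda>s. \<Psi> (norm (v s))) \<in> borel_measurable borel" by (rule Psi_measurable[OF vm])
      from nn_integral_uminus[OF this] show "(\<integral>\<^sup>+ s. \<Psi> (norm (v (- s))) \<partial>M) \<le> 1" using v(2) by simp
    qed
    finally show "(\<integral>\<^sup>+ s. mag (inv_t f) s * ennreal (weight s) * mag v s \<partial>M) \<le> gauge_norm M \<Psi> (\<lambda>s. mag f s * ennreal (weight s))" .
  qed
  show ?thesis
    using le[OF f] le[OF tinvol_measurable[OF f]] by simp
qed

text \<open>The unit ball of the dual Young class is invariant under both translations, so
  the Orlicz norm sees convolution by an integrable function, from either side, as an average of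
  isometries.\<close>

lemma gauge_norm_nconv:
  assumes F: "F \<in> borel_measurable borel" and G: "G \<in> borel_measurable borel"
  shows "gauge_norm M \<Psi> (nconv F G) \<le> (\<integral>\<^sup>+s. F s \<partial>M) * gauge_norm M \<Psi> G"
    and "gauge_norm M \<Psi> (nconv F G) \<le> gauge_norm M \<Psi> F * (\<integral>\<^sup>+s. G s \<partial>M)"
proof -
  have 1: "(\<integral>\<^sup>+t. G t * mag v (s + t) \<partial>M) \<le> gauge_norm M \<Psi> G"
    if v: "v \<in> borel_measurable M" "(\<integral>\<^sup>+ s. \<Psi> (norm (v s)) \<partial>M) \<le> 1" for v s
  proof (rule gauge_norm_upper)
    have vm: "v \<in> borel_measurable borel" using v by simp
    show "(\<lambda>t. v (s + t)) \<in> borel_measurable M" by (simp add: borel_compose[OF vm] continuous_intros)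
    show "(\<integral>\<^sup>+ t. \<Psi> (norm (v (s + t))) \<partial>M) \<le> 1"
      using nn_integral_translate[OF Psi_measurable[OF vm]] v(2) by simp
  qed
  have 2: "(\<integral>\<^sup>+s. F s * mag v (s + t) \<partial>M) \<le> gauge_norm M \<Psi> F"
    if v: "v \<in> borel_measurable M" "(\<integral>\<^sup>+ s. \<Psi> (norm (v s)) \<partial>M) \<le> 1" for v t
  proof (rule gauge_norm_upper)
    have vm: "v \<in> borel_measurable borel" using v by simp
    show "(\<lambda>s. v (s + t)) \<in> borel_measurable M" by (simp add: borel_compose[OF vm] continuous_intros)
    show "(\<integral>\<^sup>+ s. \<Psi> (norm (v (s + t))) \<partial>M) \<le> 1"
      using nn_integral_right_translate[OF Psi_measurable[OF vm]] v(2) by simp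
  qed
  show "gauge_norm M \<Psi> (nconv F G) \<le> (\<integral>\<^sup>+s. F s \<partial>M) * gauge_norm M \<Psi> G"
  proof (rule gauge_norm_least)
    fix v :: "'a \<Rightarrow> complex" assume v: "v \<in> borel_measurable M" "(\<integral>\<^sup>+ s. \<Psi> (norm (v s)) \<partial>M) \<le> 1"
    have vm: "v \<in> borel_measurable borel" using v by simp
    have "(\<integral>\<^sup>+t. nconv F G t * mag v t \<partial>M) \<le> (\<integral>\<^sup>+s. F s * gauge_norm M \<Psi> G \<partial>M)"
      unfolding nconv_pairing(1)[OF F G mag_measurable[OF vm]]
      by (intro nn_integral_mono mult_left_mono 1 v) simp
    then show "(\<integral>\<^sup>+t. nconv F G t * mag v t \<partial>M) \<le> (\<integral>\<^sup>+s. F s \<partial>M) * gauge_norm M \<Psi> G"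
      using F by (simp add: nn_integral_multc)
  qed
  show "gauge_norm M \<Psi> (nconv F G) \<le> gauge_norm M \<Psi> F * (\<integral>\<^sup>+s. G s \<partial>M)"
  proof (rule gauge_norm_least)
    fix v :: "'a \<Rightarrow> complex" assume v: "v \<in> borel_measurable M" "(\<integral>\<^sup>+ s. \<Psi> (norm (v s)) \<partial>M) \<le> 1"
    have vm: "v \<in> borel_measurable borel" using v by simp
    have "(\<integral>\<^sup>+t. nconv F G t * mag v t \<partial>M) \<le> (\<integral>\<^sup>+s. G s * gauge_norm M \<Psi> F \<partial>M)"
      unfolding nconv_pairing(2)[OF F G mag_measurable[OF vm]]
      by (intro nn_integral_mono mult_left_mono 2 v) simp
    then show "(\<integral>\<^sup>+t. nconv F G t * mag v t \<partial>M) \<le> gauge_norm M \<Psi> F * (\<integral>\<^sup>+s. G s \<partial>M)"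
      using G by (simp add: nn_integral_multc mult.commute)
  qed
qed

text \<open>Each term carries the weight on one factor and the plain \<open>L\<^sup>1\<close> norm on the other. The comparison of spectral radii rests on
  this form of the product inequality.\<close>

lemma wnorm_tconv:
  assumes f: "f \<in> borel_measurable borel" and g: "g \<in> borel_measurable borel"
  shows "wnorm (f \<circledast> g) \<le> ennreal (2 powr \<beta>) * (wnorm f * (\<integral>\<^sup>+s. mag g s \<partial>M) + (\<integral>\<^sup>+s. mag f s \<partial>M) * wnorm g)"
proof -
  let ?F = "\<lambda>s. mag f s * ennreal (weight s)" and ?G = "\<lambda>s. mag g s * ennreal (weight s)"
  note Fm = weighted_measurable[OF f] and Gm = weighted_measurable[OF g]
  note fm = mag_measurable[OF f] and gm = mag_measurable[OF g]
  have pt: "mag (f \<circledast> g) t * ennreal (weight t) \<le> ennreal (2 powr \<beta>) * (nconv ?F (mag g) t + nconv (mag f) ?G t)" for t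
  proof -
    have m1: "(\<lambda>s. ?F s * mag g (- s + t)) \<in> borel_measurable borel"
      by (intro borel_measurable_times_ennreal[OF Fm] borel_compose[OF gm] continuous_intros)
    have m2: "(\<lambda>s. mag f s * ?G (- s + t)) \<in> borel_measurable borel"
      by (intro borel_measurable_times_ennreal[OF fm] borel_compose[OF Gm] continuous_intros)
    have m3: "(\<lambda>s. mag f s * mag g (- s + t)) \<in> borel_measurable borel"
      by (intro borel_measurable_times_ennreal[OF fm] borel_compose[OF gm] continuous_intros)
    have "mag (f \<circledast> g) t * ennreal (weight t) \<le> nconv (mag f) (mag g) t * ennreal (weight t)"
      by (intro mult_right_mono norm_tconv_le) simp
    also have "\<dots> = (\<integral>\<^sup>+s. mag f s * mag g (- s + t) * ennreal (weight t) \<partial>M)"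
      unfolding nconv_def using m3 by (simp add: nn_integral_multc)
    also have "\<dots> \<le> (\<integral>\<^sup>+s. ennreal (2 powr \<beta>) * (?F s * mag g (- s + t) + mag f s * ?G (- s + t)) \<partial>M)"
    proof (rule nn_integral_mono)
      fix s
      have "weight t \<le> 2 powr \<beta> * (weight s + weight (- s + t))"
        using poly_weight_weakly_subadditive[of \<beta> s "- s + t"] beta_pos by (simp add: add.assoc[symmetric])
      then have "norm (f s) * norm (g (- s + t)) * weight t \<le> norm (f s) * norm (g (- s + t)) * (2 powr \<beta> * (weight s + weight (- s + t)))"
        by (intro mult_left_mono) auto
      also have "\<dots> = 2 powr \<beta> * (norm (f s) * weight s * norm (g (- s + t)) + norm (f s) * (norm (g (- s + t)) * weight (- s + t)))"
        by (simp add: algebra_simps)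
      finally have "ennreal (norm (f s) * norm (g (- s + t)) * weight t) \<le>
        ennreal (2 powr \<beta> * (norm (f s) * weight s * norm (g (- s + t)) + norm (f s) * (norm (g (- s + t)) * weight (- s + t))))"
        by (rule ennreal_leI)
      then show "mag f s * mag g (- s + t) * ennreal (weight t) \<le> ennreal (2 powr \<beta>) * (?F s * mag g (- s + t) + mag f s * ?G (- s + t))"
        by (simp add: ennreal_mult)
    qed
    also have "\<dots> = ennreal (2 powr \<beta>) * (nconv ?F (mag g) t + nconv (mag f) ?G t)"
      unfolding nconv_def using m1 m2 by (simp add: nn_integral_cmult nn_integral_add)
    finally show ?thesis .
  qed
  have "wnorm (f \<circledast> g) \<le> gauge_norm M \<Psi> (\<lambda>t. ennreal (2 powr \<beta>) * (nconv ?F (mag g) t + nconv (mag f) ?G t))"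
    unfolding wnorm_def by (intro gauge_norm_mono_AE AE_I2 pt)
  also have "\<dots> = ennreal (2 powr \<beta>) * gauge_norm M \<Psi> (\<lambda>t. nconv ?F (mag g) t + nconv (mag f) ?G t)"
    using nconv_measurable[OF Fm gm] nconv_measurable[OF fm Gm] by (intro gauge_norm_cmult) auto
  also have "\<dots> \<le> ennreal (2 powr \<beta>) * (gauge_norm M \<Psi> (nconv ?F (mag g)) + gauge_norm M \<Psi> (nconv (mag f) ?G))"
    using nconv_measurable[OF Fm gm] nconv_measurable[OF fm Gm] by (intro mult_left_mono gauge_norm_add) auto
  also have "\<dots> \<le> ennreal (2 powr \<beta>) * (wnorm f * (\<integral>\<^sup>+s. mag g s \<partial>M) + (\<integral>\<^sup>+s. mag f s \<partial>M) * wnorm g)"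
    unfolding wnorm_def
    by (intro mult_left_mono add_mono gauge_norm_nconv Fm Gm fm gm) simp
  finally show ?thesis .
qed

lemma Psi_power_bound: "\<exists>x0>0. \<exists>L>0. \<forall>x. 0 \<le> x \<and> x < x0 \<longrightarrow> \<Psi> x \<le> ennreal (L * x powr l)"
proof -
  obtain L0 where L0: "L0 < \<infinity>" "((\<lambda>x. \<Psi> x / ennreal (x powr l)) \<longlongrightarrow> L0) (at_right 0)"
    using Psi_lim by blast
  define L where "L = enn2real L0 + 1"
  have L: "L > 0" by (simp add: L_def add_nonneg_pos)
  have "L0 < ennreal L" using L0(1) by (cases L0) (auto simp: L_def ennreal_less_iff)
  from order_tendstoD(2)[OF L0(2) this] obtain x0 where x0: "x0 > 0"
    "\<And>x. 0 < x \<Longrightarrow> x < x0 \<Longrightarrow> \<Psi> x / ennreal (x powr l) < ennreal L"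
    unfolding eventually_at_right[OF zero_less_one] by blast
  have "\<Psi> x \<le> ennreal (L * x powr l)" if "0 \<le> x" "x < x0" for x
  proof (cases "x = 0")
    case False
    then have x: "0 < x" using that by simp
    then have p: "0 < x powr l" by simp
    have "\<Psi> x = \<Psi> x / ennreal (x powr l) * ennreal (x powr l)"
      using p by (simp add: ennreal_divide_times ennreal_times_divide[symmetric] divide_ennreal_def mult.assoc
          ennreal_inverse_positive[symmetric])
        (simp add: inverse_ennreal ennreal_mult[symmetric])
    also have "\<dots> \<le> ennreal L * ennreal (x powr l)"
      using x0(2)[OF x that(2)] by (intro mult_right_mono) auto
    finally show ?thesis using L by (simp add: ennreal_mult)
  qed simp
  then show ?thesis using x0(1) L by blast
qed

text \<open>The weight \<open>\<omega>\<close> has room to spare: \<open>\<omega>\<^sup>-\<^sup>1 * (1 + \<tau>) powr \<delta>\<close> still lies in the dual Orlicz class,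
  which is where \<open>\<beta> > d / l\<close> enters.\<close>

lemma weighted_L1_embedding:
  "\<exists>\<delta>>0. \<exists>K>0. \<forall>f\<in>borel_measurable borel.
    (\<integral>\<^sup>+s. mag f s * ennreal ((1 + real (word_length U s)) powr \<delta>) \<partial>M) \<le> ennreal K * wnorm f"
proof -
  \<comment> \<open>half of the surplus goes into the weight, the other half keeps the exponent \<open>(\<beta> - \<delta>) * l\<close> above \<open>d\<close>\<close>
  define \<delta> where "\<delta> = (\<beta> - real d / l) / 2"
  have \<delta>: "\<delta> > 0" using beta by (simp add: \<delta>_def)
  have "real d / l < \<beta> - \<delta>" 
  proof -
    have "r < \<beta> \<Longrightarrow> r < \<beta> - (\<beta> - r) / 2" for r :: real by (simp add: field_simps)
    from this[OF beta] show ?thesis by (simp only: \<delta>_def)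
  qed
  moreover have "0 < l" using l by simp
  ultimately have dl: "real d < (\<beta> - \<delta>) * l" by (simp only: pos_divide_less_eq)
  obtain x0 L where x0: "x0 > 0" and L: "L > 0" and PL: "\<And>x. 0 \<le> x \<Longrightarrow> x < x0 \<Longrightarrow> \<Psi> x \<le> ennreal (L * x powr l)"
    using Psi_power_bound by blast
  let ?b = "\<lambda>s. 1 + real (word_length U s)"
  obtain I where I: "(\<integral>\<^sup>+s. ennreal (?b s powr (- ((\<beta> - \<delta>) * l))) \<partial>M) = ennreal I" "0 \<le> I"
    using weight_integrable[OF dl] by (metis ennreal_enn2real enn2real_nonneg infinity_ennreal_def)
  \<comment> \<open>small enough for the power bound on \<open>\<Psi>\<close> to apply and for the integral of \<open>\<Psi> w\<close> to be at most \<open>1\<close>, as \<open>\<alpha> powr l \<le> \<alpha>\<close>\<close>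
  define \<alpha> where "\<alpha> = min 1 (min (x0 / 2) (1 / (L * I + 1)))"
  have LI: "0 < L * I + 1" using L I by (simp add: add_nonneg_pos)
  have "\<alpha> \<le> x0 / 2" by (simp add: \<alpha>_def)
  then have "\<alpha> < x0" using x0 by simp
  moreover have "0 < \<alpha>" using x0 LI by (simp add: \<alpha>_def)
  moreover have "\<alpha> \<le> 1" "\<alpha> \<le> 1 / (L * I + 1)" by (simp_all add: \<alpha>_def)
  ultimately have \<alpha>: "0 < \<alpha>" "\<alpha> \<le> 1" "\<alpha> < x0" "\<alpha> \<le> 1 / (L * I + 1)" by blast+
  define w where "w s = \<alpha> * ?b s powr (\<delta> - \<beta>)" for s
  have db: "\<delta> \<le> \<beta>"
  proof -
    have "0 \<le> real d / l" using l by simp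
    then show ?thesis using beta beta_pos by (simp add: \<delta>_def)
  qed
  have w: "0 \<le> w s" "w s \<le> \<alpha>" for s
  proof -
    have "?b s powr (\<delta> - \<beta>) \<le> ?b s powr 0" using db by (intro powr_mono) auto
    then show "w s \<le> \<alpha>" using \<alpha>(1) by (simp add: w_def)
  qed (use \<alpha> in \<open>simp add: w_def\<close>)
  have wm: "(\<lambda>s. complex_of_real (w s)) \<in> borel_measurable borel"
    unfolding w_def by measurable
  have "(\<integral>\<^sup>+s. \<Psi> (w s) \<partial>M) \<le> (\<integral>\<^sup>+s. ennreal (L * \<alpha>) * ennreal (?b s powr (- ((\<beta> - \<delta>) * l))) \<partial>M)"
  proof (rule nn_integral_mono)
    fix s
    have "\<Psi> (w s) \<le> ennreal (L * w s powr l)" using w[of s] \<alpha>(3) by (intro PL) auto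
    also have "w s powr l = \<alpha> powr l * ?b s powr (- ((\<beta> - \<delta>) * l))"
      using \<alpha>(1) by (simp add: w_def powr_mult powr_powr algebra_simps)
    also have "ennreal (L * (\<alpha> powr l * ?b s powr (- ((\<beta> - \<delta>) * l)))) \<le> ennreal (L * (\<alpha> * ?b s powr (- ((\<beta> - \<delta>) * l))))"
    proof (intro ennreal_leI mult_left_mono mult_right_mono)
      have "\<alpha> powr l \<le> \<alpha> powr 1" using \<alpha> l by (intro powr_mono') auto
      then show "\<alpha> powr l \<le> \<alpha>" using \<alpha>(1) by simp
    qed (use L in auto)
    also have "\<dots> = ennreal (L * \<alpha>) * ennreal (?b s powr (- ((\<beta> - \<delta>) * l)))"
      using L \<alpha>(1) by (simp add: ennreal_mult[symmetric] mult.assoc)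
    finally show "\<Psi> (w s) \<le> ennreal (L * \<alpha>) * ennreal (?b s powr (- ((\<beta> - \<delta>) * l)))" .
  qed
  also have "\<dots> = ennreal (L * \<alpha>) * ennreal I"
  proof -
    have "(\<lambda>s. ennreal (?b s powr (- ((\<beta> - \<delta>) * l)))) \<in> borel_measurable borel" by measurable
    then show ?thesis by (simp add: nn_integral_cmult I(1))
  qed
  also have "\<dots> \<le> 1"
  proof -
    have "L * \<alpha> * I \<le> (L * I) * (1 / (L * I + 1))" using L I \<alpha>(4) mult_left_mono[of \<alpha> "1 / (L * I + 1)" "L * I"] by (simp add: mult_ac)
    also have "\<dots> \<le> 1" using LI by (simp add: divide_le_eq_1)
    finally show ?thesis using L \<alpha>(1) I(2) by (simp add: ennreal_mult[symmetric])
  qed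
  finally have adm: "(\<integral>\<^sup>+s. \<Psi> (norm (complex_of_real (w s))) \<partial>M) \<le> 1" using w(1) by simp
  have "(\<integral>\<^sup>+s. mag f s * ennreal (?b s powr \<delta>) \<partial>M) \<le> ennreal (1 / \<alpha>) * wnorm f" if f: "f \<in> borel_measurable borel" for f
  proof -
    have "(\<integral>\<^sup>+s. mag f s * ennreal (?b s powr \<delta>) \<partial>M) =
        (\<integral>\<^sup>+s. ennreal (1 / \<alpha>) * (mag f s * ennreal (weight s) * ennreal (norm (complex_of_real (w s)))) \<partial>M)"
    proof (rule nn_integral_cong)
      fix s
      have "?b s powr \<delta> = 1 / \<alpha> * (weight s * w s)"
        using \<alpha>(1) by (simp add: w_def poly_weight_def powr_add[symmetric])
      then have "norm (f s) * ?b s powr \<delta> = 1 / \<alpha> * (norm (f s) * weight s * w s)" by simp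
      moreover have "ennreal a * (ennreal b * ennreal c * ennreal e) = ennreal (a * (b * c * e))"
        if "0 \<le> a" "0 \<le> b" "0 \<le> c" "0 \<le> e" for a b c e :: real
        using that by (simp add: ennreal_mult)
      from this[of "1 / \<alpha>" "norm (f s)" "weight s" "w s"]
      have "ennreal (1 / \<alpha>) * (mag f s * ennreal (weight s) * ennreal (w s)) = ennreal (1 / \<alpha> * (norm (f s) * weight s * w s))"
        using \<alpha>(1) w(1)[of s] by simp
      moreover have "mag f s * ennreal (?b s powr \<delta>) = ennreal (norm (f s) * ?b s powr \<delta>)" by (simp add: ennreal_mult)
      moreover have "norm (complex_of_real (w s)) = w s" using w(1)[of s] by simp
      ultimately show "mag f s * ennreal (?b s powr \<delta>) = ennreal (1 / \<alpha>) * (mag f s * ennreal (weight s) * ennreal (norm (complex_of_real (w s))))"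
        by (simp only:)
    qed
    also have "\<dots> = ennreal (1 / \<alpha>) * (\<integral>\<^sup>+s. mag f s * ennreal (weight s) * ennreal (norm (complex_of_real (w s))) \<partial>M)"
    proof (rule nn_integral_cmult)
      show "(\<lambda>s. mag f s * ennreal (weight s) * ennreal (norm (complex_of_real (w s)))) \<in> borel_measurable M"
        unfolding borel_measurable_M by (intro borel_measurable_times_ennreal weighted_measurable[OF f] mag_measurable[OF wm])
    qed
    also have "\<dots> \<le> ennreal (1 / \<alpha>) * wnorm f"
      unfolding wnorm_def using wm adm by (intro mult_left_mono gauge_norm_upper) auto
    finally show ?thesis .
  qed
  then show ?thesis using \<delta> \<alpha>(1) by (intro exI[of _ \<delta>] conjI exI[of _ "1 / \<alpha>"]) auto
qed

lemma L1_le_wnorm: "\<exists>K>0. \<forall>f\<in>borel_measurable borel. (\<integral>\<^sup>+s. mag f s \<partial>M) \<le> ennreal K * wnorm f"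
proof -
  obtain \<delta> K where \<delta>: "\<delta> > 0" and K: "K > 0" "\<And>f. f \<in> borel_measurable borel \<Longrightarrow>
      (\<integral>\<^sup>+s. mag f s * ennreal ((1 + real (word_length U s)) powr \<delta>) \<partial>M) \<le> ennreal K * wnorm f"
    using weighted_L1_embedding by blast
  have "(\<integral>\<^sup>+s. mag f s \<partial>M) \<le> ennreal K * wnorm f" if "f \<in> borel_measurable borel" for f
  proof -
    have "(\<integral>\<^sup>+s. mag f s \<partial>M) \<le> (\<integral>\<^sup>+s. mag f s * ennreal ((1 + real (word_length U s)) powr \<delta>) \<partial>M)"
    proof (rule nn_integral_mono)
      fix s
      have "(1::real) \<le> (1 + real (word_length U s)) powr \<delta>" using \<delta> by (simp add: ge_one_powr_ge_zero)
      then have "mag f s * 1 \<le> mag f s * ennreal ((1 + real (word_length U s)) powr \<delta>)"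
        by (intro mult_left_mono) auto
      then show "mag f s \<le> mag f s * ennreal ((1 + real (word_length U s)) powr \<delta>)" by simp
    qed
    then show ?thesis using K(2)[OF that] by simp
  qed
  then show ?thesis using K(1) by blast
qed

lemma A_subset_L1: "A \<subseteq> L1"
proof
  fix f assume f: "f \<in> A"
  obtain K where "K > 0" "\<forall>f\<in>borel_measurable borel. (\<integral>\<^sup>+s. mag f s \<partial>M) \<le> ennreal K * wnorm f"
    using L1_le_wnorm by blast
  then have "(\<integral>\<^sup>+s. mag f s \<partial>M) \<le> ennreal K * wnorm f" using f by blast
  also have "\<dots> < \<infinity>" using f by (simp add: ennreal_mult_less_top)
  finally show "f \<in> L1" using f by simp
qed

lemma A_tconv:
  assumes "f \<in> A" "g \<in> A"
  shows "f \<circledast> g \<in> A"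
proof -
  have "wnorm (f \<circledast> g) \<le> ennreal (2 powr \<beta>) * (wnorm f * (\<integral>\<^sup>+s. mag g s \<partial>M) + (\<integral>\<^sup>+s. mag f s \<partial>M) * wnorm g)"
    using assms by (intro wnorm_tconv) auto
  also have "\<dots> < \<infinity>" using assms A_subset_L1 by (auto simp: ennreal_mult_less_top)
  finally show ?thesis using assms by (auto simp: tconv_measurable)
qed

text \<open>Interpolation: Cauchy--Schwarz on the ball of radius \<open>k\<close>, the surplus weight outside.\<close>

lemma L1_interpolation:
  "\<exists>\<delta>>0. \<exists>K\<ge>0. \<exists>E\<ge>0. \<forall>f\<in>A \<inter> L2. \<forall>k\<ge>1.
    enn2real (\<integral>\<^sup>+s. mag f s \<partial>M) \<le> E * real k ^ d * sqrt (enn2real (\<integral>\<^sup>+s. (mag f s)\<^sup>2 \<partial>M))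
      + K * real k powr (- \<delta>) * enn2real (wnorm f)"
proof -
  obtain \<delta> K where \<delta>: "\<delta> > 0" and K: "K > 0" "\<And>f. f \<in> borel_measurable borel \<Longrightarrow>
      (\<integral>\<^sup>+s. mag f s * ennreal ((1 + real (word_length U s)) powr \<delta>) \<partial>M) \<le> ennreal K * wnorm f"
    using weighted_L1_embedding by blast
  obtain C where C: "C > 0" "\<And>n. n \<ge> 1 \<Longrightarrow> emeasure M (power_set U n) \<le> ennreal (C * real n ^ d)"
    using growth by (auto simp: growth_bound_def)
  have "enn2real (\<integral>\<^sup>+s. mag f s \<partial>M) \<le> sqrt C * real k ^ d * sqrt (enn2real (\<integral>\<^sup>+s. (mag f s)\<^sup>2 \<partial>M))
      + K * real k powr (- \<delta>) * enn2real (wnorm f)" if f: "f \<in> A \<inter> L2" and k: "k \<ge> 1" for f k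
  proof -
    let ?P = "power_set U k"
    have fm: "f \<in> borel_measurable borel" using f by simp
    note mm = mag_measurable[OF fm]
    have P: "?P \<in> sets M" using compact_power_set[OF U(1)] by (simp add: sets_M compact_imp_closed)
    then have Pb: "?P \<in> sets borel" by (simp add: sets_M)
    define a where "a = (\<integral>\<^sup>+s. mag f s * indicator ?P s \<partial>M)"
    define b where "b = (\<integral>\<^sup>+s. mag f s * indicator (- ?P) s \<partial>M)"
    have split: "(\<integral>\<^sup>+s. mag f s \<partial>M) = a + b"
      unfolding a_def b_def using mm Pb
      by (subst nn_integral_add[symmetric]) (auto intro!: nn_integral_cong simp: indicator_def)
    define q where "q = enn2real (\<integral>\<^sup>+s. (mag f s)\<^sup>2 \<partial>M)"
    have q: "(\<integral>\<^sup>+s. (mag f s)\<^sup>2 \<partial>M) = ennreal q" "0 \<le> q" using f by (auto simp: q_def)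
    have "a\<^sup>2 \<le> (\<integral>\<^sup>+s. (mag f s)\<^sup>2 \<partial>M) * (\<integral>\<^sup>+s. (indicator ?P s)\<^sup>2 \<partial>M)"
      unfolding a_def using mm Pb by (intro Cauchy_Schwarz_nn_integral) auto
    also have "(\<integral>\<^sup>+s. (indicator ?P s :: ennreal)\<^sup>2 \<partial>M) = emeasure M ?P"
    proof -
      have "(indicator ?P s :: ennreal)\<^sup>2 = indicator ?P s" for s by (simp add: indicator_def)
      then show ?thesis using P by simp
    qed
    also have "(\<integral>\<^sup>+s. (mag f s)\<^sup>2 \<partial>M) * emeasure M ?P \<le> ennreal q * ennreal (C * real k ^ d)"
      unfolding q(1) by (intro mult_left_mono C(2) k) simp
    finally have a2: "a\<^sup>2 \<le> ennreal (q * (C * real k ^ d))" using q(2) C(1) by (simp add: ennreal_mult)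
    have "a \<le> ennreal (sqrt C * real k ^ d * sqrt q)"
    proof -
      have "a\<^sup>2 < \<infinity>" using a2 by (rule le_less_trans) simp
      then have afin: "a < \<infinity>" by (auto simp: power2_eq_square ennreal_mult_less_top less_top)
      define a' where "a' = enn2real a"
      have a': "a = ennreal a'" "0 \<le> a'" using afin by (auto simp: a'_def)
      have "a'\<^sup>2 \<le> q * (C * real k ^ d)"
        using a2 q(2) C(1) unfolding a' by (simp add: ennreal_power a'(2) ennreal_le_iff)
      also have "\<dots> \<le> q * (C * (real k ^ d)\<^sup>2)"
        using q(2) C(1) k by (intro mult_left_mono) (auto simp: power2_eq_square one_le_power)
      also have "\<dots> = (sqrt C * real k ^ d * sqrt q)\<^sup>2" using q(2) C(1) by (simp add: power_mult_distrib)
      finally have "a' \<le> sqrt C * real k ^ d * sqrt q"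
        by (rule power2_le_imp_le) (use q(2) C(1) in auto)
      then show ?thesis unfolding a' by (rule ennreal_leI)
    qed
    moreover have "b \<le> ennreal (K * real k powr (- \<delta>) * enn2real (wnorm f))"
    proof -
      have "b \<le> (\<integral>\<^sup>+s. ennreal (real k powr (- \<delta>)) * (mag f s * ennreal ((1 + real (word_length U s)) powr \<delta>)) \<partial>M)"
        unfolding b_def
      proof (rule nn_integral_mono)
        fix s
        show "mag f s * indicator (- ?P) s \<le> ennreal (real k powr (- \<delta>)) * (mag f s * ennreal ((1 + real (word_length U s)) powr \<delta>))"
        proof (cases "s \<in> ?P")
          case False
          then have "k < word_length U s" using word_length_le_iff[OF k, of s] by auto
          then have "real k powr \<delta> \<le> (1 + real (word_length U s)) powr \<delta>" using \<delta> by (intro powr_mono2) auto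
          then have "1 \<le> real k powr (- \<delta>) * (1 + real (word_length U s)) powr \<delta>"
            using k by (simp add: powr_minus field_simps)
          then have "norm (f s) * 1 \<le> norm (f s) * (real k powr (- \<delta>) * (1 + real (word_length U s)) powr \<delta>)"
            by (intro mult_left_mono) auto
          then have "ennreal (norm (f s)) \<le> ennreal (real k powr (- \<delta>) * (norm (f s) * (1 + real (word_length U s)) powr \<delta>))"
            by (intro ennreal_leI) (simp add: mult_ac)
          then show ?thesis using False by (simp add: ennreal_mult)
        qed simp
      qed
      also have "\<dots> = ennreal (real k powr (- \<delta>)) * (\<integral>\<^sup>+s. mag f s * ennreal ((1 + real (word_length U s)) powr \<delta>) \<partial>M)"
        unfolding borel_measurable_M
        by (intro nn_integral_cmult, unfold borel_measurable_M)
          (intro borel_measurable_times_ennreal mm, measurable)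
      also have "\<dots> \<le> ennreal (real k powr (- \<delta>)) * (ennreal K * wnorm f)"
        by (intro mult_left_mono K(2) fm) simp
      also have "\<dots> = ennreal (K * real k powr (- \<delta>) * enn2real (wnorm f))"
      proof -
        have w: "wnorm f = ennreal (enn2real (wnorm f))" using f by simp
        have "ennreal (real k powr (- \<delta>)) * (ennreal K * ennreal w) = ennreal (K * real k powr (- \<delta>) * w)" if "0 \<le> w" for w
          using that K(1) by (simp add: ennreal_mult mult_ac)
        from this[of "enn2real (wnorm f)"] show ?thesis unfolding w[symmetric] by simp
      qed
      finally show ?thesis .
    qed
    ultimately have "a + b \<le> ennreal (sqrt C * real k ^ d * sqrt q) + ennreal (K * real k powr (- \<delta>) * enn2real (wnorm f))"
      by (rule add_mono)
    then have "a + b \<le> ennreal (sqrt C * real k ^ d * sqrt q + K * real k powr (- \<delta>) * enn2real (wnorm f))"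
      using C(1) K(1) q(2) by (subst ennreal_plus) auto
    then show ?thesis unfolding split q_def[symmetric]
      using C(1) K(1) q(2) by (intro enn2real_leI) auto
  qed
  then show ?thesis using \<delta> K(1) C(1) by (intro exI[of _ \<delta>] conjI exI[of _ K] exI[of _ "sqrt C"]) auto
qed

text \<open>Cutting off large values: a bounded integrable function is square integrable. The approximation is in
  \<open>L\<^sup>1\<close>; in the Orlicz norm it can fail when \<open>\<Phi>\<close> satisfies no doubling condition.\<close>

lemma truncation_dense:
  assumes f: "f \<in> A" and e: "e > 0"
  shows "\<exists>b\<in>A \<inter> L2. (\<integral>\<^sup>+s. ennreal (norm (f s - b s)) \<partial>M) < ennreal e"
proof -
  define b where "b n s = (if norm (f s) \<le> real n then f s else 0)" for n :: nat and s
  have fm[measurable]: "f \<in> borel_measurable borel" using f by simp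
  have fL1: "f \<in> L1" using subsetD[OF A_subset_L1 f] .
  have bm[measurable]: "b n \<in> borel_measurable borel" for n unfolding b_def[abs_def] by measurable
  have bA: "b n \<in> A" for n
  proof -
    have "wnorm (b n) \<le> wnorm f" by (rule wnorm_mono) (simp add: b_def)
    then show ?thesis using f bm by (simp add: le_less_trans)
  qed
  have bL2: "b n \<in> L2" for n
  proof -
    have "(\<integral>\<^sup>+s. (mag (b n) s)\<^sup>2 \<partial>M) \<le> (\<integral>\<^sup>+s. ennreal (real n) * mag f s \<partial>M)"
    proof (rule nn_integral_mono)
      fix s
      have "(norm (b n s))\<^sup>2 \<le> real n * norm (f s)"
        by (simp add: b_def power2_eq_square mult_right_mono)
      then show "(mag (b n) s)\<^sup>2 \<le> ennreal (real n) * mag f s"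
        by (simp add: ennreal_power ennreal_mult[symmetric] ennreal_leI)
    qed
    also have "\<dots> = ennreal (real n) * (\<integral>\<^sup>+s. mag f s \<partial>M)" by (intro nn_integral_cmult) simp
    also have "\<dots> < \<infinity>" using fL1 by (simp add: ennreal_mult_less_top)
    finally show ?thesis using bm by simp
  qed
  have "(\<lambda>n. \<integral>\<^sup>+s. ennreal (norm (f s - b n s)) \<partial>M) \<longlonglongrightarrow> (\<integral>\<^sup>+s. 0 \<partial>M)"
  proof (rule nn_integral_dominated_convergence[where w="mag f"])
    show "(\<integral>\<^sup>+s. mag f s \<partial>M) < \<infinity>" using fL1 by simp
    show "AE s in M. ennreal (norm (f s - b n s)) \<le> mag f s" for n by (auto simp: b_def)
    show "AE s in M. (\<lambda>n. ennreal (norm (f s - b n s))) \<longlonglongrightarrow> 0"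
    proof (rule AE_I2)
      fix s
      obtain N where N: "norm (f s) \<le> real N" using real_arch_simple by blast
      have "eventually (\<lambda>n. (0::ennreal) = ennreal (norm (f s - b n s))) sequentially"
        using N by (intro eventually_sequentiallyI[of N]) (simp add: b_def)
      then show "(\<lambda>n. ennreal (norm (f s - b n s))) \<longlonglongrightarrow> 0"
        by (rule Lim_transform_eventually[OF tendsto_const])
    qed
  qed measurable
  then have "eventually (\<lambda>n. (\<integral>\<^sup>+s. ennreal (norm (f s - b n s)) \<partial>M) < ennreal e) sequentially"
    using e by (intro order_tendstoD(2)[where a="ennreal e"]) auto
  then obtain n where "(\<integral>\<^sup>+s. ennreal (norm (f s - b n s)) \<partial>M) < ennreal e"
    using eventually_happens'[OF sequentially_bot] by blast
  then show ?thesis using bA bL2 by blast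
qed

end

section \<open>Growth of powers\<close>

lemma linear_recursion_bound:
  fixes u :: "nat \<Rightarrow> real"
  assumes u: "\<And>n. u (Suc n) \<le> t * u n + K * t ^ n" and t: "0 \<le> t" "t < t'" and K: "0 \<le> K" and u0: "0 \<le> u 0"
  shows "\<exists>D\<ge>0. \<forall>n. u n \<le> D * t' ^ n"
proof -
  define D where "D = u 0 + K / (t' - t)"
  have D: "0 \<le> D" "u 0 \<le> D" "K \<le> D * (t' - t)"
  proof -
    have "0 \<le> K / (t' - t)" "K = K / (t' - t) * (t' - t)" using K t by auto
    moreover have "0 \<le> u 0 * (t' - t)" using u0 t by simp
    ultimately show "0 \<le> D" "u 0 \<le> D" "K \<le> D * (t' - t)"
      using u0 by (auto simp: D_def distrib_right)
  qed
  have "u n \<le> D * t' ^ n" for n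
  proof (induction n)
    case (Suc n)
    have "t ^ n \<le> t' ^ n" using t by (intro power_mono) auto
    then have "K * t ^ n \<le> D * (t' - t) * t' ^ n"
      using D t K by (intro mult_mono) auto
    moreover have "t * u n \<le> t * (D * t' ^ n)" using Suc t by (intro mult_left_mono) auto
    ultimately have "u (Suc n) \<le> t * (D * t' ^ n) + D * (t' - t) * t' ^ n" using u[of n] by linarith
    also have "\<dots> = D * t' ^ Suc n" by (simp add: algebra_simps)
    finally show ?case .
  qed (use D in simp)
  then show ?thesis using D(1) by blast
qed

text \<open>Here \<open>a\<close> plays the role of the Banach norm of the powers of an element, \<open>u\<close> that of their \<open>L\<^sup>1\<close> norm, and
  \<open>g\<close> bounds the element as an operator on \<open>L\<^sup>2\<close>. If the exponential rate \<open>r\<close> of \<open>a\<close> exceeded \<open>g\<close>, the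
  interpolation inequality with \<open>k\<close> of order \<open>q ^ n\<close>, \<open>q > 1\<close> small, would give \<open>u\<close> a rate below \<open>r\<close>, and then
  doubling would lower the rate of \<open>a\<close>.\<close>

lemma growth_rate:
  fixes a u :: "nat \<Rightarrow> real" and g \<delta> C :: real
  assumes a: "\<And>n. 0 \<le> a n" and u: "\<And>n. 0 \<le> u n" and g: "0 \<le> g" and \<delta>: "0 < \<delta>" and C: "0 \<le> C"
    and submult: "\<And>m n. a (m + n) \<le> C * a m * a n"
    and doubling: "\<And>n. a (n + n) \<le> C * a n * u n"
    and interp: "\<And>\<epsilon>. \<epsilon> > 0 \<Longrightarrow> \<exists>K\<ge>0. \<forall>n. \<forall>k::nat. k \<ge> 1 \<longrightarrow>
      u (Suc n) \<le> (g + \<epsilon>) * u n + K * (real k ^ d * g ^ n + real k powr (- \<delta>) * a n)"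
    and s0: "g < s0"
  shows "\<exists>D. \<forall>n. a n \<le> D * s0 ^ n"
proof (rule ccontr)
  assume neg: "\<not> ?thesis"
  define S where "S = {s. 0 < s \<and> (\<exists>D. \<forall>n. a n \<le> D * s ^ n)}"
  have S_lower: "s0 \<le> s" if s: "s \<in> S" for s
  proof (rule ccontr)
    assume "\<not> s0 \<le> s"
    then have ss: "s \<le> s0" by simp
    obtain D where D: "\<And>n. a n \<le> D * s ^ n" and sp: "0 < s" using s by (auto simp: S_def)
    have "0 \<le> D" using D[of 0] a[of 0] by simp
    then have "a n \<le> D * s0 ^ n" for n
      using D[of n] ss sp by (meson mult_left_mono order.trans power_mono less_imp_le)
    then show False using neg by blast
  qed
  have S_ne: "C * a 1 + 1 \<in> S"
  proof -
    have p: "0 \<le> C * a 1" using C a by simp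
    have "a n \<le> a 0 * (C * a 1 + 1) ^ n" for n
    proof (induction n)
      case (Suc n)
      have "a (Suc n) \<le> C * a 1 * a n" using submult[of 1 n] by simp
      also have "\<dots> \<le> (C * a 1 + 1) * (a 0 * (C * a 1 + 1) ^ n)"
        using Suc p a by (intro mult_mono) auto
      finally show ?case by (simp add: mult_ac)
    qed simp
    then show ?thesis using p by (auto simp: S_def intro!: exI[of _ "a 0"])
  qed
  define r where "r = Inf S"
  have bdd: "bdd_below S" using S_lower by (intro bdd_belowI[of _ s0]) auto
  have r_le: "r \<le> s" if "s \<in> S" for s unfolding r_def by (intro cInf_lower that bdd)
  have rs: "s0 \<le> r" unfolding r_def using S_ne S_lower by (intro cInf_greatest) auto
  have gr: "g < r" using s0 rs by simp
  then have r: "0 < r" using g by simp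
  \<comment> \<open>with \<open>k\<close> of order \<open>q ^ n\<close>, the factor \<open>k ^ d\<close> then does not lift the rate of \<open>k ^ d * g ^ n\<close> to \<open>r\<close>\<close>
  obtain q where q: "1 < q" "q ^ d * g < r"
  proof -
    have "((\<lambda>q::real. q ^ d * g) \<longlongrightarrow> 1 ^ d * g) (at_right 1)" by (intro tendsto_intros)
    then have "eventually (\<lambda>q::real. q ^ d * g < r) (at_right 1)" using gr by (intro order_tendstoD(2)) auto
    moreover have "eventually (\<lambda>q::real. 1 < q) (at_right 1)" by (rule eventually_at_right_less)
    ultimately have "eventually (\<lambda>q::real. 1 < q \<and> q ^ d * g < r) (at_right 1)" by eventually_elim simp
    then show thesis using that eventually_happens'[OF trivial_limit_at_right_real] by blast
  qed
  define \<epsilon> where "\<epsilon> = (r - g) / 2"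
  have \<epsilon>: "0 < \<epsilon>" "g + \<epsilon> < r" using gr by (auto simp: \<epsilon>_def field_simps)
  define p where "p = q powr (- \<delta>)"
  have p: "0 < p" "p < 1" using q(1) \<delta> by (auto simp: p_def powr_less_one)
  \<comment> \<open>the rate that the recursion would give for \<open>u\<close> if \<open>a\<close> grew like \<open>r ^ n\<close>; for a rate \<open>s \<ge> r\<close> of \<open>a\<close> it is at most \<open>t0 * s / r\<close>\<close>
  define t0 where "t0 = max (g + \<epsilon>) (max (q ^ d * g) (p * r))"
  have t0: "0 < t0" "t0 < r" using \<epsilon> q(2) p r g by (auto simp: t0_def less_max_iff_disj add_nonneg_pos)
  define t1 where "t1 = (t0 + r) / 2"
  have t1: "t0 < t1" "t1 < r" "0 < t1" using t0 by (auto simp: t1_def)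
  \<comment> \<open>close enough to the infimum that the doubled rate satisfies \<open>s * (t1 * s / r) < r\<^sup>2\<close>\<close>
  have "r < r * sqrt (r / t1)" using r t1 by simp
  then obtain s where s: "s \<in> S" "s < r * sqrt (r / t1)"
    using cInf_less_iff[OF _ bdd, of "r * sqrt (r / t1)"] S_ne unfolding r_def[symmetric] by blast
  have sr: "r \<le> s" by (rule r_le[OF s(1)])
  have sp: "0 < s" using sr r by simp
  obtain D where D: "\<And>n. a n \<le> D * s ^ n" using s(1) by (auto simp: S_def)
  have D0: "0 \<le> D" using D[of 0] a[of 0] by simp
  obtain K where K: "0 \<le> K" "\<And>n k. k \<ge> 1 \<Longrightarrow>
      u (Suc n) \<le> (g + \<epsilon>) * u n + K * (real k ^ d * g ^ n + real k powr (- \<delta>) * a n)"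
    using interp[OF \<epsilon>(1)] by blast
  define t where "t = t0 * s / r"
  have t: "0 < t" using t0 sp r by (simp add: t_def)
  have sr1: "1 \<le> s / r" using sr r by simp
  have t_ge: "g + \<epsilon> \<le> t" "q ^ d * g \<le> t" "p * s \<le> t"
  proof -
    have "t0 * 1 \<le> t0 * (s / r)" using sr1 t0 by (intro mult_left_mono) auto
    then have "t0 \<le> t" by (simp add: t_def)
    then show "g + \<epsilon> \<le> t" "q ^ d * g \<le> t" by (auto simp: t0_def)
    have "p * r * (s / r) \<le> t0 * (s / r)" using sr1 by (intro mult_right_mono) (auto simp: t0_def)
    then show "p * s \<le> t" using r by (simp add: t_def)
  qed
  have rec: "u (Suc n) \<le> t * u n + (K * (2 ^ d + D)) * t ^ n" for n
  proof -
    define k where "k = nat \<lceil>q ^ n\<rceil>"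
    have qn: "1 \<le> q ^ n" using q(1) by simp
    have k1: "q ^ n \<le> real k" unfolding k_def by (rule real_nat_ceiling_ge)
    have k2: "real k \<le> 2 * q ^ n"
    proof -
      have "real k = of_int \<lceil>q ^ n\<rceil>" using qn by (simp add: k_def)
      also have "\<dots> \<le> q ^ n + 1" by linarith
      finally show ?thesis using qn by linarith
    qed
    have kge: "1 \<le> k" using k1 qn by (metis of_nat_1 of_nat_le_iff order_trans)
    have 1: "real k ^ d * g ^ n \<le> 2 ^ d * t ^ n"
    proof -
      have "real k ^ d * g ^ n \<le> (2 * q ^ n) ^ d * g ^ n" using k2 g by (intro mult_right_mono power_mono) auto
      also have "\<dots> = 2 ^ d * (q ^ d * g) ^ n" by (simp add: power_mult_distrib power_mult[symmetric] mult.commute)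
      also have "\<dots> \<le> 2 ^ d * t ^ n" using t_ge(2) g q(1) by (intro mult_left_mono power_mono) auto
      finally show ?thesis .
    qed
    have 2: "real k powr (- \<delta>) * a n \<le> D * t ^ n"
    proof -
      have "real k powr (- \<delta>) \<le> (q ^ n) powr (- \<delta>)" using k1 qn \<delta> by (intro powr_mono2') auto
      also have "\<dots> = p ^ n" using q(1) by (simp add: p_def powr_powr powr_realpow[symmetric] mult.commute)
      finally have "real k powr (- \<delta>) * a n \<le> p ^ n * (D * s ^ n)"
        using D[of n] a[of n] p by (intro mult_mono) auto
      also have "\<dots> = D * (p * s) ^ n" by (simp add: power_mult_distrib)
      also have "\<dots> \<le> D * t ^ n" using t_ge(3) p sp D0 by (intro mult_left_mono power_mono) auto
      finally show ?thesis .
    qed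
    have "u (Suc n) \<le> (g + \<epsilon>) * u n + K * (real k ^ d * g ^ n + real k powr (- \<delta>) * a n)" by (rule K(2)[OF kge])
    also have "\<dots> \<le> t * u n + K * (2 ^ d * t ^ n + D * t ^ n)"
      using t_ge(1) u[of n] K(1) 1 2 by (intro add_mono mult_right_mono mult_left_mono) auto
    finally show ?thesis by (simp add: algebra_simps)
  qed
  define t' where "t' = t1 * s / r"
  have tt': "t < t'" unfolding t_def t'_def using t1 sp r by (intro divide_strict_right_mono mult_strict_right_mono)
  obtain D' where D': "0 \<le> D'" "\<And>n. u n \<le> D' * t' ^ n"
    using linear_recursion_bound[OF rec _ tt' _ u] t K(1) D0 by auto
  define s' where "s' = sqrt (s * t')"
  have t'p: "0 < t'" using t tt' by simp
  have s'p: "0 < s'" using sp t'p by (simp add: s'_def)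
  have s'2: "s'\<^sup>2 = s * t'" using sp t'p by (simp add: s'_def)
  have "s' < r"
  proof -
    have "s\<^sup>2 < (r * sqrt (r / t1))\<^sup>2" using s(2) sp by (intro power_strict_mono) auto
    also have "\<dots> = r\<^sup>2 * (r / t1)" using r t1 by (simp add: power_mult_distrib)
    finally have "s\<^sup>2 * t1 / r < r\<^sup>2" using r t1 by (simp add: field_simps)
    then have "s'\<^sup>2 < r\<^sup>2" unfolding s'2 t'_def by (simp add: power2_eq_square mult_ac)
    then show ?thesis using r by (intro power2_less_imp_less[of s' r]) auto
  qed
  have even_bound: "a (n + n) \<le> (C * D * D') * s' ^ (n + n)" for n
  proof -
    have "a (n + n) \<le> C * a n * u n" by (rule doubling)
    also have "\<dots> \<le> C * (D * s ^ n) * (D' * t' ^ n)"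
      using D[of n] D'(2)[of n] a[of n] u[of n] C D0 sp by (intro mult_mono) auto
    also have "\<dots> = (C * D * D') * (s'\<^sup>2) ^ n" unfolding s'2 by (simp add: power_mult_distrib)
    also have "(s'\<^sup>2) ^ n = s' ^ (n + n)" by (simp add: power_mult[symmetric] mult_2)
    finally show ?thesis .
  qed
  define Q where "Q = C * D * D'"
  have Q: "0 \<le> Q" using C D0 D' by (simp add: Q_def)
  define P where "P = max Q (C * a 1 * Q / s')"
  have "a n \<le> P * s' ^ n" for n
  proof (cases "even n")
    case True
    then obtain m where m: "n = m + m" by (metis evenE mult_2)
    have "a n \<le> Q * s' ^ n" using even_bound[of m] by (simp add: m Q_def)
    also have "\<dots> \<le> P * s' ^ n" using s'p by (intro mult_right_mono) (auto simp: P_def)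
    finally show ?thesis .
  next
    case False
    then obtain m where m: "n = Suc (m + m)" by (metis oddE mult_2 Suc_eq_plus1)
    have "a n \<le> C * a 1 * a (m + m)" using submult[of 1 "m + m"] by (simp add: m)
    also have "\<dots> \<le> C * a 1 * (Q * s' ^ (m + m))"
      using even_bound[of m] C a by (intro mult_left_mono) (auto simp: Q_def)
    also have "\<dots> = (C * a 1 * Q / s') * s' ^ n" using s'p by (simp add: m)
    also have "\<dots> \<le> P * s' ^ n" using s'p by (intro mult_right_mono) (auto simp: P_def)
    finally show ?thesis .
  qed
  then have "s' \<in> S" using s'p by (auto simp: S_def)
  from r_le[OF this] show False using \<open>s' < r\<close> by simp
qed

section \<open>A symmetry criterion for Banach *-algebras\<close>

locale banach_star_alg =
  fixes B :: "'x star_algebra" (structure)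
  assumes banach: "banach_star_algebra B"
begin

abbreviation nrm :: "'x \<Rightarrow> real" where "nrm \<equiv> vnorm B"

lemma module_B: "Module.module (ring_of_type_algebra :: complex ring) B"
  using banach by (simp add: banach_star_algebra_def)

sublocale Module.module "ring_of_type_algebra :: complex ring" B
  by (rule module_B)

lemma scalars: "carrier (ring_of_type_algebra :: complex ring) = UNIV"
  "a \<oplus>\<^bsub>ring_of_type_algebra\<^esub> b = (a + b :: complex)" "a \<otimes>\<^bsub>ring_of_type_algebra\<^esub> b = (a * b :: complex)"
  "\<one>\<^bsub>ring_of_type_algebra\<^esub> = (1 :: complex)"
  by (simp_all add: ring_of_type_algebra_def)

lemma scale_closed [simp, intro]: "x \<in> carrier B \<Longrightarrow> c \<odot> x \<in> carrier B"
  using smult_closed[of c x] by (simp add: scalars)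

lemma scale_add_left: "x \<in> carrier B \<Longrightarrow> (a + b) \<odot> x = a \<odot> x \<oplus> b \<odot> x"
  using smult_l_distr[of a b x] by (simp add: scalars)

lemma scale_add_right: "x \<in> carrier B \<Longrightarrow> y \<in> carrier B \<Longrightarrow> a \<odot> (x \<oplus> y) = a \<odot> x \<oplus> a \<odot> y"
  using smult_r_distr[of a x y] by (simp add: scalars)

lemma scale_scale [simp]: "x \<in> carrier B \<Longrightarrow> a \<odot> (b \<odot> x) = (a * b) \<odot> x"
  using smult_assoc1[of a b x] by (simp add: scalars)

lemma scale_one [simp]: "x \<in> carrier B \<Longrightarrow> 1 \<odot> x = x"
  using smult_one[of x] by (simp add: scalars)

lemma scale_zero [simp]: "x \<in> carrier B \<Longrightarrow> 0 \<odot> x = \<zero>"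
proof -
  assume x: "x \<in> carrier B"
  have "0 \<odot> x \<oplus> 0 \<odot> x = 0 \<odot> x \<oplus> \<zero>" using scale_add_left[OF x, of 0 0] x by simp
  then show ?thesis using x by (simp only: add.l_cancel scale_closed zero_closed)
qed

lemma minus_eq_scale: "x \<in> carrier B \<Longrightarrow> \<ominus> x = (- 1) \<odot> x"
proof -
  assume x: "x \<in> carrier B"
  have "(- 1) \<odot> x \<oplus> x = \<zero>" using scale_add_left[OF x, of "- 1" 1] x by simp
  then show ?thesis using x by (intro minus_equality) auto
qed

lemma diff_eq: "x \<in> carrier B \<Longrightarrow> y \<in> carrier B \<Longrightarrow> x \<ominus> y = x \<oplus> (- 1) \<odot> y"
  by (simp add: a_minus_def minus_eq_scale)

lemma mult_closed [simp, intro]: "x \<in> carrier B \<Longrightarrow> y \<in> carrier B \<Longrightarrow> x \<otimes> y \<in> carrier B"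
  using banach by (simp add: banach_star_algebra_def)

lemma mult_assoc: "x \<in> carrier B \<Longrightarrow> y \<in> carrier B \<Longrightarrow> z \<in> carrier B \<Longrightarrow> (x \<otimes> y) \<otimes> z = x \<otimes> (y \<otimes> z)"
  using banach by (simp add: banach_star_algebra_def)

lemma distrib_left: "x \<in> carrier B \<Longrightarrow> y \<in> carrier B \<Longrightarrow> z \<in> carrier B \<Longrightarrow> x \<otimes> (y \<oplus> z) = x \<otimes> y \<oplus> x \<otimes> z"
  using banach by (simp add: banach_star_algebra_def)

lemma distrib_right: "x \<in> carrier B \<Longrightarrow> y \<in> carrier B \<Longrightarrow> z \<in> carrier B \<Longrightarrow> (x \<oplus> y) \<otimes> z = x \<otimes> z \<oplus> y \<otimes> z"
  using banach by (simp add: banach_star_algebra_def)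

lemma scale_mult [simp]: "x \<in> carrier B \<Longrightarrow> y \<in> carrier B \<Longrightarrow> (c \<odot> x) \<otimes> y = c \<odot> (x \<otimes> y)"
  "x \<in> carrier B \<Longrightarrow> y \<in> carrier B \<Longrightarrow> x \<otimes> (c \<odot> y) = c \<odot> (x \<otimes> y)"
  using banach unfolding banach_star_algebra_def by blast+

lemma zero_mult [simp]: "x \<in> carrier B \<Longrightarrow> \<zero> \<otimes> x = \<zero>" "x \<in> carrier B \<Longrightarrow> x \<otimes> \<zero> = \<zero>"
  using scale_mult[of \<zero> x 0] scale_mult(2)[of x \<zero> 0] by auto

lemma scale_right_zero [simp]: "c \<odot> \<zero> = \<zero>"
  using scale_scale[of \<zero> c 0] by simp

lemma nrm_nonneg [simp]: "x \<in> carrier B \<Longrightarrow> 0 \<le> nrm x"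
  using banach unfolding banach_star_algebra_def by blast

lemma nrm_eq_0: "x \<in> carrier B \<Longrightarrow> nrm x = 0 \<longleftrightarrow> x = \<zero>"
  using banach unfolding banach_star_algebra_def by blast

lemma nrm_zero [simp]: "nrm \<zero> = 0"
  by (simp add: nrm_eq_0)

lemma nrm_scale: "x \<in> carrier B \<Longrightarrow> nrm (c \<odot> x) = norm c * nrm x"
  using banach unfolding banach_star_algebra_def by blast

lemma nrm_add: "x \<in> carrier B \<Longrightarrow> y \<in> carrier B \<Longrightarrow> nrm (x \<oplus> y) \<le> nrm x + nrm y"
  using banach unfolding banach_star_algebra_def by blast

lemma nrm_diff_commute: "x \<in> carrier B \<Longrightarrow> y \<in> carrier B \<Longrightarrow> nrm (x \<ominus> y) = nrm (y \<ominus> x)"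
proof -
  assume x: "x \<in> carrier B" and y: "y \<in> carrier B"
  have "x \<ominus> y = (- 1) \<odot> (y \<ominus> x)" using x y by (simp add: diff_eq scale_add_right a_comm)
  then show ?thesis using x y by (simp add: nrm_scale)
qed

lemma nrm_mult_bound: "\<exists>C>0. \<forall>x\<in>carrier B. \<forall>y\<in>carrier B. nrm (x \<otimes> y) \<le> C * nrm x * nrm y"
  using banach unfolding banach_star_algebra_def by blast

lemma complete:
  assumes "range F \<subseteq> carrier B" "\<And>e. e > 0 \<Longrightarrow> \<exists>N. \<forall>m\<ge>N. \<forall>n\<ge>N. nrm (F m \<ominus> F n) < e"
  shows "\<exists>x\<in>carrier B. (\<lambda>n. nrm (F n \<ominus> x)) \<longlonglongrightarrow> 0"
  using banach assms unfolding banach_star_algebra_def by blast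

lemma invol_closed [simp, intro]: "x \<in> carrier B \<Longrightarrow> invol B x \<in> carrier B"
  using banach unfolding banach_star_algebra_def by blast

lemma geometric_convergence:
  assumes F: "\<And>n. F n \<in> carrier B" and step: "\<And>n. nrm (F (Suc n) \<ominus> F n) \<le> D * \<rho> ^ n" and \<rho>: "0 \<le> \<rho>" "\<rho> < 1"
  shows "\<exists>x\<in>carrier B. (\<lambda>n. nrm (F n \<ominus> x)) \<longlonglongrightarrow> 0"
proof (rule complete)
  show "range F \<subseteq> carrier B" using F by auto
  have "nrm (F (Suc 0) \<ominus> F 0) \<le> D" using step[of 0] by simp
  then have D: "0 \<le> D" using F by (intro order_trans[OF nrm_nonneg]) auto
  have tri: "nrm (F m \<ominus> F n) \<le> nrm (F m \<ominus> F k) + nrm (F k \<ominus> F n)" for m n k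
  proof -
    have "F m \<ominus> F n = (F m \<ominus> F k) \<oplus> (F k \<ominus> F n)"
    proof -
      have "(F m \<ominus> F k) \<oplus> (F k \<ominus> F n) = F m \<oplus> ((\<ominus> F k \<oplus> F k) \<oplus> \<ominus> F n)"
        using F by (simp only: a_minus_def a_assoc a_closed a_inv_closed)
      then show ?thesis using F by (simp add: l_neg a_minus_def)
    qed
    then show ?thesis using nrm_add[of "F m \<ominus> F k" "F k \<ominus> F n"] F by simp
  qed
  have bound: "nrm (F (n + j) \<ominus> F n) \<le> D / (1 - \<rho>) * (\<rho> ^ n - \<rho> ^ (n + j))" for n j
  proof (induction j)
    case 0
    then show ?case using F by (simp add: nrm_eq_0 r_neg a_minus_def)
  next
    case (Suc j)
    have "nrm (F (n + Suc j) \<ominus> F n) \<le> D * \<rho> ^ (n + j) + D / (1 - \<rho>) * (\<rho> ^ n - \<rho> ^ (n + j))"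
      using tri[of "n + Suc j" n "n + j"] step[of "n + j"] Suc by simp
    also have "D * \<rho> ^ (n + j) = D / (1 - \<rho>) * (\<rho> ^ (n + j) - \<rho> ^ (n + Suc j))"
      using \<rho> by (simp add: field_simps)
    finally show ?case by (simp add: algebra_simps)
  qed
  fix e :: real assume e: "e > 0"
  have "(\<lambda>n. D / (1 - \<rho>) * \<rho> ^ n) \<longlonglongrightarrow> D / (1 - \<rho>) * 0"
    using \<rho> by (intro tendsto_mult_left LIMSEQ_realpow_zero)
  then have "eventually (\<lambda>n. D / (1 - \<rho>) * \<rho> ^ n < e) sequentially" using e by (intro order_tendstoD(2)) auto
  then obtain N where N: "D / (1 - \<rho>) * \<rho> ^ n < e" if "n \<ge> N" for n by (auto simp: eventually_sequentially)
  have "nrm (F m \<ominus> F n) < e" if "n \<ge> N" "m \<ge> n" for m n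
  proof -
    have "nrm (F m \<ominus> F n) \<le> D / (1 - \<rho>) * (\<rho> ^ n - \<rho> ^ m)"
      using bound[of n "m - n"] that by simp
    also have "\<dots> \<le> D / (1 - \<rho>) * \<rho> ^ n" using D \<rho> by (intro mult_left_mono) auto
    finally show ?thesis using N[OF that(1)] by simp
  qed
  then show "\<exists>N. \<forall>m\<ge>N. \<forall>n\<ge>N. nrm (F m \<ominus> F n) < e"
    by (metis F nrm_diff_commute linear)
qed

text \<open>\<open>(\<gamma> ^ n, upow h \<gamma> n)\<close> is the \<open>n\<close>-th power of \<open>(\<gamma>, h)\<close> in the unitization, and \<open>act h \<gamma> n\<close> is
  multiplication by it.\<close>

primrec upow :: "'x \<Rightarrow> complex \<Rightarrow> nat \<Rightarrow> 'x" where
  "upow h \<gamma> 0 = \<zero>"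
| "upow h \<gamma> (Suc n) = (h \<otimes> upow h \<gamma> n \<oplus> \<gamma> \<odot> upow h \<gamma> n) \<oplus> \<gamma> ^ n \<odot> h"

definition act :: "'x \<Rightarrow> complex \<Rightarrow> nat \<Rightarrow> 'x \<Rightarrow> 'x" where
  "act h \<gamma> n y = \<gamma> ^ n \<odot> y \<oplus> upow h \<gamma> n \<otimes> y"

lemma upow_closed [simp, intro]: "h \<in> carrier B \<Longrightarrow> upow h \<gamma> n \<in> carrier B"
  by (induction n) auto

lemma act_closed [simp, intro]: "h \<in> carrier B \<Longrightarrow> y \<in> carrier B \<Longrightarrow> act h \<gamma> n y \<in> carrier B"
  by (simp add: act_def)

lemma act_0: "y \<in> carrier B \<Longrightarrow> act h \<gamma> 0 y = y"
  by (simp add: act_def)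

lemma act_Suc:
  assumes h: "h \<in> carrier B" and y: "y \<in> carrier B"
  shows "act h \<gamma> (Suc n) y = h \<otimes> act h \<gamma> n y \<oplus> \<gamma> \<odot> act h \<gamma> n y"
  using h y by (simp add: act_def distrib_left distrib_right scale_add_right mult_assoc a_ac)

lemma upow_add:
  assumes h: "h \<in> carrier B"
  shows "upow h \<gamma> (m + n) = act h \<gamma> m (upow h \<gamma> n) \<oplus> \<gamma> ^ n \<odot> upow h \<gamma> m"
proof (induction m)
  case (Suc m)
  then show ?case
    using h by (simp add: act_Suc distrib_left scale_add_right power_add mult_ac a_ac)
qed (use h in \<open>simp add: act_0\<close>)

lemma upow_commute:
  assumes h: "h \<in> carrier B"
  shows "upow h \<gamma> n \<otimes> h = h \<otimes> upow h \<gamma> n"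
  by (induction n) (use h in \<open>simp_all add: distrib_left distrib_right mult_assoc\<close>)

lemma upow_Suc_act:
  assumes h: "h \<in> carrier B"
  shows "upow h \<gamma> (Suc n) = act h \<gamma> n h \<oplus> \<gamma> \<odot> upow h \<gamma> n"
  using h by (simp add: act_def upow_commute a_ac)

text \<open>Partial sums of the Neumann series for the inverse of \<open>z - h = (z + \<gamma>) - (\<gamma> + h)\<close>, without their scalar parts.\<close>

primrec nsum :: "'x \<Rightarrow> complex \<Rightarrow> complex \<Rightarrow> nat \<Rightarrow> 'x" where
  "nsum h \<gamma> z 0 = \<zero>"
| "nsum h \<gamma> z (Suc n) = nsum h \<gamma> z n \<oplus> (1 / (z + \<gamma>) ^ Suc n) \<odot> upow h \<gamma> n"

lemma nsum_closed [simp, intro]: "h \<in> carrier B \<Longrightarrow> nsum h \<gamma> z n \<in> carrier B"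
  by (induction n) auto

lemma nsum_commute: "h \<in> carrier B \<Longrightarrow> nsum h \<gamma> z n \<otimes> h = h \<otimes> nsum h \<gamma> z n"
  by (induction n) (simp_all add: distrib_left distrib_right upow_commute)

lemma nsum_telescope:
  assumes h: "h \<in> carrier B" and z: "z + \<gamma> \<noteq> 0"
  shows "z \<odot> nsum h \<gamma> z n \<oplus> (1 / (z + \<gamma>) ^ n) \<odot> upow h \<gamma> n =
    h \<otimes> nsum h \<gamma> z n \<oplus> (\<Sum>i<n. \<gamma> ^ i / (z + \<gamma>) ^ Suc i) \<odot> h"
proof (induction n)
  case (Suc n)
  define w where "w = upow h \<gamma> n"
  define S where "S = nsum h \<gamma> z n"
  define c where "c = 1 / (z + \<gamma>) ^ Suc n"
  define \<sigma> where "\<sigma> = (\<Sum>i<n. \<gamma> ^ i / (z + \<gamma>) ^ Suc i)"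
  have [simp]: "w \<in> carrier B" "S \<in> carrier B" using h by (auto simp: w_def S_def)
  have zc: "z * c + c * \<gamma> = 1 / (z + \<gamma>) ^ n"
  proof -
    have "z * c + c * \<gamma> = (z + \<gamma>) * c" by (simp add: algebra_simps)
    then show ?thesis using z by (simp add: c_def)
  qed
  have SS: "nsum h \<gamma> z (Suc n) = S \<oplus> c \<odot> w" by (simp only: nsum.simps S_def w_def c_def)
  have US: "upow h \<gamma> (Suc n) = (h \<otimes> w \<oplus> \<gamma> \<odot> w) \<oplus> \<gamma> ^ n \<odot> h" by (simp only: upow.simps w_def)
  have "z \<odot> nsum h \<gamma> z (Suc n) \<oplus> c \<odot> upow h \<gamma> (Suc n) =
      (z \<odot> S \<oplus> ((z * c) \<odot> w \<oplus> (c * \<gamma>) \<odot> w)) \<oplus> (c \<odot> (h \<otimes> w) \<oplus> (c * \<gamma> ^ n) \<odot> h)"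
    unfolding SS US using h by (simp add: scale_add_right a_ac)
  also have "(z * c) \<odot> w \<oplus> (c * \<gamma>) \<odot> w = (1 / (z + \<gamma>) ^ n) \<odot> w"
    by (simp add: scale_add_left[symmetric] zc)
  also have "z \<odot> S \<oplus> (1 / (z + \<gamma>) ^ n) \<odot> w = h \<otimes> S \<oplus> \<sigma> \<odot> h"
    using Suc by (simp add: w_def S_def \<sigma>_def)
  also have "h \<otimes> S \<oplus> \<sigma> \<odot> h \<oplus> (c \<odot> (h \<otimes> w) \<oplus> (c * \<gamma> ^ n) \<odot> h) =
      h \<otimes> (S \<oplus> c \<odot> w) \<oplus> (\<sigma> + c * \<gamma> ^ n) \<odot> h"
    using h by (simp add: distrib_left scale_add_left a_ac)
  also have "\<sigma> + c * \<gamma> ^ n = (\<Sum>i<Suc n. \<gamma> ^ i / (z + \<gamma>) ^ Suc i)"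
    by (simp add: \<sigma>_def c_def)
  finally show ?case unfolding SS[symmetric] unfolding c_def .
qed (use h in simp)

text \<open>The conclusion says that \<open>(1 / z, v)\<close> inverts \<open>z - h\<close> in the unitization. The limit of the Neumann sums serves as
  \<open>v\<close>, and the scalar parts of the series sum to \<open>1 / z\<close>.\<close>

lemma neumann_resolvent:
  assumes h: "h \<in> carrier B" and z: "z \<noteq> 0" and s: "norm \<gamma> < norm (z + \<gamma>)" "0 \<le> s" "s < norm (z + \<gamma>)"
    and D: "\<And>n. nrm (upow h \<gamma> n) \<le> D * s ^ n"
  shows "\<exists>v\<in>carrier B. z \<odot> v = h \<otimes> v \<oplus> (1 / z) \<odot> h \<and> v \<otimes> h = h \<otimes> v"
proof -
  define R where "R = norm (z + \<gamma>)"
  have R: "0 < R" "s < R" using s by (auto simp: R_def)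
  have zg: "z + \<gamma> \<noteq> 0" using R by (auto simp: R_def)
  define F where "F = nsum h \<gamma> z"
  have F: "F n \<in> carrier B" for n using h by (simp add: F_def)
  have D0: "0 \<le> D" using D[of 0] nrm_eq_0[of \<zero>] by simp
  have "nrm (F (Suc n) \<ominus> F n) \<le> D / R * (s / R) ^ n" for n
  proof -
    let ?x = "(1 / (z + \<gamma>) ^ Suc n) \<odot> upow h \<gamma> n"
    have "F (Suc n) \<ominus> F n = (?x \<oplus> F n) \<oplus> \<ominus> F n" using h F[of n] by (simp add: F_def a_minus_def a_comm)
    also have "\<dots> = ?x \<oplus> (F n \<oplus> \<ominus> F n)" using h F[of n] by (intro a_assoc) auto
    also have "\<dots> = ?x" using h F[of n] by (simp add: r_neg)
    finally have "nrm (F (Suc n) \<ominus> F n) = nrm (upow h \<gamma> n) / R ^ Suc n"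
      using h by (simp add: nrm_scale norm_divide norm_mult norm_power R_def)
    also have "\<dots> \<le> D * s ^ n / R ^ Suc n" using D R by (intro divide_right_mono) auto
    finally show ?thesis by (simp add: power_divide)
  qed
  then obtain v where v: "v \<in> carrier B" "(\<lambda>n. nrm (F n \<ominus> v)) \<longlonglongrightarrow> 0"
    using geometric_convergence[of F "D / R" "s / R"] F R s by auto
  obtain C where C: "C > 0" "\<And>x y. x \<in> carrier B \<Longrightarrow> y \<in> carrier B \<Longrightarrow> nrm (x \<otimes> y) \<le> C * nrm x * nrm y"
    using nrm_mult_bound by blast
  have eqI: "x = y" if x: "x \<in> carrier B" and y: "y \<in> carrier B" and b: "\<And>n. nrm (x \<ominus> y) \<le> b n" "b \<longlonglongrightarrow> 0" for x y and b :: "nat \<Rightarrow> real"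
  proof -
    have "nrm (x \<ominus> y) \<le> 0" using b by (intro LIMSEQ_le_const[OF b(2)]) auto
    then have "nrm (x \<ominus> y) = 0" using x y by (intro antisym nrm_nonneg) auto
    then have "x \<ominus> y = \<zero>" using x y by (simp add: nrm_eq_0)
    moreover have "(x \<ominus> y) \<oplus> y = x" using x y by (simp add: a_minus_def a_assoc l_neg)
    ultimately show ?thesis using y by simp
  qed
  define e where "e n = F n \<ominus> v" for n
  have e: "e n \<in> carrier B" "F n = v \<oplus> e n" for n
  proof -
    show "e n \<in> carrier B" using F v by (simp add: e_def)
    have "v \<oplus> e n = F n \<oplus> (v \<oplus> \<ominus> v)" using F[of n] v by (simp add: e_def a_minus_def a_ac)
    then show "F n = v \<oplus> e n" using F[of n] v by (simp add: r_neg)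
  qed
  have e0: "(\<lambda>n. nrm (e n)) \<longlonglongrightarrow> 0" using v(2) by (simp add: e_def)
  have "v \<otimes> h = h \<otimes> v"
  proof (rule eqI)
    show "v \<otimes> h \<in> carrier B" "h \<otimes> v \<in> carrier B" using v h by auto
    show "(\<lambda>n. 2 * C * nrm h * nrm (e n)) \<longlonglongrightarrow> 0" using tendsto_mult_left[OF e0, of "2 * C * nrm h"] by simp
    fix n
    have "v \<otimes> h \<oplus> e n \<otimes> h = h \<otimes> v \<oplus> h \<otimes> e n"
      using nsum_commute[OF h, of \<gamma> z n] e[of n] v h by (simp add: F_def[symmetric] distrib_left distrib_right)
    then have "(v \<otimes> h \<oplus> e n \<otimes> h) \<oplus> (\<ominus> (h \<otimes> v) \<oplus> \<ominus> (e n \<otimes> h)) = (h \<otimes> v \<oplus> h \<otimes> e n) \<oplus> (\<ominus> (h \<otimes> v) \<oplus> \<ominus> (e n \<otimes> h))"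
      by simp
    then have "v \<otimes> h \<ominus> h \<otimes> v = h \<otimes> e n \<ominus> e n \<otimes> h"
    proof -
      have abel: "(p \<oplus> q) \<oplus> (\<ominus> x \<oplus> \<ominus> q) = p \<ominus> x" "(x \<oplus> q) \<oplus> (\<ominus> x \<oplus> \<ominus> y) = q \<ominus> y"
        if "p \<in> carrier B" "q \<in> carrier B" "x \<in> carrier B" "y \<in> carrier B" for p q x y
      proof -
        have "(p \<oplus> q) \<oplus> (\<ominus> x \<oplus> \<ominus> q) = (p \<oplus> \<ominus> x) \<oplus> (q \<oplus> \<ominus> q)" using that by (simp add: a_ac)
        then show "(p \<oplus> q) \<oplus> (\<ominus> x \<oplus> \<ominus> q) = p \<ominus> x" using that by (simp add: r_neg a_minus_def)
        have "(x \<oplus> q) \<oplus> (\<ominus> x \<oplus> \<ominus> y) = (q \<oplus> \<ominus> y) \<oplus> (x \<oplus> \<ominus> x)" using that by (simp add: a_ac)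
        then show "(x \<oplus> q) \<oplus> (\<ominus> x \<oplus> \<ominus> y) = q \<ominus> y" using that by (simp add: r_neg a_minus_def)
      qed
      show ?thesis
        using \<open>(v \<otimes> h \<oplus> e n \<otimes> h) \<oplus> _ = _\<close> abel(1)[of "v \<otimes> h" "e n \<otimes> h" "h \<otimes> v"]
          abel(2)[of "h \<otimes> v" "h \<otimes> e n" "h \<otimes> v" "e n \<otimes> h"] v h e(1)[of n] by simp
    qed
    then have "nrm (v \<otimes> h \<ominus> h \<otimes> v) \<le> nrm (h \<otimes> e n) + nrm (e n \<otimes> h)"
      using nrm_add[of "h \<otimes> e n" "(- 1) \<odot> (e n \<otimes> h)"] e(1)[of n] h by (simp add: diff_eq nrm_scale)
    also have "\<dots> \<le> C * nrm h * nrm (e n) + C * nrm (e n) * nrm h" using C(2) h e(1)[of n] by (intro add_mono) auto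
    finally show "nrm (v \<otimes> h \<ominus> h \<otimes> v) \<le> 2 * C * nrm h * nrm (e n)" by (simp add: mult_ac)
  qed
  moreover have "z \<odot> v = h \<otimes> v \<oplus> (1 / z) \<odot> h"
  proof (rule eqI)
    define \<sigma> where "\<sigma> n = (\<Sum>i<n. \<gamma> ^ i / (z + \<gamma>) ^ Suc i)" for n
    have \<sigma>: "\<sigma> \<longlonglongrightarrow> 1 / z"
    proof -
      have lt: "norm (\<gamma> / (z + \<gamma>)) < 1" using s(1) R by (simp add: norm_divide R_def)
      have "(\<lambda>i. (1 / (z + \<gamma>)) * (\<gamma> / (z + \<gamma>)) ^ i) sums ((1 / (z + \<gamma>)) * (1 / (1 - \<gamma> / (z + \<gamma>))))"
        by (intro sums_mult geometric_sums lt)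
      moreover have "(1 / (z + \<gamma>)) * (1 / (1 - \<gamma> / (z + \<gamma>))) = 1 / z"
        using zg z by (simp add: divide_simps)
      moreover have "(1 / (z + \<gamma>)) * (\<gamma> / (z + \<gamma>)) ^ i = \<gamma> ^ i / (z + \<gamma>) ^ Suc i" for i
        by (simp add: power_divide)
      ultimately show ?thesis by (simp add: sums_def \<sigma>_def[abs_def])
    qed
    let ?b = "\<lambda>n. norm z * nrm (e n) + D * (s / R) ^ n + C * nrm h * nrm (e n) + norm (\<sigma> n - 1 / z) * nrm h"
    show "z \<odot> v \<in> carrier B" "h \<otimes> v \<oplus> (1 / z) \<odot> h \<in> carrier B" using v h by auto
    show "?b \<longlonglongrightarrow> 0"
    proof -
      have A: "(\<lambda>n. norm (\<sigma> n - 1 / z)) \<longlonglongrightarrow> 0" using \<sigma> by (simp add: LIM_zero tendsto_norm_zero)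
      have Q: "(\<lambda>n. (s / R) ^ n) \<longlonglongrightarrow> 0" using s R by (intro LIMSEQ_realpow_zero) auto
      have "?b \<longlonglongrightarrow> norm z * 0 + D * 0 + C * nrm h * 0 + 0 * nrm h"
        by (intro tendsto_add tendsto_mult tendsto_const e0 A Q)
      then show ?thesis by simp
    qed
    fix n
    define T where "T = (1 / (z + \<gamma>) ^ n) \<odot> upow h \<gamma> n"
    have T: "T \<in> carrier B" using h by (simp add: T_def)
    have nT: "nrm T \<le> D * (s / R) ^ n"
      using D[of n] h R by (simp add: T_def nrm_scale norm_divide norm_power R_def[symmetric] power_divide divide_right_mono)
    define he where "he = h \<otimes> e n"
    define hv where "hv = h \<otimes> v"
    have cl: "he \<in> carrier B" "hv \<in> carrier B" using h v e by (auto simp: he_def hv_def)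
    have "z \<odot> v \<oplus> z \<odot> e n \<oplus> T = hv \<oplus> he \<oplus> \<sigma> n \<odot> h"
      using nsum_telescope[OF h zg, of n] e[of n] v h
      by (simp add: F_def[symmetric] T_def \<sigma>_def he_def hv_def scale_add_right distrib_left)
    also have "\<sigma> n \<odot> h = (1 / z) \<odot> h \<oplus> (\<sigma> n - 1 / z) \<odot> h"
      using h by (simp add: scale_add_left[symmetric])
    finally have main: "z \<odot> v \<oplus> z \<odot> e n \<oplus> T = hv \<oplus> he \<oplus> ((1 / z) \<odot> h \<oplus> (\<sigma> n - 1 / z) \<odot> h)" .
    have abel: "p \<ominus> (a \<oplus> k) = ((b \<oplus> m) \<ominus> q) \<ominus> t"
      if cl: "p \<in> carrier B" "q \<in> carrier B" "t \<in> carrier B" "a \<in> carrier B" "b \<in> carrier B" "k \<in> carrier B" "m \<in> carrier B"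
        and eq: "p \<oplus> q \<oplus> t = a \<oplus> b \<oplus> (k \<oplus> m)" for p q t a b k m
    proof -
      let ?w = "\<ominus> q \<oplus> \<ominus> t \<oplus> \<ominus> (a \<oplus> k)"
      have wc: "?w \<in> carrier B" using cl by auto
      have "(p \<oplus> q \<oplus> t) \<oplus> ?w = (p \<oplus> \<ominus> (a \<oplus> k)) \<oplus> ((q \<oplus> \<ominus> q) \<oplus> (t \<oplus> \<ominus> t))"
        using cl by (simp only: a_ac a_closed a_inv_closed)
      then have L: "(p \<oplus> q \<oplus> t) \<oplus> ?w = p \<ominus> (a \<oplus> k)" using cl by (simp add: r_neg a_minus_def)
      have "(a \<oplus> b \<oplus> (k \<oplus> m)) \<oplus> ?w = (((b \<oplus> m) \<oplus> \<ominus> q) \<oplus> \<ominus> t) \<oplus> ((a \<oplus> k) \<oplus> \<ominus> (a \<oplus> k))"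
        using cl by (simp only: a_ac a_closed a_inv_closed)
      then have "(a \<oplus> b \<oplus> (k \<oplus> m)) \<oplus> ?w = ((b \<oplus> m) \<ominus> q) \<ominus> t" using cl by (simp add: r_neg a_minus_def)
      with L eq show ?thesis by simp
    qed
    have E: "z \<odot> v \<ominus> (hv \<oplus> (1 / z) \<odot> h) = ((he \<oplus> (\<sigma> n - 1 / z) \<odot> h) \<ominus> z \<odot> e n) \<ominus> T"
      by (rule abel[OF _ _ _ _ _ _ _ main]) (use cl T e h v in auto)
    have sub: "nrm (x \<ominus> y) \<le> nrm x + nrm y" if "x \<in> carrier B" "y \<in> carrier B" for x y
      using nrm_add[of x "(- 1) \<odot> y"] that by (simp add: diff_eq nrm_scale)
    have "nrm (((he \<oplus> (\<sigma> n - 1 / z) \<odot> h) \<ominus> z \<odot> e n) \<ominus> T) \<le> nrm ((he \<oplus> (\<sigma> n - 1 / z) \<odot> h) \<ominus> z \<odot> e n) + nrm T"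
      by (rule sub) (use cl T e h in auto)
    moreover have "nrm ((he \<oplus> (\<sigma> n - 1 / z) \<odot> h) \<ominus> z \<odot> e n) \<le> nrm (he \<oplus> (\<sigma> n - 1 / z) \<odot> h) + nrm (z \<odot> e n)"
      by (rule sub) (use cl T e h in auto)
    moreover have "nrm (he \<oplus> (\<sigma> n - 1 / z) \<odot> h) \<le> nrm he + nrm ((\<sigma> n - 1 / z) \<odot> h)"
      by (rule nrm_add) (use cl h in auto)
    ultimately have "nrm (z \<odot> v \<ominus> (hv \<oplus> (1 / z) \<odot> h)) \<le> ((nrm he + nrm ((\<sigma> n - 1 / z) \<odot> h)) + nrm (z \<odot> e n)) + nrm T"
      unfolding E by linarith
    also have "\<dots> \<le> ((C * nrm h * nrm (e n) + norm (\<sigma> n - 1 / z) * nrm h) + norm z * nrm (e n)) + D * (s / R) ^ n"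
      using nT C(2)[OF h e(1)[of n]] e(1)[of n] h by (simp add: nrm_scale he_def)
    finally show "nrm (z \<odot> v \<ominus> (h \<otimes> v \<oplus> (1 / z) \<odot> h)) \<le> ?b n" by (simp add: hv_def)
  qed
  ultimately show ?thesis using v(1) by blast
qed

end

context banach_star_alg
begin

lemma resolvent_cancel:
  assumes "h \<in> carrier B" "v \<in> carrier B" "z \<noteq> 0" and eq: "z \<odot> v = h \<otimes> v \<oplus> (1 / z) \<odot> h"
  shows "z \<odot> v \<oplus> ((- (1 / z)) \<odot> h \<oplus> (- 1) \<odot> (h \<otimes> v)) = \<zero>"
proof -
  have "z \<odot> v \<oplus> ((- (1 / z)) \<odot> h \<oplus> (- 1) \<odot> (h \<otimes> v)) =
      (1 \<odot> (h \<otimes> v) \<oplus> (- 1) \<odot> (h \<otimes> v)) \<oplus> ((1 / z) \<odot> h \<oplus> (- (1 / z)) \<odot> h)"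
    unfolding eq using assms(1,2) by (simp add: a_ac)
  also have "\<dots> = \<zero>"
    using assms(1,2) by (simp add: scale_add_left[symmetric] del: scale_one)
  finally show ?thesis .
qed

lemma unit_of_resolvent:
  assumes m: "Group.monoid B" and h: "h \<in> carrier B" and v: "v \<in> carrier B" and z: "z \<noteq> 0"
    and eq: "z \<odot> v = h \<otimes> v \<oplus> (1 / z) \<odot> h" and comm: "v \<otimes> h = h \<otimes> v"
  shows "(z \<odot> \<one>) \<ominus> h \<in> Units B"
proof -
  have one: "\<one> \<in> carrier B" "\<And>x. x \<in> carrier B \<Longrightarrow> \<one> \<otimes> x = x" "\<And>x. x \<in> carrier B \<Longrightarrow> x \<otimes> \<one> = x"
    using m by (simp_all add: Group.monoid.one_closed Group.monoid.l_one Group.monoid.r_one)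
  let ?y = "(1 / z) \<odot> \<one> \<oplus> v"
  have d: "(z \<odot> \<one>) \<ominus> h = z \<odot> \<one> \<oplus> (- 1) \<odot> h" using h one by (simp add: diff_eq)
  have "((z \<odot> \<one>) \<ominus> h) \<otimes> ?y = \<one> \<oplus> (z \<odot> v \<oplus> ((- (1 / z)) \<odot> h \<oplus> (- 1) \<odot> (h \<otimes> v)))"
    unfolding d using h v one z by (simp add: distrib_left distrib_right scale_add_right a_ac)
  then have 1: "((z \<odot> \<one>) \<ominus> h) \<otimes> ?y = \<one>" using resolvent_cancel[OF h v z eq] one by simp
  have "?y \<otimes> ((z \<odot> \<one>) \<ominus> h) = \<one> \<oplus> (z \<odot> v \<oplus> ((- (1 / z)) \<odot> h \<oplus> (- 1) \<odot> (h \<otimes> v)))"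
    unfolding d using h v one z by (simp add: distrib_left distrib_right scale_add_right a_ac comm)
  then have 2: "?y \<otimes> ((z \<odot> \<one>) \<ominus> h) = \<one>" using resolvent_cancel[OF h v z eq] one by simp
  show ?thesis unfolding Units_def using 1 2 h v one by (auto intro!: bexI[of _ ?y])
qed

lemma unitization_simps:
  "carrier (unitization B) = UNIV \<times> carrier B"
  "(c, x) \<otimes>\<^bsub>unitization B\<^esub> (e, y) = (c * e, ((c \<odot> y) \<oplus> (e \<odot> x)) \<oplus> (x \<otimes> y))"
  "\<one>\<^bsub>unitization B\<^esub> = (1, \<zero>)" "\<zero>\<^bsub>unitization B\<^esub> = (0, \<zero>)"
  "(c, x) \<oplus>\<^bsub>unitization B\<^esub> (e, y) = (c + e, x \<oplus> y)"
  "a \<odot>\<^bsub>unitization B\<^esub> (c, x) = (a * c, a \<odot> x)"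
  by (simp_all add: unitization_def)

lemma abelian_group_unitization: "abelian_group (unitization B)"
proof (rule abelian_groupI)
  fix p assume p: "p \<in> carrier (unitization B)"
  obtain c x where cx: "p = (c, x)" "x \<in> carrier B" using p by (auto simp: unitization_simps)
  then show "\<exists>q\<in>carrier (unitization B). q \<oplus>\<^bsub>unitization B\<^esub> p = \<zero>\<^bsub>unitization B\<^esub>"
    by (intro bexI[of _ "(- c, \<ominus> x)"]) (auto simp: unitization_simps l_neg)
qed (auto simp: unitization_simps a_ac)

lemma unitization_unit_of_resolvent:
  assumes h: "h \<in> carrier B" and v: "v \<in> carrier B" and z: "z \<noteq> 0"
    and eq: "z \<odot> v = h \<otimes> v \<oplus> (1 / z) \<odot> h" and comm: "v \<otimes> h = h \<otimes> v"
  shows "(z \<odot>\<^bsub>unitization B\<^esub> \<one>\<^bsub>unitization B\<^esub>) \<ominus>\<^bsub>unitization B\<^esub> (0, h) \<in> Units (unitization B)"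
proof -
  interpret u: abelian_group "unitization B" by (rule abelian_group_unitization)
  have "\<ominus>\<^bsub>unitization B\<^esub> (0, h) = (0, (- 1) \<odot> h)"
  proof (rule u.minus_equality)
    show "(0, (- 1) \<odot> h) \<oplus>\<^bsub>unitization B\<^esub> (0, h) = \<zero>\<^bsub>unitization B\<^esub>"
      using h by (simp add: unitization_simps minus_eq_scale[symmetric] l_neg)
  qed (use h in \<open>auto simp: unitization_simps\<close>)
  then have d: "(z \<odot>\<^bsub>unitization B\<^esub> \<one>\<^bsub>unitization B\<^esub>) \<ominus>\<^bsub>unitization B\<^esub> (0, h) = (z, (- 1) \<odot> h)"
    using h by (simp add: a_minus_def unitization_simps)
  let ?y = "(1 / z, v)"
  have "(z, (- 1) \<odot> h) \<otimes>\<^bsub>unitization B\<^esub> ?y = (1, z \<odot> v \<oplus> ((- (1 / z)) \<odot> h \<oplus> (- 1) \<odot> (h \<otimes> v)))"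
    using h v z by (simp add: unitization_simps a_ac)
  then have 1: "(z, (- 1) \<odot> h) \<otimes>\<^bsub>unitization B\<^esub> ?y = \<one>\<^bsub>unitization B\<^esub>"
    using resolvent_cancel[OF h v z eq] by (simp add: unitization_simps)
  have "?y \<otimes>\<^bsub>unitization B\<^esub> (z, (- 1) \<odot> h) = (1, z \<odot> v \<oplus> ((- (1 / z)) \<odot> h \<oplus> (- 1) \<odot> (h \<otimes> v)))"
    using h v z by (simp add: unitization_simps a_ac comm)
  then have 2: "?y \<otimes>\<^bsub>unitization B\<^esub> (z, (- 1) \<odot> h) = \<one>\<^bsub>unitization B\<^esub>"
    using resolvent_cancel[OF h v z eq] by (simp add: unitization_simps)
  show ?thesis unfolding d Units_def using 1 2 h v by (auto simp: unitization_simps(1) intro!: bexI[of _ ?y])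
qed

lemma not_in_spectrum:
  assumes h: "h \<in> carrier B" and v: "v \<in> carrier B" and z: "z \<noteq> 0"
    and eq: "z \<odot> v = h \<otimes> v \<oplus> (1 / z) \<odot> h" and comm: "v \<otimes> h = h \<otimes> v"
  shows "z \<notin> spectrum B h"
  using unit_of_resolvent[OF _ h v z eq comm] unitization_unit_of_resolvent[OF h v z eq comm]
  by (auto simp: spectrum_def unital_spectrum_def)

end

text \<open>The model is an algebra of integrable functions with \<open>n1\<close> the \<open>L\<^sup>1\<close> norm and \<open>n2\<close> the \<open>L\<^sup>2\<close> norm on the left ideal \<open>I\<close> of
  square integrable elements. The rule \<open>contraction\<close> is the only trace of the Hilbert space: \<open>a\<^sup>* \<otimes> a\<close> acts
  positively on it, so that adding a scalar of suitable nonpositive real part gives an operator no larger than this scalar.\<close>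

locale spectral_control = banach_star_alg +
  fixes n1 n2 :: "'a \<Rightarrow> real" and I :: "'a set" and C K E \<delta> :: real and d :: nat
  assumes constants: "0 \<le> C" "0 \<le> K" "0 \<le> E" "0 < \<delta>"
    and n1_nonneg: "x \<in> carrier B \<Longrightarrow> 0 \<le> n1 x"
    and n1_add: "x \<in> carrier B \<Longrightarrow> y \<in> carrier B \<Longrightarrow> n1 (x \<oplus> y) \<le> n1 x + n1 y"
    and n1_scale: "x \<in> carrier B \<Longrightarrow> n1 (c \<odot> x) = norm c * n1 x"
    and n1_mult: "x \<in> carrier B \<Longrightarrow> y \<in> carrier B \<Longrightarrow> n1 (x \<otimes> y) \<le> n1 x * n1 y"
    and nrm_mult: "x \<in> carrier B \<Longrightarrow> y \<in> carrier B \<Longrightarrow> nrm (x \<otimes> y) \<le> C * (nrm x * n1 y + n1 x * nrm y)"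
    and I_carrier: "b \<in> I \<Longrightarrow> b \<in> carrier B"
    and I_add: "b \<in> I \<Longrightarrow> b' \<in> I \<Longrightarrow> b \<oplus> b' \<in> I"
    and I_scale: "b \<in> I \<Longrightarrow> c \<odot> b \<in> I"
    and I_mult: "x \<in> carrier B \<Longrightarrow> b \<in> I \<Longrightarrow> x \<otimes> b \<in> I"
    and n2_nonneg: "b \<in> I \<Longrightarrow> 0 \<le> n2 b"
    and interpolation: "b \<in> I \<Longrightarrow> k \<ge> 1 \<Longrightarrow> n1 b \<le> E * real k ^ d * n2 b + K * real k powr (- \<delta>) * nrm b"
    and dense: "x \<in> carrier B \<Longrightarrow> 0 < \<epsilon> \<Longrightarrow> \<exists>b\<in>I. n1 (x \<ominus> b) < \<epsilon>"
    and contraction: "x \<in> carrier B \<Longrightarrow> \<exists>m\<le>0. \<forall>\<gamma>. Re \<gamma> = m \<longrightarrow>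
      (\<forall>b\<in>I. n2 ((invol B x \<otimes> x) \<otimes> b \<oplus> \<gamma> \<odot> b) \<le> norm \<gamma> * n2 b)"
begin

text \<open>An instance of \<open>growth_rate\<close>. Doubling comes from \<open>nrm_mult\<close>. For the one-step inequality, \<open>h\<close> is split
  as \<open>b \<oplus> e\<close> with \<open>b \<in> I\<close> and \<open>n1 e < \<epsilon>\<close>: on \<open>b\<close> the powers contract in \<open>n2\<close> and \<open>interpolation\<close> brings this back to \<open>n1\<close>, while
  \<open>e\<close> costs only a factor \<open>\<epsilon>\<close>.\<close>

lemma upow_growth:
  assumes h: "h \<in> carrier B" and \<gamma>: "\<And>b. b \<in> I \<Longrightarrow> n2 (h \<otimes> b \<oplus> \<gamma> \<odot> b) \<le> norm \<gamma> * n2 b"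
    and s0: "norm \<gamma> < s0"
  shows "\<exists>D. \<forall>n. nrm (upow h \<gamma> n) \<le> D * s0 ^ n"
proof -
  obtain C0 where C0: "C0 > 0" "\<And>x y. x \<in> carrier B \<Longrightarrow> y \<in> carrier B \<Longrightarrow> nrm (x \<otimes> y) \<le> C0 * nrm x * nrm y"
    using nrm_mult_bound by blast
  define g where "g = norm \<gamma>"
  define w where "w = upow h \<gamma>"
  define W where "W n = nrm (w n)" for n
  define V where "V n = n1 (w n)" for n
  have w[simp]: "w n \<in> carrier B" for n using h by (simp add: w_def)
  have nn: "0 \<le> W n" "0 \<le> V n" "0 \<le> g ^ n" for n by (simp_all add: W_def V_def g_def n1_nonneg)
  have act_nrm: "nrm (act h \<gamma> n y) \<le> g ^ n * nrm y + nrm (w n \<otimes> y)" if "y \<in> carrier B" for n y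
    unfolding act_def w_def[symmetric] using nrm_add[of "\<gamma> ^ n \<odot> y" "w n \<otimes> y"] that
    by (simp add: nrm_scale norm_power g_def)
  have act_n1: "n1 (act h \<gamma> n y) \<le> (g ^ n + V n) * n1 y" if y: "y \<in> carrier B" for n y
  proof -
    have "n1 (act h \<gamma> n y) \<le> g ^ n * n1 y + n1 (w n \<otimes> y)"
      unfolding act_def w_def[symmetric] using n1_add[of "\<gamma> ^ n \<odot> y" "w n \<otimes> y"] that
      by (simp add: n1_scale norm_power g_def)
    also have "n1 (w n \<otimes> y) \<le> V n * n1 y" using n1_mult[of "w n" y] y by (simp add: V_def)
    finally show ?thesis by (simp add: algebra_simps)
  qed
  have act_I: "act h \<gamma> n b \<in> I \<and> n2 (act h \<gamma> n b) \<le> g ^ n * n2 b" if b: "b \<in> I" for n b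
  proof (induction n)
    case 0
    then show ?case using b I_carrier[OF b] by (simp add: act_0)
  next
    case (Suc n)
    let ?y = "act h \<gamma> n b"
    have eq: "act h \<gamma> (Suc n) b = h \<otimes> ?y \<oplus> \<gamma> \<odot> ?y" by (rule act_Suc[OF h I_carrier[OF b]])
    have "act h \<gamma> (Suc n) b \<in> I" unfolding eq using Suc h by (intro I_add I_mult I_scale) auto
    moreover have "n2 (act h \<gamma> (Suc n) b) \<le> g * n2 ?y" unfolding eq g_def using Suc by (intro \<gamma>) auto
    moreover have "g * n2 ?y \<le> g * (g ^ n * n2 b)" using Suc by (intro mult_left_mono) (auto simp: g_def)
    ultimately show ?case by simp
  qed
  have w_add: "W (m + n) \<le> nrm (act h \<gamma> m (w n)) + g ^ n * W m" for m n
    unfolding W_def w_def upow_add[OF h, of \<gamma> m n]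
    using nrm_add[of "act h \<gamma> m (upow h \<gamma> n)" "\<gamma> ^ n \<odot> upow h \<gamma> m"] h
    by (simp add: nrm_scale norm_power g_def)
  define CC where "CC = 2 + 2 * C + C0"
  have CC: "0 \<le> CC" using constants C0 by (simp add: CC_def)
  have "\<exists>D. \<forall>n. g ^ n + W n \<le> D * s0 ^ n"
  proof (rule growth_rate[where u="\<lambda>n. g ^ n + V n" and g=g and \<delta>=\<delta> and C=CC and d=d])
    show "0 \<le> g ^ n + W n" "0 \<le> g ^ n + V n" for n using nn by simp_all
    show "0 \<le> g" "0 < \<delta>" "0 \<le> CC" "g < s0" using constants CC s0 by (simp_all add: g_def)
    fix m n
    show "g ^ (m + n) + W (m + n) \<le> CC * (g ^ m + W m) * (g ^ n + W n)"
    proof -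
      have "W (m + n) \<le> g ^ m * W n + C0 * W m * W n + g ^ n * W m"
        using w_add[of m n] act_nrm[of "w n" m] C0(2)[of "w m" "w n"] by (simp add: W_def)
      then have "g ^ (m + n) + W (m + n) \<le> g ^ m * g ^ n + (g ^ m * W n + C0 * (W m * W n) + g ^ n * W m)"
        by (simp add: power_add mult.assoc)
      also have "\<dots> \<le> CC * (g ^ m * g ^ n) + (CC * (g ^ m * W n) + CC * (W m * W n) + CC * (g ^ n * W m))"
      proof -
        have le: "x \<le> CC * x" "C0 * x \<le> CC * x" if "0 \<le> x" for x
          using mult_right_mono[of 1 CC x] mult_right_mono[of C0 CC x] that constants C0(1) by (auto simp: CC_def)
        show ?thesis using nn by (intro add_mono le mult_nonneg_nonneg) auto
      qed
      also have "\<dots> = CC * (g ^ m + W m) * (g ^ n + W n)" by (simp add: algebra_simps)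
      finally show ?thesis .
    qed
  next
    fix n
    show "g ^ (n + n) + W (n + n) \<le> CC * (g ^ n + W n) * (g ^ n + V n)"
    proof -
      have "nrm (w n \<otimes> w n) \<le> C * (W n * V n + V n * W n)" using nrm_mult[of "w n" "w n"] by (simp add: W_def V_def)
      then have "W (n + n) \<le> g ^ n * W n + 2 * C * (W n * V n) + g ^ n * W n"
        using w_add[of n n] act_nrm[of "w n" n] by (simp add: W_def algebra_simps)
      then have "g ^ (n + n) + W (n + n) \<le> g ^ n * g ^ n + 2 * (g ^ n * W n) + (2 * C) * (W n * V n)"
        by (simp add: power_add mult_ac)
      also have "\<dots> \<le> CC * (g ^ n * g ^ n) + CC * (g ^ n * W n) + CC * (W n * V n) + CC * (g ^ n * V n)"
      proof -
        have le: "x \<le> CC * x" "2 * x \<le> CC * x" "(2 * C) * x \<le> CC * x" "0 \<le> CC * x" if "0 \<le> x" for x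
          using mult_right_mono[of 1 CC x] mult_right_mono[of 2 CC x] mult_right_mono[of "2 * C" CC x] that constants C0(1) CC
          by (auto simp: CC_def)
        have p: "0 \<le> g ^ n * g ^ n" "0 \<le> g ^ n * W n" "0 \<le> W n * V n" "0 \<le> g ^ n * V n" using nn by simp_all
        show ?thesis using le(1)[OF p(1)] le(2)[OF p(2)] le(3)[OF p(3)] le(4)[OF p(4)] by linarith
      qed
      also have "\<dots> = CC * (g ^ n + W n) * (g ^ n + V n)" by (simp add: algebra_simps)
      finally show ?thesis .
    qed
  next
    fix \<epsilon> :: real assume \<epsilon>: "0 < \<epsilon>"
    obtain b where b: "b \<in> I" "n1 (h \<ominus> b) < \<epsilon>" using dense[OF h \<epsilon>] by blast
    have bc: "b \<in> carrier B" by (rule I_carrier[OF b(1)])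
    define e where "e = h \<ominus> b"
    have e: "e \<in> carrier B" "h = b \<oplus> e"
    proof -
      show "e \<in> carrier B" using h bc by (simp add: e_def)
      have "b \<oplus> e = h \<oplus> (b \<oplus> \<ominus> b)" using h bc by (simp add: e_def a_minus_def a_ac)
      then show "h = b \<oplus> e" using h bc by (simp add: r_neg)
    qed
    define K' where "K' = E * n2 b + K * ((1 + C0) * nrm b)"
    have K': "0 \<le> K'" using constants n2_nonneg[OF b(1)] C0(1) bc by (simp add: K'_def)
    have "g ^ Suc n + V (Suc n) \<le> (g + \<epsilon>) * (g ^ n + V n) + K' * (real k ^ d * g ^ n + real k powr (- \<delta>) * (g ^ n + W n))"
      if k: "k \<ge> 1" for n k
    proof -
      let ?P = "real k ^ d * g ^ n" and ?Q = "real k powr (- \<delta>) * (g ^ n + W n)"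
      have PQ: "0 \<le> ?P" "0 \<le> ?Q" using nn by simp_all
      have split: "act h \<gamma> n h = act h \<gamma> n b \<oplus> act h \<gamma> n e"
        using h bc e(1) e(2) by (subst (2) e(2)) (simp add: act_def distrib_left scale_add_right a_ac)
      have "V (Suc n) \<le> n1 (act h \<gamma> n h) + g * V n"
        unfolding V_def w_def upow_Suc_act[OF h, of \<gamma> n]
        using n1_add[of "act h \<gamma> n h" "\<gamma> \<odot> upow h \<gamma> n"] h by (simp add: n1_scale g_def)
      also have "n1 (act h \<gamma> n h) \<le> n1 (act h \<gamma> n b) + n1 (act h \<gamma> n e)"
        unfolding split using h bc e(1) by (intro n1_add) auto
      finally have V1: "V (Suc n) \<le> n1 (act h \<gamma> n b) + n1 (act h \<gamma> n e) + g * V n" by simp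
      have e1: "n1 (act h \<gamma> n e) \<le> \<epsilon> * (g ^ n + V n)"
      proof -
        have "n1 (act h \<gamma> n e) \<le> (g ^ n + V n) * n1 e" by (rule act_n1[OF e(1)])
        also have "\<dots> \<le> (g ^ n + V n) * \<epsilon>" using b(2) nn by (intro mult_left_mono) (auto simp: e_def)
        finally show ?thesis by (simp add: mult.commute)
      qed
      have b1: "n1 (act h \<gamma> n b) \<le> K' * (?P + ?Q)"
      proof -
        have "nrm (act h \<gamma> n b) \<le> g ^ n * nrm b + C0 * W n * nrm b"
          using act_nrm[OF bc, of n] C0(2)[of "w n" b] bc by (simp add: W_def)
        also have "\<dots> \<le> (1 + C0) * nrm b * (g ^ n + W n)"
        proof -
          have "0 \<le> nrm b * W n + C0 * nrm b * g ^ n" using nn C0(1) bc by simp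
          then show ?thesis by (simp add: algebra_simps)
        qed
        finally have n: "nrm (act h \<gamma> n b) \<le> (1 + C0) * nrm b * (g ^ n + W n)" .
        have "n1 (act h \<gamma> n b) \<le> E * real k ^ d * n2 (act h \<gamma> n b) + K * real k powr (- \<delta>) * nrm (act h \<gamma> n b)"
          using act_I[OF b(1), of n] k by (intro interpolation) auto
        also have "\<dots> \<le> E * real k ^ d * (g ^ n * n2 b) + K * real k powr (- \<delta>) * ((1 + C0) * nrm b * (g ^ n + W n))"
          using act_I[OF b(1), of n] n constants by (intro add_mono mult_left_mono) auto
        also have "\<dots> = (E * n2 b) * ?P + (K * ((1 + C0) * nrm b)) * ?Q" by (simp add: algebra_simps)
        also have "\<dots> \<le> K' * ?P + K' * ?Q"
          using PQ constants n2_nonneg[OF b(1)] C0(1) bc by (intro add_mono mult_right_mono) (auto simp: K'_def)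
        finally show ?thesis by (simp add: ring_distribs)
      qed
      show ?thesis using V1 e1 b1 by (simp add: algebra_simps)
    qed
    then show "\<exists>K\<ge>0. \<forall>n. \<forall>k\<ge>1. g ^ Suc n + V (Suc n) \<le> (g + \<epsilon>) * (g ^ n + V n) +
        K * (real k ^ d * g ^ n + real k powr (- \<delta>) * (g ^ n + W n))"
      using K' by blast
  qed
  then obtain D where D: "\<And>n. g ^ n + W n \<le> D * s0 ^ n" by blast
  have "nrm (upow h \<gamma> n) \<le> D * s0 ^ n" for n using D[of n] nn(3)[of n] by (simp add: W_def w_def)
  then show ?thesis by blast
qed

text \<open>A point \<open>z\<close> outside \<open>[0, \<infinity>)\<close> is separated from the numerical range of the positive operator by a disk: for a
  suitable \<open>\<gamma>\<close> the powers of \<open>\<gamma> + h\<close> have rate at most \<open>norm \<gamma> < norm (z + \<gamma>)\<close>, and the Neumann series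
  converges.\<close>

theorem symmetric: "symmetric_star_algebra B"
  unfolding symmetric_star_algebra_def
proof (intro ballI subsetI)
  fix a z assume a: "a \<in> carrier B" and zs: "z \<in> spectrum B (invol B a \<otimes> a)"
  define h where "h = invol B a \<otimes> a"
  have h: "h \<in> carrier B" using a by (simp add: h_def)
  show "z \<in> complex_of_real ` {0..}"
  proof (rule ccontr)
    assume zn: "z \<notin> complex_of_real ` {0..}"
    have z0: "z \<noteq> 0" using zn by force
    have z_im: "Im z = 0 \<Longrightarrow> Re z < 0"
    proof (rule ccontr)
      assume "Im z = 0" "\<not> Re z < 0"
      then have "z = complex_of_real (Re z)" "Re z \<in> {0..}" by (auto simp: complex_eq_iff)
      then show False using zn by blast
    qed
    obtain m where m: "m \<le> 0" "\<And>\<gamma> b. Re \<gamma> = m \<Longrightarrow> b \<in> I \<Longrightarrow> n2 (h \<otimes> b \<oplus> \<gamma> \<odot> b) \<le> norm \<gamma> * n2 b"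
      using contraction[OF a] unfolding h_def by blast
    \<comment> \<open>chosen so that the excess \<open>(norm z)\<^sup>2 + 2 * (Re z * m + Im z * t)\<close> of \<open>(norm (z + \<gamma>))\<^sup>2\<close> over \<open>(norm \<gamma>)\<^sup>2\<close> is positive\<close>
    define t where "t = (if Im z = 0 then 0 else - (Re z * m) / Im z)"
    define \<gamma> where "\<gamma> = Complex m t"
    have q0: "0 \<le> Re z * m + Im z * t"
    proof (cases "Im z = 0")
      case True
      then show ?thesis using z_im[OF True] m(1) by (simp add: mult_nonpos_nonpos)
    qed (simp add: t_def)
    have q1: "(norm (z + \<gamma>))\<^sup>2 = (norm \<gamma>)\<^sup>2 + ((norm z)\<^sup>2 + 2 * (Re z * m + Im z * t))"
      by (simp add: cmod_power2 \<gamma>_def power2_sum algebra_simps)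
    have "0 < (norm z)\<^sup>2" using z0 by simp
    then have "(norm \<gamma>)\<^sup>2 < (norm (z + \<gamma>))\<^sup>2" unfolding q1 using q0 by (simp add: add_pos_nonneg del: zero_less_power2)
    then have lt: "norm \<gamma> < norm (z + \<gamma>)" by (rule power2_less_imp_less) simp
    define s where "s = (norm \<gamma> + norm (z + \<gamma>)) / 2"
    have s: "norm \<gamma> < s" "s < norm (z + \<gamma>)" using lt by (auto simp: s_def)
    then have s0: "0 \<le> s" using norm_ge_zero[of \<gamma>] by linarith
    have "Re \<gamma> = m" by (simp add: \<gamma>_def)
    then obtain D where D: "\<And>n. nrm (upow h \<gamma> n) \<le> D * s ^ n"
      using upow_growth[OF h m(2) s(1)] by blast
    obtain v where "v \<in> carrier B" "z \<odot> v = h \<otimes> v \<oplus> (1 / z) \<odot> h" "v \<otimes> h = h \<otimes> v"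
      using neumann_resolvent[OF h z0 lt s0 s(2) D] by blast
    then have "z \<notin> spectrum B h" by (intro not_in_spectrum[OF h _ z0])
    then show False using zs by (simp add: h_def)
  qed
qed

end

section \<open>The algebra of classes\<close>

context orlicz_group
begin

abbreviation OA :: "('a \<Rightarrow> complex) set star_algebra" where
  "OA \<equiv> orlicz_algebra M \<Phi> \<Psi> weight \<Omega>"

abbreviation cls :: "('a \<Rightarrow> complex) \<Rightarrow> ('a \<Rightarrow> complex) set" where
  "cls \<equiv> ae_class M"

lemma in_cls: "f \<in> borel_measurable borel \<Longrightarrow> g \<in> cls f \<longleftrightarrow> g \<in> borel_measurable borel \<and> (AE s in M. f s = g s)"
  by (simp add: ae_class_def ae_rel_def)

lemma cls_eq_iff:
  assumes "f \<in> borel_measurable borel" "g \<in> borel_measurable borel"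
  shows "cls f = cls g \<longleftrightarrow> (AE s in M. f s = g s)"
proof
  assume "cls f = cls g"
  moreover have "g \<in> cls g" using assms by (simp add: in_cls)
  ultimately show "AE s in M. f s = g s" using assms by (metis in_cls)
next
  assume eq: "AE s in M. f s = g s"
  have "h \<in> cls f \<longleftrightarrow> h \<in> cls g" for h
  proof -
    have "(AE s in M. f s = h s) \<longleftrightarrow> (AE s in M. g s = h s)"
    proof
      assume "AE s in M. f s = h s" with eq show "AE s in M. g s = h s" by eventually_elim simp
    next
      assume "AE s in M. g s = h s" with eq show "AE s in M. f s = h s" by eventually_elim simp
    qed
    then show ?thesis using assms by (simp add: in_cls)
  qed
  then show "cls f = cls g" by blast
qed

lemma cls_eqI:
  "f \<in> borel_measurable borel \<Longrightarrow> g \<in> borel_measurable borel \<Longrightarrow> AE s in M. f s = g s \<Longrightarrow> cls f = cls g"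
  by (simp add: cls_eq_iff)

lemma rep_cls:
  assumes "f \<in> borel_measurable borel"
  shows "rep (cls f) \<in> borel_measurable borel" "AE s in M. rep (cls f) s = f s"
proof -
  have "f \<in> cls f" using assms by (simp add: in_cls)
  then have "rep (cls f) \<in> cls f" unfolding rep_def by (rule someI[of "\<lambda>h. h \<in> cls f"])
  then have *: "rep (cls f) \<in> borel_measurable borel" "AE s in M. f s = rep (cls f) s" using assms by (simp_all add: in_cls)
  show "rep (cls f) \<in> borel_measurable borel" by (rule *(1))
  show "AE s in M. rep (cls f) s = f s" using *(2) by eventually_elim simp
qed

lemma carrier_OA: "carrier OA = cls ` A"
proof -
  have "A // ae_rel M = cls ` A"
    by (auto simp: quotient_def ae_class_def)
  then show ?thesis by (simp add: orlicz_algebra_def Let_def worlicz_space_eq)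
qed

lemma cls_carrier: "f \<in> A \<Longrightarrow> cls f \<in> carrier OA"
  by (simp add: carrier_OA)

lemma carrierE:
  assumes "F \<in> carrier OA"
  obtains f where "f \<in> A" "F = cls f"
  using assms by (auto simp: carrier_OA)

lemma A_add: "f \<in> A \<Longrightarrow> g \<in> A \<Longrightarrow> (\<lambda>s. f s + g s) \<in> A"
  using wnorm_add[of f g] by (auto simp: less_top[symmetric] top_unique)

lemma A_scale: "f \<in> A \<Longrightarrow> (\<lambda>s. c * f s) \<in> A"
  using wnorm_scale[of f c] by (auto simp: ennreal_mult_less_top)

lemma A_tinvol: "f \<in> A \<Longrightarrow> inv_t f \<in> A"
  using wnorm_tinvol[of f] tinvol_measurable[of f] by auto

lemma A_zero: "(\<lambda>_. 0) \<in> A"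
  using gauge_norm_cmult[of "\<lambda>_. 0" M \<Psi> 0] by (simp add: wnorm_def)

lemma A_borel: "f \<in> A \<Longrightarrow> f \<in> borel_measurable borel"
  by simp

lemma mult_cls: "f \<in> A \<Longrightarrow> g \<in> A \<Longrightarrow> cls f \<otimes>\<^bsub>OA\<^esub> cls g = cls (f \<circledast> g)"
  using tconv_cong_AE[of "rep (cls f)" f "rep (cls g)" g] rep_cls[of f] rep_cls[of g]
  by (simp add: orlicz_algebra_def Let_def tconv_class_def)

lemma add_cls: "f \<in> A \<Longrightarrow> g \<in> A \<Longrightarrow> cls f \<oplus>\<^bsub>OA\<^esub> cls g = cls (\<lambda>s. f s + g s)"
proof -
  assume "f \<in> A" "g \<in> A"
  then have m: "f \<in> borel_measurable borel" "g \<in> borel_measurable borel" by auto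
  have "AE s in M. rep (cls f) s + rep (cls g) s = f s + g s"
    using rep_cls(2)[OF m(1)] rep_cls(2)[OF m(2)] by eventually_elim simp
  then have "cls (\<lambda>s. rep (cls f) s + rep (cls g) s) = cls (\<lambda>s. f s + g s)"
    using m rep_cls(1)[OF m(1)] rep_cls(1)[OF m(2)] by (intro cls_eqI) auto
  then show ?thesis by (simp add: orlicz_algebra_def Let_def)
qed

lemma smult_cls: "f \<in> A \<Longrightarrow> c \<odot>\<^bsub>OA\<^esub> cls f = cls (\<lambda>s. c * f s)"
proof -
  assume "f \<in> A"
  then have m: "f \<in> borel_measurable borel" by auto
  have "AE s in M. c * rep (cls f) s = c * f s"
    using rep_cls(2)[OF m] by eventually_elim simp
  then have "cls (\<lambda>s. c * rep (cls f) s) = cls (\<lambda>s. c * f s)"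
    using m rep_cls(1)[OF m] by (intro cls_eqI) auto
  then show ?thesis by (simp add: orlicz_algebra_def Let_def)
qed

lemma invol_cls: "f \<in> A \<Longrightarrow> invol OA (cls f) = cls (inv_t f)"
proof -
  assume "f \<in> A"
  then have m: "f \<in> borel_measurable borel" by auto
  have "AE s in M. rep (cls f) (- s) = f (- s)"
    using AE_eq_reflect[OF rep_cls(1)[OF m] m rep_cls(2)[OF m], of 0] by simp
  then have "AE s in M. inv_t (rep (cls f)) s = inv_t f s"
    by eventually_elim (simp add: tinvol_def)
  then have "cls (inv_t (rep (cls f))) = cls (inv_t f)"
    using tinvol_measurable[OF m] tinvol_measurable[OF rep_cls(1)[OF m]] by (intro cls_eqI) auto
  then show ?thesis by (simp add: orlicz_algebra_def Let_def)
qed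

lemma vnorm_cls: "f \<in> A \<Longrightarrow> vnorm OA (cls f) = enn2real (wnorm f)"
  using wnorm_cong_AE[of "rep (cls f)" f] rep_cls(2)[of f]
  by (simp add: orlicz_algebra_def Let_def worlicz_norm_eq)

lemma zero_cls: "\<zero>\<^bsub>OA\<^esub> = cls (\<lambda>_. 0)"
  by (simp add: orlicz_algebra_def Let_def)

lemma ennreal_wnorm: "f \<in> A \<Longrightarrow> ennreal (enn2real (wnorm f)) = wnorm f"
  by simp

lemma abelian_group_OA: "abelian_group OA"
proof (rule abelian_groupI)
  fix x y assume "x \<in> carrier OA" "y \<in> carrier OA"
  then show "x \<oplus>\<^bsub>OA\<^esub> y \<in> carrier OA"
    by (elim carrierE) (simp only: add_cls, intro cls_carrier A_add)
next
  show "\<zero>\<^bsub>OA\<^esub> \<in> carrier OA" unfolding zero_cls by (intro cls_carrier A_zero)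
next
  fix x y z assume "x \<in> carrier OA" "y \<in> carrier OA" "z \<in> carrier OA"
  then show "x \<oplus>\<^bsub>OA\<^esub> y \<oplus>\<^bsub>OA\<^esub> z = x \<oplus>\<^bsub>OA\<^esub> (y \<oplus>\<^bsub>OA\<^esub> z)"
    by (elim carrierE) (simp only: add_cls A_add add.assoc)
next
  fix x y assume "x \<in> carrier OA" "y \<in> carrier OA"
  then show "x \<oplus>\<^bsub>OA\<^esub> y = y \<oplus>\<^bsub>OA\<^esub> x"
    by (elim carrierE) (simp only: add_cls add.commute)
next
  fix x assume "x \<in> carrier OA"
  then show "\<zero>\<^bsub>OA\<^esub> \<oplus>\<^bsub>OA\<^esub> x = x"
    by (elim carrierE) (simp only: zero_cls add_cls A_zero add_0)
next
  fix x assume "x \<in> carrier OA"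
  then obtain f where f: "f \<in> A" "x = cls f" by (rule carrierE)
  have "cls (\<lambda>s. (- 1) * f s) \<oplus>\<^bsub>OA\<^esub> x = \<zero>\<^bsub>OA\<^esub>"
    unfolding f(2) zero_cls by (subst add_cls[OF A_scale[OF f(1)] f(1)]) simp
  then show "\<exists>y\<in>carrier OA. y \<oplus>\<^bsub>OA\<^esub> x = \<zero>\<^bsub>OA\<^esub>"
    using cls_carrier[OF A_scale[OF f(1)]] by blast
qed

lemma module_OA: "Module.module (ring_of_type_algebra :: complex ring) OA"
proof (rule moduleI)
  show "cring (ring_of_type_algebra :: complex ring)" by (rule cring_from_type_algebra)
  show "abelian_group OA" by (rule abelian_group_OA)
  fix a b :: complex and x y
  assume x: "x \<in> carrier OA"
  show "a \<odot>\<^bsub>OA\<^esub> x \<in> carrier OA"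
    using x by (elim carrierE) (simp only: smult_cls, intro cls_carrier A_scale)
  show "(a \<oplus>\<^bsub>ring_of_type_algebra\<^esub> b) \<odot>\<^bsub>OA\<^esub> x = a \<odot>\<^bsub>OA\<^esub> x \<oplus>\<^bsub>OA\<^esub> b \<odot>\<^bsub>OA\<^esub> x"
    using x by (elim carrierE) (simp only: smult_cls add_cls A_scale ring_of_type_algebra_def ring.simps distrib_right)
  show "(a \<otimes>\<^bsub>ring_of_type_algebra\<^esub> b) \<odot>\<^bsub>OA\<^esub> x = a \<odot>\<^bsub>OA\<^esub> (b \<odot>\<^bsub>OA\<^esub> x)"
    using x by (elim carrierE) (simp only: smult_cls A_scale ring_of_type_algebra_def monoid.simps mult.assoc)
  show "\<one>\<^bsub>ring_of_type_algebra\<^esub> \<odot>\<^bsub>OA\<^esub> x = x"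
    using x by (elim carrierE) (simp only: smult_cls ring_of_type_algebra_def monoid.simps mult_1)
  assume y: "y \<in> carrier OA"
  show "a \<odot>\<^bsub>OA\<^esub> (x \<oplus>\<^bsub>OA\<^esub> y) = a \<odot>\<^bsub>OA\<^esub> x \<oplus>\<^bsub>OA\<^esub> a \<odot>\<^bsub>OA\<^esub> y"
    using x y by (elim carrierE) (simp only: smult_cls add_cls A_add A_scale distrib_left)
qed

lemma diff_cls:
  assumes f: "f \<in> A" and g: "g \<in> A"
  shows "cls f \<ominus>\<^bsub>OA\<^esub> cls g = cls (\<lambda>s. f s - g s)"
proof -
  interpret abelian_group OA by (rule abelian_group_OA)
  have "cls (\<lambda>s. (- 1) * g s) \<oplus>\<^bsub>OA\<^esub> cls g = \<zero>\<^bsub>OA\<^esub>"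
    unfolding zero_cls by (subst add_cls[OF A_scale[OF g] g]) simp
  then have "\<ominus>\<^bsub>OA\<^esub> cls g = cls (\<lambda>s. (- 1) * g s)"
    by (rule minus_equality) (intro cls_carrier A_scale g)+
  then show ?thesis unfolding a_minus_def by (simp add: add_cls[OF f A_scale[OF g, of "- 1"], simplified])
qed

lemma A_diff: "f \<in> A \<Longrightarrow> g \<in> A \<Longrightarrow> (\<lambda>s. f s - g s) \<in> A"
  using A_add[of f "\<lambda>s. (- 1) * g s"] A_scale[of g "- 1"] by simp

text \<open>A Cauchy sequence converges almost everywhere along a subsequence, because the norm dominates the \<open>L\<^sup>1\<close> norm.
  Fatou for the Orlicz norm turns this into convergence in norm.\<close>

lemma complete_A:
  assumes f: "\<And>n::nat. f n \<in> A"
    and cauchy: "\<And>e. e > 0 \<Longrightarrow> \<exists>N. \<forall>m\<ge>N. \<forall>n\<ge>N. enn2real (wnorm (\<lambda>s. f m s - f n s)) < e"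
  shows "\<exists>g\<in>A. (\<lambda>n. enn2real (wnorm (\<lambda>s. f n s - g s))) \<longlonglongrightarrow> 0"
proof -
  obtain K where K: "K > 0" "\<And>h. h \<in> borel_measurable borel \<Longrightarrow> (\<integral>\<^sup>+s. mag h s \<partial>M) \<le> ennreal K * wnorm h"
    using L1_le_wnorm by blast
  have fm: "f n \<in> borel_measurable borel" for n using A_borel[OF f] .
  have fi: "integrable M (f n)" for n using subsetD[OF A_subset_L1 f] by (simp add: L1_iff_integrable[symmetric])
  have dA: "(\<lambda>s. f m s - f n s) \<in> A" for m n by (intro A_diff f)
  have L1_cauchy: "\<exists>N. \<forall>i\<ge>N. \<forall>j\<ge>N. (\<integral>x. norm (f i x - f j x) \<partial>M) < e" if e: "e > 0" for e
  proof -
    obtain N where N: "\<And>m n. m \<ge> N \<Longrightarrow> n \<ge> N \<Longrightarrow> enn2real (wnorm (\<lambda>s. f m s - f n s)) < e / K"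
      using cauchy[of "e / K"] e K(1) by auto
    have "(\<integral>x. norm (f i x - f j x) \<partial>M) < e" if "i \<ge> N" "j \<ge> N" for i j
    proof -
      have "ennreal (\<integral>x. norm (f i x - f j x) \<partial>M) = (\<integral>\<^sup>+s. mag (\<lambda>s. f i s - f j s) s \<partial>M)"
        using fi by (intro nn_integral_eq_integral[symmetric]) auto
      also have "\<dots> \<le> ennreal K * wnorm (\<lambda>s. f i s - f j s)" using A_borel[OF dA] by (rule K(2))
      also have "\<dots> = ennreal (K * enn2real (wnorm (\<lambda>s. f i s - f j s)))"
        by (subst ennreal_mult) (use K(1) in \<open>simp_all only: ennreal_wnorm[OF dA] less_imp_le enn2real_nonneg\<close>)
      finally have "(\<integral>x. norm (f i x - f j x) \<partial>M) \<le> K * enn2real (wnorm (\<lambda>s. f i s - f j s))"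
        using K(1) by (simp add: ennreal_le_iff)
      also have "\<dots> < K * (e / K)" using K(1) N[OF that] by (intro mult_strict_left_mono)
      finally show ?thesis using K(1) by simp
    qed
    then show ?thesis by blast
  qed
  obtain r where r: "strict_mono r" "AE x in M. Cauchy (\<lambda>i. f (r i) x)"
    by (rule cauchy_L1_AE_cauchy_subseq[OF fi L1_cauchy])
  define g where "g x = lim (\<lambda>i. f (r i) x)" for x
  have gm: "g \<in> borel_measurable borel" unfolding g_def[abs_def] using fm by (intro borel_measurable_lim_metric)
  have lim: "AE x in M. (\<lambda>i. f (r i) x) \<longlonglongrightarrow> g x"
    using r(2) by eventually_elim (simp add: g_def Cauchy_convergent_iff convergent_LIMSEQ_iff)
  have bound: "wnorm (\<lambda>s. f n s - g s) \<le> ennreal e"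
    if N: "\<And>m. m \<ge> N \<Longrightarrow> enn2real (wnorm (\<lambda>s. f n s - f m s)) \<le> e" for n N e
  proof -
    have "wnorm (\<lambda>s. f n s - g s) \<le> liminf (\<lambda>i. wnorm (\<lambda>s. f n s - f (r i) s))"
      unfolding wnorm_def
    proof (rule gauge_norm_liminf)
      show "(\<lambda>s. mag (\<lambda>s. f n s - f (r i) s) s * ennreal (weight s)) \<in> borel_measurable M" for i
        unfolding borel_measurable_M by (rule weighted_measurable[OF A_borel[OF dA]])
      show "AE s in M. mag (\<lambda>s. f n s - g s) s * ennreal (weight s) \<le>
          liminf (\<lambda>i. mag (\<lambda>s. f n s - f (r i) s) s * ennreal (weight s))"
        using lim
      proof eventually_elim
        case (elim s)
        have "(\<lambda>i. norm (f n s - f (r i) s) * weight s) \<longlonglongrightarrow> norm (f n s - g s) * weight s"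
          by (intro tendsto_intros elim)
        then have "(\<lambda>i. ennreal (norm (f n s - f (r i) s) * weight s)) \<longlonglongrightarrow> ennreal (norm (f n s - g s) * weight s)"
          by (rule tendsto_ennrealI)
        from lim_imp_Liminf[OF sequentially_bot this] show ?case by (simp add: ennreal_mult)
      qed
    qed
    also have "\<dots> \<le> ennreal e"
    proof (rule Liminf_le)
      show "eventually (\<lambda>i. wnorm (\<lambda>s. f n s - f (r i) s) \<le> ennreal e) sequentially"
      proof (rule eventually_sequentiallyI[of N])
        fix i assume "i \<ge> N"
        then have "r i \<ge> N" using seq_suble[OF r(1), of i] by simp
        from ennreal_leI[OF N[OF this]] show "wnorm (\<lambda>s. f n s - f (r i) s) \<le> ennreal e"
          by (simp only: ennreal_wnorm[OF dA])
      qed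
    qed simp
    finally show ?thesis .
  qed
  have dg: "(\<lambda>s. f n s - g s) \<in> borel_measurable borel" for n using fm gm by measurable
  have gA: "g \<in> A"
  proof -
    obtain N where N: "\<And>m n. m \<ge> N \<Longrightarrow> n \<ge> N \<Longrightarrow> enn2real (wnorm (\<lambda>s. f m s - f n s)) < 1"
      using cauchy[of 1] by auto
    have "wnorm (\<lambda>s. f N s - g s) \<le> ennreal 1" using N by (intro bound[of N]) (auto intro: less_imp_le)
    then have "wnorm (\<lambda>s. f N s - g s) < \<infinity>" by (rule le_less_trans) simp
    then have d: "(\<lambda>s. f N s - g s) \<in> A" using dg by simp
    from A_diff[OF f[of N] d] show ?thesis by simp
  qed
  have "(\<lambda>n. enn2real (wnorm (\<lambda>s. f n s - g s))) \<longlonglongrightarrow> 0"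
  proof (rule LIMSEQ_I)
    fix e :: real assume e: "0 < e"
    obtain N where N: "\<And>m n. m \<ge> N \<Longrightarrow> n \<ge> N \<Longrightarrow> enn2real (wnorm (\<lambda>s. f m s - f n s)) < e / 2"
      using cauchy[of "e / 2"] e by auto
    have "norm (enn2real (wnorm (\<lambda>s. f n s - g s)) - 0) < e" if "n \<ge> N" for n
    proof -
      have "wnorm (\<lambda>s. f n s - g s) \<le> ennreal (e / 2)" using N that by (intro bound[of N]) (auto intro: less_imp_le)
      then have "enn2real (wnorm (\<lambda>s. f n s - g s)) \<le> e / 2" using e by (intro enn2real_leI) auto
      then show ?thesis using e by simp
    qed
    then show "\<exists>N. \<forall>n\<ge>N. norm (enn2real (wnorm (\<lambda>s. f n s - g s)) - 0) < e" by blast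
  qed
  then show ?thesis using gA by blast
qed

lemma wnorm_eq_0_iff:
  assumes f: "f \<in> A"
  shows "wnorm f = 0 \<longleftrightarrow> (AE s in M. f s = 0)"
proof
  assume 0: "wnorm f = 0"
  obtain K where K: "\<And>h. h \<in> borel_measurable borel \<Longrightarrow> (\<integral>\<^sup>+s. mag h s \<partial>M) \<le> ennreal K * wnorm h"
    using L1_le_wnorm by blast
  have "(\<integral>\<^sup>+s. mag f s \<partial>M) = 0" using K[OF A_borel[OF f]] 0 by simp
  then show "AE s in M. f s = 0" using mag_measurable[OF A_borel[OF f]] by (simp add: nn_integral_0_iff_AE)
next
  assume "AE s in M. f s = 0"
  then have "wnorm f = wnorm (\<lambda>_. 0)" by (intro wnorm_cong_AE)
  also have "\<dots> = 0" using gauge_norm_cmult[of "\<lambda>_. 0" M \<Psi> 0] by (simp add: wnorm_def)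
  finally show "wnorm f = 0" .
qed

lemma wnorm_submultiplicative:
  "\<exists>C>0. \<forall>f\<in>A. \<forall>g\<in>A. wnorm (f \<circledast> g) \<le> ennreal C * wnorm f * wnorm g"
proof -
  obtain K where K: "K > 0" "\<And>h. h \<in> borel_measurable borel \<Longrightarrow> (\<integral>\<^sup>+s. mag h s \<partial>M) \<le> ennreal K * wnorm h"
    using L1_le_wnorm by blast
  have "wnorm (f \<circledast> g) \<le> ennreal (2 powr \<beta> * (2 * K)) * wnorm f * wnorm g" if f: "f \<in> A" and g: "g \<in> A" for f g
  proof -
    have "wnorm (f \<circledast> g) \<le> ennreal (2 powr \<beta>) * (wnorm f * (\<integral>\<^sup>+s. mag g s \<partial>M) + (\<integral>\<^sup>+s. mag f s \<partial>M) * wnorm g)"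
      by (rule wnorm_tconv[OF A_borel[OF f] A_borel[OF g]])
    also have "\<dots> \<le> ennreal (2 powr \<beta>) * (wnorm f * (ennreal K * wnorm g) + (ennreal K * wnorm f) * wnorm g)"
      by (intro mult_left_mono mult_right_mono add_mono K(2) A_borel f g) auto
    also have "\<dots> = ennreal (2 powr \<beta>) * (2 * ennreal K) * wnorm f * wnorm g"
      by (simp add: mult_2 algebra_simps)
    also have "ennreal (2 powr \<beta>) * (2 * ennreal K) = ennreal (2 powr \<beta> * (2 * K))"
      using K(1) by (simp add: ennreal_mult)
    finally show ?thesis .
  qed
  then show ?thesis using K(1) by (intro exI[of _ "2 powr \<beta> * (2 * K)"]) auto
qed

lemma banach_OA: "banach_star_algebra OA"
proof -
  have closed: "x \<otimes>\<^bsub>OA\<^esub> y \<in> carrier OA" if "x \<in> carrier OA" "y \<in> carrier OA" for x y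
    using that by (elim carrierE) (simp only: mult_cls, intro cls_carrier A_tconv)
  have assoc: "x \<otimes>\<^bsub>OA\<^esub> y \<otimes>\<^bsub>OA\<^esub> z = x \<otimes>\<^bsub>OA\<^esub> (y \<otimes>\<^bsub>OA\<^esub> z)"
    "(x \<oplus>\<^bsub>OA\<^esub> y) \<otimes>\<^bsub>OA\<^esub> z = (x \<otimes>\<^bsub>OA\<^esub> z) \<oplus>\<^bsub>OA\<^esub> (y \<otimes>\<^bsub>OA\<^esub> z)"
    "x \<otimes>\<^bsub>OA\<^esub> (y \<oplus>\<^bsub>OA\<^esub> z) = (x \<otimes>\<^bsub>OA\<^esub> y) \<oplus>\<^bsub>OA\<^esub> (x \<otimes>\<^bsub>OA\<^esub> z)"
    if xyz: "x \<in> carrier OA" "y \<in> carrier OA" "z \<in> carrier OA" for x y z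
  proof -
    obtain f where f: "f \<in> A" "x = cls f" by (rule carrierE[OF xyz(1)])
    obtain g where g: "g \<in> A" "y = cls g" by (rule carrierE[OF xyz(2)])
    obtain h where h: "h \<in> A" "z = cls h" by (rule carrierE[OF xyz(3)])
    note L = subsetD[OF A_subset_L1 f(1)] subsetD[OF A_subset_L1 g(1)] subsetD[OF A_subset_L1 h(1)]
    show "x \<otimes>\<^bsub>OA\<^esub> y \<otimes>\<^bsub>OA\<^esub> z = x \<otimes>\<^bsub>OA\<^esub> (y \<otimes>\<^bsub>OA\<^esub> z)"
      unfolding f(2) g(2) h(2) mult_cls[OF f(1) g(1)] mult_cls[OF g(1) h(1)]
        mult_cls[OF A_tconv[OF f(1) g(1)] h(1)] mult_cls[OF f(1) A_tconv[OF g(1) h(1)]]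
      by (rule cls_eqI[OF A_borel A_borel tconv_assoc[OF L]]) (intro A_tconv f g h)+
    show "(x \<oplus>\<^bsub>OA\<^esub> y) \<otimes>\<^bsub>OA\<^esub> z = (x \<otimes>\<^bsub>OA\<^esub> z) \<oplus>\<^bsub>OA\<^esub> (y \<otimes>\<^bsub>OA\<^esub> z)"
      unfolding f(2) g(2) h(2) add_cls[OF f(1) g(1)] mult_cls[OF f(1) h(1)] mult_cls[OF g(1) h(1)]
        mult_cls[OF A_add[OF f(1) g(1)] h(1)] add_cls[OF A_tconv[OF f(1) h(1)] A_tconv[OF g(1) h(1)]]
      by (rule cls_eqI[OF A_borel A_borel tconv_add_left[OF L]]) (intro A_tconv A_add f g h)+
    show "x \<otimes>\<^bsub>OA\<^esub> (y \<oplus>\<^bsub>OA\<^esub> z) = (x \<otimes>\<^bsub>OA\<^esub> y) \<oplus>\<^bsub>OA\<^esub> (x \<otimes>\<^bsub>OA\<^esub> z)"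
      unfolding f(2) g(2) h(2) add_cls[OF g(1) h(1)] mult_cls[OF f(1) g(1)] mult_cls[OF f(1) h(1)]
        mult_cls[OF f(1) A_add[OF g(1) h(1)]] add_cls[OF A_tconv[OF f(1) g(1)] A_tconv[OF f(1) h(1)]]
      by (rule cls_eqI[OF A_borel A_borel tconv_add_right[OF L]]) (intro A_tconv A_add f g h)+
  qed
  have scale: "(c \<odot>\<^bsub>OA\<^esub> x) \<otimes>\<^bsub>OA\<^esub> y = c \<odot>\<^bsub>OA\<^esub> (x \<otimes>\<^bsub>OA\<^esub> y)"
    "x \<otimes>\<^bsub>OA\<^esub> (c \<odot>\<^bsub>OA\<^esub> y) = c \<odot>\<^bsub>OA\<^esub> (x \<otimes>\<^bsub>OA\<^esub> y)"
    if xy: "x \<in> carrier OA" "y \<in> carrier OA" for c x y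
  proof -
    obtain f where f: "f \<in> A" "x = cls f" by (rule carrierE[OF xy(1)])
    obtain g where g: "g \<in> A" "y = cls g" by (rule carrierE[OF xy(2)])
    show "(c \<odot>\<^bsub>OA\<^esub> x) \<otimes>\<^bsub>OA\<^esub> y = c \<odot>\<^bsub>OA\<^esub> (x \<otimes>\<^bsub>OA\<^esub> y)"
      unfolding f(2) g(2) smult_cls[OF f(1)] mult_cls[OF A_scale[OF f(1)] g(1)] mult_cls[OF f(1) g(1)]
        smult_cls[OF A_tconv[OF f(1) g(1)]] tconv_scale_left ..
    show "x \<otimes>\<^bsub>OA\<^esub> (c \<odot>\<^bsub>OA\<^esub> y) = c \<odot>\<^bsub>OA\<^esub> (x \<otimes>\<^bsub>OA\<^esub> y)"
      unfolding f(2) g(2) smult_cls[OF g(1)] mult_cls[OF f(1) A_scale[OF g(1)]] mult_cls[OF f(1) g(1)]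
        smult_cls[OF A_tconv[OF f(1) g(1)]] tconv_scale_right ..
  qed
  have norm0: "0 \<le> vnorm OA x \<and> (vnorm OA x = 0 \<longleftrightarrow> x = \<zero>\<^bsub>OA\<^esub>)" if x: "x \<in> carrier OA" for x
  proof -
    obtain f where f: "f \<in> A" "x = cls f" using x by (rule carrierE)
    have "vnorm OA x = 0 \<longleftrightarrow> wnorm f = 0" unfolding f(2) vnorm_cls[OF f(1)] using f(1) by (auto simp: enn2real_eq_0_iff)
    also have "\<dots> \<longleftrightarrow> x = \<zero>\<^bsub>OA\<^esub>"
      unfolding f(2) zero_cls wnorm_eq_0_iff[OF f(1)] using f(1) by (subst cls_eq_iff) auto
    finally show ?thesis using f by (simp add: vnorm_cls)
  qed
  have normscale: "vnorm OA (c \<odot>\<^bsub>OA\<^esub> x) = norm c * vnorm OA x" if x: "x \<in> carrier OA" for c x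
  proof -
    obtain f where f: "f \<in> A" "x = cls f" by (rule carrierE[OF x])
    show ?thesis
      unfolding f(2) smult_cls[OF f(1)] vnorm_cls[OF f(1)] vnorm_cls[OF A_scale[OF f(1)]] wnorm_scale[OF A_borel[OF f(1)]]
      by (simp add: enn2real_mult)
  qed
  have normadd: "vnorm OA (x \<oplus>\<^bsub>OA\<^esub> y) \<le> vnorm OA x + vnorm OA y" if xy: "x \<in> carrier OA" "y \<in> carrier OA" for x y
  proof -
    obtain f where f: "f \<in> A" "x = cls f" by (rule carrierE[OF xy(1)])
    obtain g where g: "g \<in> A" "y = cls g" by (rule carrierE[OF xy(2)])
    have "wnorm (\<lambda>s. f s + g s) \<le> wnorm f + wnorm g" using f g by (intro wnorm_add) auto
    also have "\<dots> = ennreal (enn2real (wnorm f) + enn2real (wnorm g))"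
      by (subst ennreal_plus) (simp_all only: enn2real_nonneg ennreal_wnorm[OF f(1)] ennreal_wnorm[OF g(1)])
    finally show ?thesis
      unfolding f(2) g(2) add_cls[OF f(1) g(1)] vnorm_cls[OF f(1)] vnorm_cls[OF g(1)] vnorm_cls[OF A_add[OF f(1) g(1)]]
      by (intro enn2real_leI) auto
  qed
  have normmult: "\<exists>C>0. \<forall>x\<in>carrier OA. \<forall>y\<in>carrier OA. vnorm OA (x \<otimes>\<^bsub>OA\<^esub> y) \<le> C * vnorm OA x * vnorm OA y"
  proof -
    obtain C where C: "C > 0" "\<And>f g. f \<in> A \<Longrightarrow> g \<in> A \<Longrightarrow> wnorm (f \<circledast> g) \<le> ennreal C * wnorm f * wnorm g"
      using wnorm_submultiplicative by blast
    have "vnorm OA (x \<otimes>\<^bsub>OA\<^esub> y) \<le> C * vnorm OA x * vnorm OA y" if xy: "x \<in> carrier OA" "y \<in> carrier OA" for x y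
    proof -
      obtain f where f: "f \<in> A" "x = cls f" by (rule carrierE[OF xy(1)])
    obtain g where g: "g \<in> A" "y = cls g" by (rule carrierE[OF xy(2)])
      have "ennreal C * wnorm f * wnorm g = ennreal C * ennreal (enn2real (wnorm f)) * ennreal (enn2real (wnorm g))"
        by (simp only: ennreal_wnorm[OF f(1)] ennreal_wnorm[OF g(1)])
      also have "\<dots> = ennreal (C * enn2real (wnorm f) * enn2real (wnorm g))"
        using C(1) by (simp add: ennreal_mult del: ennreal_enn2real ennreal_enn2real_if)
      finally show ?thesis
        unfolding f(2) g(2) mult_cls[OF f(1) g(1)] vnorm_cls[OF f(1)] vnorm_cls[OF g(1)] vnorm_cls[OF A_tconv[OF f(1) g(1)]]
        using C(2)[OF f(1) g(1)] C(1) by (intro enn2real_leI) auto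
    qed
    then show ?thesis using C(1) by blast
  qed
  have compl: "\<exists>x\<in>carrier OA. (\<lambda>n. vnorm OA (F n \<ominus>\<^bsub>OA\<^esub> x)) \<longlonglongrightarrow> 0"
    if F: "range F \<subseteq> carrier OA" and c: "\<forall>e>0. \<exists>N. \<forall>m\<ge>N. \<forall>n\<ge>N. vnorm OA (F m \<ominus>\<^bsub>OA\<^esub> F n) < e" for F :: "nat \<Rightarrow> _"
  proof -
    have "\<exists>f. f \<in> A \<and> F n = cls f" for n
    proof -
      have "F n \<in> carrier OA" using F by (rule subsetD) simp
      then obtain f where "f \<in> A" "F n = cls f" by (rule carrierE)
      then show ?thesis by (intro exI[of _ f] conjI)
    qed
    then have "\<exists>f. \<forall>n. f n \<in> A \<and> F n = cls (f n)" by (intro choice allI)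
    then obtain f where f0: "\<forall>n. f n \<in> A \<and> F n = cls (f n)" ..
    have f: "\<And>n. f n \<in> A" "\<And>n. F n = cls (f n)" using f0 by (simp_all only:)
    have d: "vnorm OA (F m \<ominus>\<^bsub>OA\<^esub> F n) = enn2real (wnorm (\<lambda>s. f m s - f n s))" for m n
      unfolding f(2) diff_cls[OF f(1) f(1)] by (rule vnorm_cls[OF A_diff[OF f(1) f(1)]])
    have "\<exists>g\<in>A. (\<lambda>n. enn2real (wnorm (\<lambda>s. f n s - g s))) \<longlonglongrightarrow> 0"
      by (rule complete_A[OF f(1)]) (rule c[unfolded d, rule_format])
    then obtain g where g: "g \<in> A" "(\<lambda>n. enn2real (wnorm (\<lambda>s. f n s - g s))) \<longlonglongrightarrow> 0" by (rule bexE)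
    have "vnorm OA (F n \<ominus>\<^bsub>OA\<^esub> cls g) = enn2real (wnorm (\<lambda>s. f n s - g s))" for n
      unfolding f(2) diff_cls[OF f(1) g(1)] by (rule vnorm_cls[OF A_diff[OF f(1) g(1)]])
    then have "(\<lambda>n. vnorm OA (F n \<ominus>\<^bsub>OA\<^esub> cls g)) \<longlonglongrightarrow> 0" using g(2) by (simp only:)
    then show ?thesis using cls_carrier[OF g(1)] by (rule bexI)
  qed
  have inv1: "invol OA x \<in> carrier OA \<and> invol OA (invol OA x) = x \<and> vnorm OA (invol OA x) = vnorm OA x"
    if x: "x \<in> carrier OA" for x
  proof -
    obtain f where f: "f \<in> A" "x = cls f" using x by (rule carrierE)
    show ?thesis
      unfolding f(2) invol_cls[OF f(1)] invol_cls[OF A_tinvol[OF f(1)]] vnorm_cls[OF f(1)] vnorm_cls[OF A_tinvol[OF f(1)]]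
        wnorm_tinvol[OF A_borel[OF f(1)]] tinvol_tinvol
      using cls_carrier[OF A_tinvol[OF f(1)]] by simp
  qed
  have inv2: "invol OA (x \<oplus>\<^bsub>OA\<^esub> y) = invol OA x \<oplus>\<^bsub>OA\<^esub> invol OA y \<and>
      invol OA (x \<otimes>\<^bsub>OA\<^esub> y) = invol OA y \<otimes>\<^bsub>OA\<^esub> invol OA x" if xy: "x \<in> carrier OA" "y \<in> carrier OA" for x y
  proof -
    obtain f where f: "f \<in> A" "x = cls f" by (rule carrierE[OF xy(1)])
    obtain g where g: "g \<in> A" "y = cls g" by (rule carrierE[OF xy(2)])
    have "inv_t (\<lambda>s. f s + g s) = (\<lambda>s. inv_t f s + inv_t g s)" by (simp add: tinvol_def fun_eq_iff distrib_right)
    then show ?thesis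
      unfolding f(2) g(2) add_cls[OF f(1) g(1)] mult_cls[OF f(1) g(1)] invol_cls[OF f(1)] invol_cls[OF g(1)]
        invol_cls[OF A_add[OF f(1) g(1)]] invol_cls[OF A_tconv[OF f(1) g(1)]]
        add_cls[OF A_tinvol[OF f(1)] A_tinvol[OF g(1)]] mult_cls[OF A_tinvol[OF g(1)] A_tinvol[OF f(1)]]
      using tinvol_tconv[OF A_borel[OF f(1)] A_borel[OF g(1)]] by simp
  qed
  have inv3: "invol OA (c \<odot>\<^bsub>OA\<^esub> x) = cnj c \<odot>\<^bsub>OA\<^esub> invol OA x" if x: "x \<in> carrier OA" for c x
  proof -
    obtain f where f: "f \<in> A" "x = cls f" using x by (rule carrierE)
    have "inv_t (\<lambda>s. c * f s) = (\<lambda>s. cnj c * inv_t f s)" by (simp add: tinvol_def fun_eq_iff mult.assoc)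
    then show ?thesis
      unfolding f(2) smult_cls[OF f(1)] invol_cls[OF A_scale[OF f(1)]] invol_cls[OF f(1)] smult_cls[OF A_tinvol[OF f(1)]]
      by simp
  qed
  show ?thesis
    unfolding banach_star_algebra_def
    apply (intro conjI)
    subgoal by (rule module_OA)
    subgoal by (intro ballI) (rule closed)
    subgoal by (intro ballI conjI) (rule assoc; assumption)+
    subgoal by (intro allI ballI conjI) (rule scale; assumption)+
    subgoal by (intro ballI) (rule norm0)
    subgoal by (intro allI ballI) (rule normscale)
    subgoal by (intro ballI) (rule normadd)
    subgoal by (rule normmult)
    subgoal by (intro allI impI) (rule compl)
    subgoal by (intro ballI) (rule inv1)
    subgoal by (intro ballI) (rule inv2)
    subgoal by (intro allI ballI) (rule inv3)
    done
qed


lemma L1_mono_A: "f \<in> A \<Longrightarrow> (\<integral>\<^sup>+s. mag f s \<partial>M) < \<infinity>"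
  using A_subset_L1 by blast

definition one_norm :: "('a \<Rightarrow> complex) set \<Rightarrow> real" where
  "one_norm F = enn2real (\<integral>\<^sup>+s. mag (rep F) s \<partial>M)"

definition two_norm :: "('a \<Rightarrow> complex) set \<Rightarrow> real" where
  "two_norm F = sqrt (enn2real (\<integral>\<^sup>+s. (mag (rep F) s)\<^sup>2 \<partial>M))"

lemma one_norm_cls: "f \<in> A \<Longrightarrow> one_norm (cls f) = enn2real (\<integral>\<^sup>+s. mag f s \<partial>M)"
  unfolding one_norm_def using rep_cls(2)[OF A_borel[of f]]
  by (intro arg_cong[where f=enn2real] nn_integral_cong_AE) (auto elim: eventually_mono)

lemma two_norm_cls: "f \<in> A \<Longrightarrow> two_norm (cls f) = sqrt (enn2real (\<integral>\<^sup>+s. (mag f s)\<^sup>2 \<partial>M))"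
  unfolding two_norm_def using rep_cls(2)[OF A_borel[of f]]
  by (intro arg_cong[where f=sqrt] arg_cong[where f=enn2real] nn_integral_cong_AE) (auto elim: eventually_mono)

lemma ennreal_L1: "f \<in> A \<Longrightarrow> ennreal (enn2real (\<integral>\<^sup>+s. mag f s \<partial>M)) = (\<integral>\<^sup>+s. mag f s \<partial>M)"
  using L1_mono_A[of f] by simp

lemma L2_add: "f \<in> L2 \<Longrightarrow> g \<in> L2 \<Longrightarrow> (\<lambda>s. f s + g s) \<in> L2"
proof -
  assume f: "f \<in> L2" and g: "g \<in> L2"
  then have [measurable]: "f \<in> borel_measurable borel" "g \<in> borel_measurable borel" by auto
  have "(\<integral>\<^sup>+s. (mag (\<lambda>s. f s + g s) s)\<^sup>2 \<partial>M) \<le> (\<integral>\<^sup>+s. 2 * (mag f s)\<^sup>2 + 2 * (mag g s)\<^sup>2 \<partial>M)"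
  proof (rule nn_integral_mono)
    fix s
    have "(norm (f s + g s))\<^sup>2 \<le> (norm (f s) + norm (g s))\<^sup>2" by (intro power_mono norm_triangle_ineq) simp
    also have "\<dots> \<le> 2 * (norm (f s))\<^sup>2 + 2 * (norm (g s))\<^sup>2"
      using sum_squares_bound[of "norm (f s)" "norm (g s)"] by (simp add: power2_sum)
    finally have "ennreal ((norm (f s + g s))\<^sup>2) \<le> ennreal (2 * (norm (f s))\<^sup>2 + 2 * (norm (g s))\<^sup>2)" by (rule ennreal_leI)
    then show "(mag (\<lambda>s. f s + g s) s)\<^sup>2 \<le> 2 * (mag f s)\<^sup>2 + 2 * (mag g s)\<^sup>2"
      by (simp add: ennreal_power ennreal_mult)
  qed
  also have "\<dots> = 2 * (\<integral>\<^sup>+s. (mag f s)\<^sup>2 \<partial>M) + 2 * (\<integral>\<^sup>+s. (mag g s)\<^sup>2 \<partial>M)"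
    by (subst nn_integral_add) (auto simp: nn_integral_cmult)
  also have "\<dots> < \<infinity>" using f g by (auto simp: ennreal_mult_less_top)
  finally show ?thesis by simp
qed

lemma L2_scale: "f \<in> L2 \<Longrightarrow> (\<lambda>s. c * f s) \<in> L2"
proof -
  assume f: "f \<in> L2"
  then have [measurable]: "f \<in> borel_measurable borel" by auto
  have "(\<integral>\<^sup>+s. (mag (\<lambda>s. c * f s) s)\<^sup>2 \<partial>M) = (ennreal (norm c))\<^sup>2 * (\<integral>\<^sup>+s. (mag f s)\<^sup>2 \<partial>M)"
    by (subst nn_integral_cmult[symmetric]) (auto simp: norm_mult ennreal_mult power_mult_distrib)
  then show ?thesis using f by (auto simp: ennreal_mult_less_top power2_eq_square)
qed

text \<open>In the algebra, \<open>a\<^sup>* \<otimes> a\<close> acts on the square integrable classes as a positive operator of norm at most \<open>N\<^sup>2\<close> for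
  \<open>N = one_norm a\<close>; shifted by \<open>\<gamma>\<close> with \<open>Re \<gamma> = - N\<^sup>2 / 2\<close> it has norm at most \<open>norm \<gamma>\<close>.\<close>

lemma two_norm_contraction:
  assumes a: "a \<in> A" and b: "b \<in> A \<inter> L2" and \<gamma>: "Re \<gamma> = - (one_norm (cls a))\<^sup>2 / 2"
  shows "two_norm ((invol OA (cls a) \<otimes>\<^bsub>OA\<^esub> cls a) \<otimes>\<^bsub>OA\<^esub> cls b \<oplus>\<^bsub>OA\<^esub> \<gamma> \<odot>\<^bsub>OA\<^esub> cls b) \<le> norm \<gamma> * two_norm (cls b)"
proof -
  have bA: "b \<in> A" and bL2: "b \<in> L2" using b by auto
  let ?c = "- \<gamma>"
  let ?h = "inv_t a \<circledast> a"
  let ?k = "\<lambda>s. (?h \<circledast> b) s + \<gamma> * b s"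
  note aL = subsetD[OF A_subset_L1 a] and bL = subsetD[OF A_subset_L1 bA]
  have N: "one_norm (cls a) = (\<integral>s. norm (a s) \<partial>M)"
  proof -
    have "(\<integral>\<^sup>+s. mag a s \<partial>M) = ennreal (\<integral>s. norm (a s) \<partial>M)"
      using aL by (intro nn_integral_eq_integral) (auto simp: integrable_iff_bounded)
    then show ?thesis by (simp add: one_norm_cls[OF a])
  qed
  have c: "(\<integral>s. norm (a s) \<partial>M)\<^sup>2 \<le> 2 * Re ?c" using \<gamma> by (simp add: N)
  have hA: "?h \<in> A" by (intro A_tconv A_tinvol a)
  have kA: "?k \<in> A" by (intro A_add A_tconv A_scale hA bA)
  have eq: "(invol OA (cls a) \<otimes>\<^bsub>OA\<^esub> cls a) \<otimes>\<^bsub>OA\<^esub> cls b \<oplus>\<^bsub>OA\<^esub> \<gamma> \<odot>\<^bsub>OA\<^esub> cls b = cls ?k"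
    unfolding invol_cls[OF a] mult_cls[OF A_tinvol[OF a] a] mult_cls[OF hA bA] smult_cls[OF bA]
      add_cls[OF A_tconv[OF hA bA] A_scale[OF bA]] ..
  have "(\<integral>\<^sup>+s. (mag ?k s)\<^sup>2 \<partial>M) = (\<integral>\<^sup>+t. (ennreal (norm ((inv_t a \<circledast> (a \<circledast> b)) t - ?c * b t)))\<^sup>2 \<partial>M)"
    using tconv_assoc[OF L1_tinvol[OF aL] aL bL]
    by (intro nn_integral_cong_AE) (auto elim!: eventually_mono)
  also have "\<dots> \<le> ennreal ((norm ?c)\<^sup>2) * (\<integral>\<^sup>+t. (mag b t)\<^sup>2 \<partial>M)"
    by (rule shifted_square_bound[OF aL bL2 c])
  finally have le: "(\<integral>\<^sup>+s. (mag ?k s)\<^sup>2 \<partial>M) \<le> ennreal ((norm \<gamma>)\<^sup>2) * (\<integral>\<^sup>+t. (mag b t)\<^sup>2 \<partial>M)" by simp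
  moreover have "ennreal ((norm \<gamma>)\<^sup>2) * (\<integral>\<^sup>+t. (mag b t)\<^sup>2 \<partial>M) < \<infinity>" using bL2 by (simp add: ennreal_mult_less_top)
  ultimately have "enn2real (\<integral>\<^sup>+s. (mag ?k s)\<^sup>2 \<partial>M) \<le> (norm \<gamma>)\<^sup>2 * enn2real (\<integral>\<^sup>+t. (mag b t)\<^sup>2 \<partial>M)"
    using enn2real_mono[OF le] by (simp add: enn2real_mult)
  then have "sqrt (enn2real (\<integral>\<^sup>+s. (mag ?k s)\<^sup>2 \<partial>M)) \<le> sqrt ((norm \<gamma>)\<^sup>2 * enn2real (\<integral>\<^sup>+t. (mag b t)\<^sup>2 \<partial>M))"
    by (rule real_sqrt_le_mono)
  then show ?thesis unfolding eq two_norm_cls[OF kA] two_norm_cls[OF bA] by (simp add: real_sqrt_mult)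
qed

lemma symmetric_OA: "symmetric_star_algebra OA"
proof -
  obtain \<delta> K E where c: "\<delta> > 0" "K \<ge> 0" "E \<ge> 0" and interp: "\<And>f k. f \<in> A \<inter> L2 \<Longrightarrow> k \<ge> (1::nat) \<Longrightarrow>
    enn2real (\<integral>\<^sup>+s. mag f s \<partial>M) \<le> E * real k ^ d * sqrt (enn2real (\<integral>\<^sup>+s. (mag f s)\<^sup>2 \<partial>M))
      + K * real k powr (- \<delta>) * enn2real (wnorm f)"
    using L1_interpolation by blast
  have "spectral_control OA one_norm two_norm (cls ` (A \<inter> L2)) (2 powr \<beta>) K E \<delta> d"
  proof (intro spectral_control.intro spectral_control_axioms.intro banach_star_alg.intro banach_OA)
    show "0 \<le> 2 powr \<beta>" "0 \<le> K" "0 \<le> E" "0 < \<delta>" using c by auto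
    fix x y assume x: "x \<in> carrier OA" and y: "y \<in> carrier OA"
    obtain f where f: "f \<in> A" "x = cls f" by (rule carrierE[OF x])
    obtain g where g: "g \<in> A" "y = cls g" by (rule carrierE[OF y])
    show "one_norm (x \<oplus>\<^bsub>OA\<^esub> y) \<le> one_norm x + one_norm y"
    proof -
      have "(\<integral>\<^sup>+s. mag (\<lambda>s. f s + g s) s \<partial>M) \<le> (\<integral>\<^sup>+s. mag f s + mag g s \<partial>M)"
        by (intro nn_integral_mono) (simp add: ennreal_plus[symmetric] norm_triangle_ineq ennreal_leI del: ennreal_plus)
      also have "\<dots> = (\<integral>\<^sup>+s. mag f s \<partial>M) + (\<integral>\<^sup>+s. mag g s \<partial>M)"
        using mag_measurable[OF A_borel[OF f(1)]] mag_measurable[OF A_borel[OF g(1)]] by (intro nn_integral_add) auto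
      also have "\<dots> = ennreal (enn2real (\<integral>\<^sup>+s. mag f s \<partial>M) + enn2real (\<integral>\<^sup>+s. mag g s \<partial>M))"
        by (subst ennreal_plus) (simp_all only: enn2real_nonneg ennreal_L1[OF f(1)] ennreal_L1[OF g(1)])
      finally show ?thesis
        unfolding f(2) g(2) add_cls[OF f(1) g(1)] one_norm_cls[OF f(1)] one_norm_cls[OF g(1)] one_norm_cls[OF A_add[OF f(1) g(1)]]
        by (intro enn2real_leI) auto
    qed
    show "one_norm (x \<otimes>\<^bsub>OA\<^esub> y) \<le> one_norm x * one_norm y"
    proof -
      have "(\<integral>\<^sup>+s. mag (f \<circledast> g) s \<partial>M) \<le> (\<integral>\<^sup>+s. mag f s \<partial>M) * (\<integral>\<^sup>+s. mag g s \<partial>M)"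
        by (rule L1_norm_tconv[OF A_borel[OF f(1)] A_borel[OF g(1)]])
      also have "\<dots> = ennreal (enn2real (\<integral>\<^sup>+s. mag f s \<partial>M) * enn2real (\<integral>\<^sup>+s. mag g s \<partial>M))"
        by (subst ennreal_mult) (simp_all only: enn2real_nonneg ennreal_L1[OF f(1)] ennreal_L1[OF g(1)])
      finally show ?thesis
        unfolding f(2) g(2) mult_cls[OF f(1) g(1)] one_norm_cls[OF f(1)] one_norm_cls[OF g(1)] one_norm_cls[OF A_tconv[OF f(1) g(1)]]
        by (intro enn2real_leI) auto
    qed
    show "vnorm OA (x \<otimes>\<^bsub>OA\<^esub> y) \<le> 2 powr \<beta> * (vnorm OA x * one_norm y + one_norm x * vnorm OA y)"
    proof -
      let ?wf = "enn2real (wnorm f)" and ?wg = "enn2real (wnorm g)"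
        and ?f1 = "enn2real (\<integral>\<^sup>+s. mag f s \<partial>M)" and ?g1 = "enn2real (\<integral>\<^sup>+s. mag g s \<partial>M)"
      have gen: "ennreal p * (ennreal q * ennreal r + ennreal u * ennreal v) = ennreal (p * (q * r + u * v))"
        if "0 \<le> p" "0 \<le> q" "0 \<le> r" "0 \<le> u" "0 \<le> v" for p q r u v
        using that by (simp add: ennreal_mult)
      have "wnorm (f \<circledast> g) \<le> ennreal (2 powr \<beta>) * (wnorm f * (\<integral>\<^sup>+s. mag g s \<partial>M) + (\<integral>\<^sup>+s. mag f s \<partial>M) * wnorm g)"
        by (rule wnorm_tconv[OF A_borel[OF f(1)] A_borel[OF g(1)]])
      also have "\<dots> = ennreal (2 powr \<beta> * (?wf * ?g1 + ?f1 * ?wg))"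
        using gen[of "2 powr \<beta>" ?wf ?g1 ?f1 ?wg]
        unfolding ennreal_wnorm[OF f(1)] ennreal_wnorm[OF g(1)] ennreal_L1[OF f(1)] ennreal_L1[OF g(1)] by simp
      finally show ?thesis
        unfolding f(2) g(2) mult_cls[OF f(1) g(1)] one_norm_cls[OF f(1)] one_norm_cls[OF g(1)]
          vnorm_cls[OF f(1)] vnorm_cls[OF g(1)] vnorm_cls[OF A_tconv[OF f(1) g(1)]]
        by (intro enn2real_leI) auto
    qed
  next
    fix x assume x: "x \<in> carrier OA"
    then obtain f where f: "f \<in> A" "x = cls f" by (rule carrierE)
    show "0 \<le> one_norm x" by (simp add: one_norm_def)
    show "one_norm (c \<odot>\<^bsub>OA\<^esub> x) = norm c * one_norm x" for c
    proof -
      have "(\<integral>\<^sup>+s. mag (\<lambda>s. c * f s) s \<partial>M) = ennreal (norm c) * (\<integral>\<^sup>+s. mag f s \<partial>M)"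
        using mag_measurable[OF A_borel[OF f(1)]] by (simp add: norm_mult ennreal_mult nn_integral_cmult)
      then show ?thesis
        unfolding f(2) smult_cls[OF f(1)] one_norm_cls[OF f(1)] one_norm_cls[OF A_scale[OF f(1)]] by (simp add: enn2real_mult)
    qed
    show "\<exists>b\<in>cls ` (A \<inter> L2). one_norm (x \<ominus>\<^bsub>OA\<^esub> b) < \<epsilon>" if \<epsilon>: "0 < \<epsilon>" for \<epsilon>
    proof -
      obtain b where b: "b \<in> A \<inter> L2" "(\<integral>\<^sup>+s. ennreal (norm (f s - b s)) \<partial>M) < ennreal \<epsilon>"
        using truncation_dense[OF f(1) \<epsilon>] by blast
      then have bA: "b \<in> A" by simp
      have "one_norm (x \<ominus>\<^bsub>OA\<^esub> cls b) < \<epsilon>"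
        unfolding f(2) diff_cls[OF f(1) bA] one_norm_cls[OF A_diff[OF f(1) bA]]
        using b(2) \<epsilon> by (cases "\<integral>\<^sup>+s. ennreal (norm (f s - b s)) \<partial>M") (auto simp: ennreal_less_iff)
      then show ?thesis using b(1) by blast
    qed
    show "x \<otimes>\<^bsub>OA\<^esub> b \<in> cls ` (A \<inter> L2)" if b: "b \<in> cls ` (A \<inter> L2)" for b
    proof -
      obtain g where g: "g \<in> A" "g \<in> L2" "b = cls g" using b by blast
      show ?thesis unfolding f(2) g(3) mult_cls[OF f(1) g(1)]
        using A_tconv[OF f(1) g(1)] L2_tconv[OF subsetD[OF A_subset_L1 f(1)] g(2)] by blast
    qed
    show "\<exists>m\<le>0. \<forall>\<gamma>. Re \<gamma> = m \<longrightarrow> (\<forall>b\<in>cls ` (A \<inter> L2).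
        two_norm ((invol OA x \<otimes>\<^bsub>OA\<^esub> x) \<otimes>\<^bsub>OA\<^esub> b \<oplus>\<^bsub>OA\<^esub> \<gamma> \<odot>\<^bsub>OA\<^esub> b) \<le> norm \<gamma> * two_norm b)"
    proof (intro exI[of _ "- (one_norm x)\<^sup>2 / 2"] conjI allI impI ballI)
      fix \<gamma> b assume g: "Re \<gamma> = - (one_norm x)\<^sup>2 / 2" and "b \<in> cls ` (A \<inter> L2)"
      then obtain g' where g': "g' \<in> A \<inter> L2" "b = cls g'" by blast
      show "two_norm ((invol OA x \<otimes>\<^bsub>OA\<^esub> x) \<otimes>\<^bsub>OA\<^esub> b \<oplus>\<^bsub>OA\<^esub> \<gamma> \<odot>\<^bsub>OA\<^esub> b) \<le> norm \<gamma> * two_norm b"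
        unfolding f(2) g'(2) by (rule two_norm_contraction[OF f(1) g'(1) g[unfolded f(2)]])
    qed simp
  next
    fix b assume b: "b \<in> cls ` (A \<inter> L2)"
    then obtain f where f: "f \<in> A" "f \<in> L2" "b = cls f" by blast
    show "b \<in> carrier OA" unfolding f(3) by (rule cls_carrier[OF f(1)])
    show "0 \<le> two_norm b" by (simp add: two_norm_def)
    show "c \<odot>\<^bsub>OA\<^esub> b \<in> cls ` (A \<inter> L2)" for c
      unfolding f(3) smult_cls[OF f(1)] using A_scale[OF f(1)] L2_scale[OF f(2)] by blast
    show "b \<oplus>\<^bsub>OA\<^esub> b' \<in> cls ` (A \<inter> L2)" if b': "b' \<in> cls ` (A \<inter> L2)" for b'
    proof -
      obtain g where g: "g \<in> A" "g \<in> L2" "b' = cls g" using b' by blast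
      show ?thesis unfolding f(3) g(3) add_cls[OF f(1) g(1)] using A_add[OF f(1) g(1)] L2_add[OF f(2) g(2)] by blast
    qed
    show "one_norm b \<le> E * real k ^ d * two_norm b + K * real k powr (- \<delta>) * vnorm OA b" if "k \<ge> 1" for k :: nat
      unfolding f(3) one_norm_cls[OF f(1)] two_norm_cls[OF f(1)] vnorm_cls[OF f(1)]
      using f(1,2) that by (intro interp) auto
  qed
  then show ?thesis by (rule spectral_control.symmetric)
qed

theorem symmetric_orlicz: "symmetric_twisted_orlicz_algebra M \<Phi> \<Psi> weight \<Omega>"
  unfolding symmetric_twisted_orlicz_algebra_def worlicz_space_eq worlicz_norm_eq
proof (intro conjI banach_OA symmetric_OA)
  obtain C where C: "C > 0" "\<And>f g. f \<in> A \<Longrightarrow> g \<in> A \<Longrightarrow> wnorm (f \<circledast> g) \<le> ennreal C * wnorm f * wnorm g"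
    using wnorm_submultiplicative by blast
  show "\<exists>C>0. \<forall>f\<in>A. \<forall>g\<in>A. (AE t in M. integrable M (tconv_integrand \<Omega> f g t)) \<and> f \<circledast> g \<in> A \<and>
      wnorm (f \<circledast> g) \<le> ennreal C * wnorm f * wnorm g"
    by (rule exI[of _ C], rule conjI[OF C(1)], intro ballI conjI AE_integrable_tconv subsetD[OF A_subset_L1] A_tconv C(2))
qed

end

theorem corollary5p3:
  fixes M :: "'g::{topological_group_add, t2_space} measure"
    and U :: "'g set"
    and \<Phi> \<Psi> :: "real \<Rightarrow> ennreal"
    and \<Omega> :: "'g \<Rightarrow> 'g \<Rightarrow> complex"
    and d :: nat
    and l \<beta> :: real
  assumes "locally_compact_space (euclidean :: 'g topology)"
    and "left_haar_measure M"
    and "generating_nbhd U"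
    and "polynomial_growth M U"
    and "complementary_young_pair \<Phi> \<Psi>"
    and "\<forall>x\<ge>0. \<Phi> x < \<infinity>"
    and "continuous_on {0..} \<Phi>"
    and "\<forall>x>0. \<Phi> x > 0"
    and "circle_cocycle \<Omega>"
    and "d = growth_order M U"
    and "l \<ge> 1"
    and "\<exists>L<\<infinity>. ((\<lambda>x. \<Psi> x / ennreal (x powr l)) \<longlongrightarrow> L) (at_right 0)"
    and "\<beta> > real d / l"
  shows "symmetric_twisted_orlicz_algebra M \<Phi> \<Psi> (poly_weight U \<beta>) \<Omega>"
proof -
  have "growth_bound M U d"
    using assms(4) unfolding \<open>d = growth_order M U\<close> growth_order_def polynomial_growth_def by (rule LeastI_ex)
  then interpret orlicz_group M U d \<Omega> \<Phi> \<Psi> l \<beta>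
    using assms by unfold_locales
  show ?thesis by (rule symmetric_orlicz)
qed

end
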